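(* Let $G$ be the fundamental group of a graph of groups $(\mathcal{G},\Gamma)$, where $\Gamma$ is a finite connected graph with $\chi(\Gamma) = 0$. Suppose that all vertex groups $G_v$, $v \in V\Gamma$, are finitely generated abelian and there exists an edge $e \in E\Gamma$ such that $e \notin ET$, for some maximal tree $T$ in $\Gamma$, and $G_e$ is cyclic. Then $G$ has property (VRC) if and only if $G$ is balanced.
   Context: A subgroup $H$ of a group $G$ is a virtual retract of $G$ if there is a finite index subgroup $K$ of $G$ such that $H \subseteq K$ and there is a homomorphism $\rho: K \to H$ whose restriction to $H$ is the identity map. A group has property (VRC) if every cyclic subgroup is a virtual retract. A group $G$ is balanced if for every infinite order element $g \in G$ and all $k,l \in \mathbb{Z}\setminus\{0\}$, if $g^k$ is conjugate to $g^l$ in $G$ then $l = \pm k$. Graphs are in the sense of Serre: a graph $\Gamma$ has a vertex set $V\Gamma$, an edge set $E\Gamma$, an inversion map $e \mapsto \overline{e}$ on $E\Gamma$ with $\overline{e} \ne e$ and $\overline{\overline{e}} = e$, and incidence maps $\alpha,\omega: E\Gamma \to V\Gamma$ with $\omega(\overline{e}) = \alpha(e)$. The Euler characteristic of a finite graph is $\chi(\Gamma) = |V\Gamma| - \frac12 |E\Gamma|$. An orientation is a decomposition $E\Gamma = E\Gamma^+ \sqcup E\Gamma^-$ with $E\Gamma^- = \{\overline{e} \mid e \in E\Gamma^+\}$. A finite graph of groups $(\mathcal{G},\Gamma)$ consists of a non-empty finite connected graph $\Gamma$, vertex groups $G_v$ ($v \in V\Gamma$), edge groups $G_e$ ($e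 \in E\Gamma$) with $G_e = G_{\overline{e}}$, and monomorphisms $\alpha_e: G_e \to G_{\alpha(e)}$ ($e \in E\Gamma$); put $\omega_e := \alpha_{\overline{e}}: G_e \to G_{\omega(e)}$. Given a maximal tree $T$ in $\Gamma$ and an orientation, its fundamental group is the group generated by all $G_v$, $v \in V\Gamma$, and free letters $t_e$, $e \in E\Gamma^+$, subject to the relations of the vertex groups, $t_e\, \omega_e(a)\, t_e^{-1} = \alpha_e(a)$ for all $e \in E\Gamma^+$, $a \in G_e$, and $t_f = 1$ for all $f \in ET \cap E\Gamma^+$; up to isomorphism it does not depend on the choices. *)

theory Defs
  imports "HOL-Algebra.Algebra" Complex_Main
begin

section \<open>Virtual retracts, (VRC), balanced groups\<close>

definition finitely_generated_group :: "('a, 'm) monoid_scheme \<Rightarrow> bool" where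
  "finitely_generated_group G \<longleftrightarrow>
     (\<exists>S. finite S \<and> S \<subseteq> carrier G \<and> generate G S = carrier G)"

definition virtual_retract :: "'a set \<Rightarrow> ('a, 'm) monoid_scheme \<Rightarrow> bool" where
  "virtual_retract H G \<longleftrightarrow> subgroup H G \<and>
     (\<exists>K. subgroup K G \<and> finite (rcosets\<^bsub>G\<^esub> K) \<and> H \<subseteq> K \<and>
        (\<exists>\<rho> \<in> hom (G\<lparr>carrier := K\<rparr>) (G\<lparr>carrier := H\<rparr>). \<forall>h\<in>H. \<rho> h = h))"

definition property_VRC :: "('a, 'm) monoid_scheme \<Rightarrow> bool" where
  "property_VRC G \<longleftrightarrow>
     (\<forall>H. subgroup H G \<and> cyclic_group (G\<lparr>carrier := H\<rparr>) \<longrightarrow> virtual_retract H G)"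

definition conjugate_in :: "('a, 'm) monoid_scheme \<Rightarrow> 'a \<Rightarrow> 'a \<Rightarrow> bool" where
  "conjugate_in G x y \<longleftrightarrow> (\<exists>h\<in>carrier G. h \<otimes>\<^bsub>G\<^esub> x \<otimes>\<^bsub>G\<^esub> inv\<^bsub>G\<^esub> h = y)"

text \<open>The library's \<^const>\<open>group.ord\<close> takes the value 0 exactly on the elements of infinite order.\<close>

definition balanced :: "('a, 'm) monoid_scheme \<Rightarrow> bool" where
  "balanced G \<longleftrightarrow>
     (\<forall>g\<in>carrier G. group.ord G g = 0 \<longrightarrow>
        (\<forall>k l :: int. k \<noteq> 0 \<longrightarrow> l \<noteq> 0 \<longrightarrow>
           conjugate_in G (g [^]\<^bsub>G\<^esub> k) (g [^]\<^bsub>G\<^esub> l) \<longrightarrow> l = k \<or> l = - k))"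


section \<open>Graphs in the sense of Serre\<close>

record ('v, 'e) pregraph =
  verts :: "'v set"
  edges :: "'e set"
  einv :: "'e \<Rightarrow> 'e"
  \<alpha>_of :: "'e \<Rightarrow> 'v"
  \<omega>_of :: "'e \<Rightarrow> 'v"

locale serre_graph =
  fixes \<Gamma> :: "('v, 'e) pregraph"
  assumes einv_closed: "e \<in> edges \<Gamma> \<Longrightarrow> einv \<Gamma> e \<in> edges \<Gamma>"
    and einv_neq: "e \<in> edges \<Gamma> \<Longrightarrow> einv \<Gamma> e \<noteq> e"
    and einv_einv: "e \<in> edges \<Gamma> \<Longrightarrow> einv \<Gamma> (einv \<Gamma> e) = e"
    and \<alpha>_closed: "e \<in> edges \<Gamma> \<Longrightarrow> \<alpha>_of \<Gamma> e \<in> verts \<Gamma>"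
    and \<omega>_closed: "e \<in> edges \<Gamma> \<Longrightarrow> \<omega>_of \<Gamma> e \<in> verts \<Gamma>"
    and \<omega>_einv: "e \<in> edges \<Gamma> \<Longrightarrow> \<omega>_of \<Gamma> (einv \<Gamma> e) = \<alpha>_of \<Gamma> e"

text \<open>Meaningful for finite graphs only; each geometric edge is counted twice in \<^term>\<open>edges \<Gamma>\<close>.\<close>

definition euler_char :: "('v, 'e) pregraph \<Rightarrow> rat" where
  "euler_char \<Gamma> = of_nat (card (verts \<Gamma>)) - of_nat (card (edges \<Gamma>)) / 2"

fun edge_path :: "('v, 'e) pregraph \<Rightarrow> 'v \<Rightarrow> 'e list \<Rightarrow> 'v \<Rightarrow> bool" where
  "edge_path \<Gamma> u [] v \<longleftrightarrow> u \<in> verts \<Gamma> \<and> u = v"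
| "edge_path \<Gamma> u (e # p) v \<longleftrightarrow> e \<in> edges \<Gamma> \<and> \<alpha>_of \<Gamma> e = u \<and> edge_path \<Gamma> (\<omega>_of \<Gamma> e) p v"

definition reduced_path :: "('v, 'e) pregraph \<Rightarrow> 'e list \<Rightarrow> bool" where
  "reduced_path \<Gamma> p \<longleftrightarrow> successively (\<lambda>e f. f \<noteq> einv \<Gamma> e) p"

definition graph_connected :: "('v, 'e) pregraph \<Rightarrow> bool" where
  "graph_connected \<Gamma> \<longleftrightarrow> (\<forall>u\<in>verts \<Gamma>. \<forall>v\<in>verts \<Gamma>. \<exists>p. edge_path \<Gamma> u p v)"

definition is_tree :: "('v, 'e) pregraph \<Rightarrow> bool" where
  "is_tree \<Gamma> \<longleftrightarrow> serre_graph \<Gamma> \<and> verts \<Gamma> \<noteq> {} \<and> graph_connected \<Gamma> \<and>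
     (\<forall>u p. edge_path \<Gamma> u p u \<and> reduced_path \<Gamma> p \<longrightarrow> p = [])"

definition subgraph_of :: "('v, 'e) pregraph \<Rightarrow> ('v, 'e) pregraph \<Rightarrow> bool" where
  "subgraph_of \<Delta> \<Gamma> \<longleftrightarrow> serre_graph \<Delta> \<and> verts \<Delta> \<subseteq> verts \<Gamma> \<and> edges \<Delta> \<subseteq> edges \<Gamma> \<and>
     (\<forall>e\<in>edges \<Delta>. einv \<Delta> e = einv \<Gamma> e \<and> \<alpha>_of \<Delta> e = \<alpha>_of \<Gamma> e \<and> \<omega>_of \<Delta> e = \<omega>_of \<Gamma> e)"

definition maximal_tree :: "('v, 'e) pregraph \<Rightarrow> ('v, 'e) pregraph \<Rightarrow> bool" where
  "maximal_tree T \<Gamma> \<longleftrightarrow> subgraph_of T \<Gamma> \<and> is_tree T \<and>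
     (\<forall>T'. subgraph_of T' \<Gamma> \<and> is_tree T' \<and> subgraph_of T T' \<longrightarrow>
        verts T' = verts T \<and> edges T' = edges T)"

text \<open>An orientation is given by its set \<open>P\<close> of positive edges.\<close>

definition orientation :: "('v, 'e) pregraph \<Rightarrow> 'e set \<Rightarrow> bool" where
  "orientation \<Gamma> P \<longleftrightarrow> edges \<Gamma> = P \<union> einv \<Gamma> ` P \<and> P \<inter> einv \<Gamma> ` P = {}"


section \<open>Group presentations\<close>

text \<open>A word is a list of signed generators; the letter \<open>(x, True)\<close> stands for \<open>x\<close> and
  \<open>(x, False)\<close> for its inverse. A pair \<open>(r, s)\<close> in \<open>R\<close> is the relation \<open>r = s\<close>.\<close>

type_synonym 'x word = "('x \<times> bool) list"

definition words_over :: "'x set \<Rightarrow> 'x word set" where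
  "words_over S = lists (S \<times> UNIV)"

inductive_set pres_eq :: "'x set \<Rightarrow> ('x word \<times> 'x word) set \<Rightarrow> ('x word \<times> 'x word) set"
  for S :: "'x set" and R :: "('x word \<times> 'x word) set" where
  refl: "w \<in> words_over S \<Longrightarrow> (w, w) \<in> pres_eq S R"
| sym: "(w, w') \<in> pres_eq S R \<Longrightarrow> (w', w) \<in> pres_eq S R"
| trans: "(w, w') \<in> pres_eq S R \<Longrightarrow> (w', w'') \<in> pres_eq S R \<Longrightarrow> (w, w'') \<in> pres_eq S R"
| cancel: "u \<in> words_over S \<Longrightarrow> v \<in> words_over S \<Longrightarrow> x \<in> S \<Longrightarrow>
     (u @ [(x, b), (x, \<not> b)] @ v, u @ v) \<in> pres_eq S R"
| relation: "u \<in> words_over S \<Longrightarrow> v \<in> words_over S \<Longrightarrow> r \<in> words_over S \<Longrightarrow> s \<in> words_over S \<Longrightarrow>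
     (r, s) \<in> R \<Longrightarrow> (u @ r @ v, u @ s @ v) \<in> pres_eq S R"

definition presented_group :: "'x set \<Rightarrow> ('x word \<times> 'x word) set \<Rightarrow> 'x word set monoid" where
  "presented_group S R =
     \<lparr>carrier = words_over S // pres_eq S R,
      monoid.mult = (\<lambda>A B. \<Union>a\<in>A. \<Union>b\<in>B. pres_eq S R `` {a @ b}),
      monoid.one = pres_eq S R `` {[]}\<rparr>"

lemma words_over_simps [simp]:
  "[] \<in> words_over S"
  "l # w \<in> words_over S \<longleftrightarrow> fst l \<in> S \<and> w \<in> words_over S"
  "u @ v \<in> words_over S \<longleftrightarrow> u \<in> words_over S \<and> v \<in> words_over S"
  by (auto simp: words_over_def mem_Times_iff)

lemma pres_eq_words: "(a, b) \<in> pres_eq S R \<Longrightarrow> a \<in> words_over S \<and> b \<in> words_over S"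
  by (induction rule: pres_eq.induct) auto

lemma equiv_pres_eq: "equiv (words_over S) (pres_eq S R)"
proof (rule equivI)
  show "pres_eq S R \<subseteq> words_over S \<times> words_over S"
    by (auto dest: pres_eq_words)
  show "refl_on (words_over S) (pres_eq S R)"
    by (simp add: refl_on_def pres_eq.refl)
  show "sym (pres_eq S R)"
    by (rule symI) (rule pres_eq.sym)
  show "trans (pres_eq S R)"
    by (rule transI) (rule pres_eq.trans)
qed

lemma pres_eq_context:
  assumes "(a, b) \<in> pres_eq S R" "p \<in> words_over S" "q \<in> words_over S"
  shows "(p @ a @ q, p @ b @ q) \<in> pres_eq S R"
  using assms
proof (induction rule: pres_eq.induct)
  case (cancel u v x c)
  then show ?case
    using pres_eq.cancel[of "p @ u" S "v @ q" x c R] by simp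
next
  case (relation u v r s)
  then show ?case
    using pres_eq.relation[of "p @ u" S "v @ q" r s R] by simp
next
  case (refl w)
  then show ?case by (simp add: pres_eq.refl)
next
  case (sym w w')
  then show ?case by (simp add: pres_eq.sym)
next
  case (trans w w' w'')
  then show ?case by (meson pres_eq.trans)
qed

lemma pres_eq_append:
  assumes "(a, a') \<in> pres_eq S R" "(b, b') \<in> pres_eq S R"
  shows "(a @ b, a' @ b') \<in> pres_eq S R"
proof (rule pres_eq.trans)
  show "(a @ b, a' @ b) \<in> pres_eq S R"
    using pres_eq_context[OF assms(1), of "[]" b] pres_eq_words[OF assms(2)] by simp
  show "(a' @ b, a' @ b') \<in> pres_eq S R"
    using pres_eq_context[OF assms(2), of a' "[]"] pres_eq_words[OF assms(1)] by simp
qed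

lemma presented_mult:
  assumes "a \<in> words_over S" "b \<in> words_over S"
  shows "pres_eq S R `` {a} \<otimes>\<^bsub>presented_group S R\<^esub> pres_eq S R `` {b} = pres_eq S R `` {a @ b}"
proof -
  let ?A = "pres_eq S R `` {a}" and ?B = "pres_eq S R `` {b}" and ?C = "pres_eq S R `` {a @ b}"
  have "pres_eq S R `` {a' @ b'} = ?C" if "a' \<in> ?A" "b' \<in> ?B" for a' b'
    using equiv_class_eq[OF equiv_pres_eq pres_eq_append] that by (metis Image_singleton_iff)
  then have "(\<Union>a'\<in>?A. \<Union>b'\<in>?B. pres_eq S R `` {a' @ b'}) = (\<Union>a'\<in>?A. \<Union>b'\<in>?B. ?C)"
    by (intro SUP_cong) auto
  moreover have "a \<in> ?A" "b \<in> ?B"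
    using assms by (auto intro: pres_eq.refl)
  then have "(\<Union>a'\<in>?A. \<Union>b'\<in>?B. ?C) = ?C"
    by blast
  ultimately show ?thesis
    by (simp add: presented_group_def)
qed

lemma pres_eq_inverse:
  "w \<in> words_over S \<Longrightarrow> \<exists>w'\<in>words_over S. (w' @ w, []) \<in> pres_eq S R"
proof (induction w)
  case Nil
  then show ?case by (auto intro: pres_eq.refl intro!: bexI[of _ "[]"])
next
  case (Cons l w)
  obtain x c where l: "l = (x, c)" by (cases l)
  obtain w' where w': "w' \<in> words_over S" "(w' @ w, []) \<in> pres_eq S R"
    using Cons by auto
  have "((w' @ [(x, \<not> c)]) @ l # w, w' @ w) \<in> pres_eq S R"
    using pres_eq.cancel[of w' S w x "\<not> c" R] w' Cons.prems l by simp
  then show ?case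
    using w' Cons.prems l pres_eq.trans[of _ "w' @ w" S R "[]"]
    by (intro bexI[of _ "w' @ [(x, \<not> c)]"]) simp_all
qed

lemma presented_group_is_group: "group (presented_group S R)"
proof (rule groupI)
  let ?G = "presented_group S R" and ?q = "\<lambda>w. pres_eq S R `` {w}"
  have car: "x \<in> carrier ?G \<longleftrightarrow> (\<exists>w\<in>words_over S. x = ?q w)" for x
    by (auto simp: presented_group_def quotient_def)
  have one: "\<one>\<^bsub>?G\<^esub> = ?q []" by (simp add: presented_group_def)
  show "\<one>\<^bsub>?G\<^esub> \<in> carrier ?G"
    unfolding car one by (intro bexI[of _ "[]"]) auto
  show "x \<otimes>\<^bsub>?G\<^esub> y \<in> carrier ?G" if xy: "x \<in> carrier ?G" "y \<in> carrier ?G" for x y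
  proof -
    obtain a b where "a \<in> words_over S" "x = ?q a" "b \<in> words_over S" "y = ?q b"
      using xy unfolding car by blast
    then show ?thesis
      unfolding car by (intro bexI[of _ "a @ b"]) (auto simp: presented_mult)
  qed
  show "x \<otimes>\<^bsub>?G\<^esub> y \<otimes>\<^bsub>?G\<^esub> z = x \<otimes>\<^bsub>?G\<^esub> (y \<otimes>\<^bsub>?G\<^esub> z)"
    if "x \<in> carrier ?G" "y \<in> carrier ?G" "z \<in> carrier ?G" for x y z
    using that by (auto simp: car presented_mult)
  show "\<one>\<^bsub>?G\<^esub> \<otimes>\<^bsub>?G\<^esub> x = x" if "x \<in> carrier ?G" for x
    using that by (auto simp: car one presented_mult)
  show "\<exists>y\<in>carrier ?G. y \<otimes>\<^bsub>?G\<^esub> x = \<one>\<^bsub>?G\<^esub>" if x: "x \<in> carrier ?G" for x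
  proof -
    obtain w where w: "w \<in> words_over S" "x = ?q w" using x car by auto
    obtain w' where w': "w' \<in> words_over S" "(w' @ w, []) \<in> pres_eq S R"
      using pres_eq_inverse[OF w(1)] by blast
    have "?q w' \<otimes>\<^bsub>?G\<^esub> x = ?q []"
      using w w' equiv_class_eq[OF equiv_pres_eq w'(2)] by (simp add: presented_mult)
    moreover have "?q w' \<in> carrier ?G" using w'(1) unfolding car by blast
    ultimately show ?thesis unfolding one by blast
  qed
qed


section \<open>Graphs of groups and their fundamental groups\<close>

text \<open>All vertex groups share one type and so do all edge groups; this is no restriction, since
  any family of groups can be copied into a common type. The monomorphism
  \<open>\<omega>\<^sub>e\<close> is \<^term>\<open>\<phi> (einv \<Gamma> e)\<close>.\<close>

locale finite_graph_of_groups = serre_graph \<Gamma>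
  for \<Gamma> :: "('v, 'e) pregraph" +
  fixes VG :: "'v \<Rightarrow> 'a monoid"
    and EG :: "'e \<Rightarrow> 'b monoid"
    and \<phi> :: "'e \<Rightarrow> 'b \<Rightarrow> 'a"
  assumes finite_verts: "finite (verts \<Gamma>)"
    and finite_edges: "finite (edges \<Gamma>)"
    and nonempty: "verts \<Gamma> \<noteq> {}"
    and connected: "graph_connected \<Gamma>"
    and vertex_group: "v \<in> verts \<Gamma> \<Longrightarrow> group (VG v)"
    and edge_group: "e \<in> edges \<Gamma> \<Longrightarrow> group (EG e)"
    and edge_group_einv: "e \<in> edges \<Gamma> \<Longrightarrow> EG (einv \<Gamma> e) = EG e"
    and edge_mono: "e \<in> edges \<Gamma> \<Longrightarrow> \<phi> e \<in> mon (EG e) (VG (\<alpha>_of \<Gamma> e))"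

datatype ('v, 'e, 'a) gog_gen = Elt 'v 'a | Stable 'e

definition gog_gens ::
  "('v, 'e) pregraph \<Rightarrow> ('v \<Rightarrow> 'a monoid) \<Rightarrow> 'e set \<Rightarrow> ('v, 'e, 'a) gog_gen set" where
  "gog_gens \<Gamma> VG P = {Elt v a |v a. v \<in> verts \<Gamma> \<and> a \<in> carrier (VG v)} \<union> Stable ` P"

text \<open>The three parts are the multiplication tables of the vertex groups, the relations
  \<open>t\<^sub>e \<omega>\<^sub>e(a) t\<^sub>e\<^sup>-\<^sup>1 = \<alpha>\<^sub>e(a)\<close>, and \<open>t\<^sub>f = 1\<close> for the positive edges of the tree.\<close>

definition gog_rels ::
  "('v, 'e) pregraph \<Rightarrow> ('v \<Rightarrow> 'a monoid) \<Rightarrow> ('e \<Rightarrow> 'b monoid) \<Rightarrow> ('e \<Rightarrow> 'b \<Rightarrow> 'a) \<Rightarrow>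
   ('v, 'e) pregraph \<Rightarrow> 'e set \<Rightarrow> (('v, 'e, 'a) gog_gen word \<times> ('v, 'e, 'a) gog_gen word) set" where
  "gog_rels \<Gamma> VG EG \<phi> T P =
     {([(Elt v a, True), (Elt v b, True)], [(Elt v (a \<otimes>\<^bsub>VG v\<^esub> b), True)]) |v a b.
        v \<in> verts \<Gamma> \<and> a \<in> carrier (VG v) \<and> b \<in> carrier (VG v)} \<union>
     {([(Stable e, True), (Elt (\<omega>_of \<Gamma> e) (\<phi> (einv \<Gamma> e) a), True), (Stable e, False)],
       [(Elt (\<alpha>_of \<Gamma> e) (\<phi> e a), True)]) |e a. e \<in> P \<and> a \<in> carrier (EG e)} \<union>
     {([(Stable f, True)], []) |f. f \<in> edges T \<inter> P}"

definition fundamental_group ::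
  "('v, 'e) pregraph \<Rightarrow> ('v \<Rightarrow> 'a monoid) \<Rightarrow> ('e \<Rightarrow> 'b monoid) \<Rightarrow> ('e \<Rightarrow> 'b \<Rightarrow> 'a) \<Rightarrow>
   ('v, 'e) pregraph \<Rightarrow> 'e set \<Rightarrow> ('v, 'e, 'a) gog_gen word set monoid" where
  "fundamental_group \<Gamma> VG EG \<phi> T P =
     presented_group (gog_gens \<Gamma> VG P) (gog_rels \<Gamma> VG EG \<phi> T P)"

lemma group_fundamental_group: "group (fundamental_group \<Gamma> VG EG \<phi> T P)"
  unfolding fundamental_group_def by (rule presented_group_is_group)

end

theory Submission
  imports Defs
begin

text \<open>If \<open>h g\<^sup>k h\<inverse> = g\<^sup>l\<close>, then \<open>h\<^sup>n\<close> conjugates the \<open>k\<^sup>n\<close>-th power of \<open>g\<close> to the \<open>l\<^sup>n\<close>-th;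
  applying a retraction onto \<open>\<langle>g\<rangle>\<close> of a finite index subgroup containing \<open>g\<close> and \<open>h\<^sup>n\<close> gives \<open>k\<^sup>n = l\<^sup>n\<close>.

  Conversely, let \<open>c\<close> and \<open>d\<close> be the images of a generator of the cyclic group \<open>G\<^sub>e\<close>. Since \<open>\<chi>(\<Gamma>) = 0\<close>,
  \<open>e\<close> is the only geometric edge outside the tree \<open>T\<close>, and homomorphisms from a vertex group to a
  divisible group extend along \<open>T\<close>. If \<open>c\<^sup>i\<close> and \<open>d\<^sup>j\<close> with \<open>i \<noteq> 0\<close> are identified along \<open>T\<close>, then \<open>d\<^sup>i\<close> and
  \<open>d\<^sup>j\<close> are conjugate, so \<open>j = \<plusminus>i\<close> by balancedness; hence for every family \<open>f\<close> of such homomorphisms there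
  is a family \<open>f'\<close> with \<open>f'(c) = f(d)\<close> and \<open>f'(d) = f(c)\<close>. The pair \<open>(f, f')\<close> is compatible with the stable
  letter up to swapping. With rational values it detects elliptic elements of infinite order. With
  roots of unity as values it yields finite quotients of the vertex groups, compatible with all edges
  and separating any finite set of elements. They detect elliptic elements of finite order and, as in
  Marshall Hall's theorem, allow a partial action on a finite set, read off a cyclically reduced word,
  to be completed to an action of \<open>G\<close>, whence a finite index subgroup with a homomorphism to \<open>\<int>\<close> that
  does not vanish on the given hyperbolic element.\<close>

section \<open>Reduced paths in trees\<close>

text \<open>The presentation is taken over a tree \<open>T\<^sub>0\<close> that may differ from the
  tree \<open>T\<close> missing the cyclic edge. Rather than comparing the groups for the two trees,
  homomorphisms are built from values on all edges and normalised afterwards: conjugating by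
  suitable elements \<open>p v\<close> makes the letters of \<open>T\<^sub>0\<close> trivial. This
  is why a vertex group always appears conjugated by \<open>p v\<close>. Balancedness speaks of
  elements of infinite order in \<open>G\<close>, and passing to \<open>G\<close> might a priori
  shorten orders. That \<open>d\<close> keeps infinite order is read off in the affine group of the
  rational line, where vertex elements are translations and the stable letter is a dilation.
  Likewise, "identified along \<open>T\<close>" is expressed by equal values in a target that
  respects the edges of \<open>T\<close>: a triple consisting of \<open>G\<close>, the divisible
  group and the rationals. All retractions come from one kind of target, the permutations of
  \<open>S\<close> times the integers that commute with translation. Such a permutation carries a
  finite action and an integer cocycle at once, so elements of finite and of infinite order are
  detected by the same means.\<close>

lemma edge_path_append:
  "edge_path \<Gamma> u (p @ q) w \<longleftrightarrow> (\<exists>v. edge_path \<Gamma> u p v \<and> edge_path \<Gamma> v q w)"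
  if "serre_graph \<Gamma>"
proof (induction p arbitrary: u)
  case Nil
  have "u \<in> verts \<Gamma>" if "edge_path \<Gamma> u q w"
    using that \<open>serre_graph \<Gamma>\<close> by (cases q) (auto simp: serre_graph_def)
  then show ?case by auto
qed auto

lemma edge_path_verts:
  assumes "serre_graph \<Gamma>" "edge_path \<Gamma> u p v"
  shows "u \<in> verts \<Gamma>" "v \<in> verts \<Gamma>"
proof -
  show "u \<in> verts \<Gamma>"
    using assms by (cases p) (auto simp: serre_graph_def)
  show "v \<in> verts \<Gamma>"
    using assms(2)
  proof (induction p arbitrary: u)
    case Nil
    then show ?case by (metis edge_path.simps(1))
  next
    case (Cons e p)
    then show ?case by auto
  qed
qed

lemma \<alpha>_einv: "serre_graph \<Gamma> \<Longrightarrow> e \<in> edges \<Gamma> \<Longrightarrow> \<alpha>_of \<Gamma> (einv \<Gamma> e) = \<omega>_of \<Gamma> e"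
  by (metis serre_graph.\<omega>_einv serre_graph.einv_closed serre_graph.einv_einv)

lemma edge_path_inverse:
  assumes "serre_graph \<Gamma>" "edge_path \<Gamma> u p v"
  shows "edge_path \<Gamma> v (rev (map (einv \<Gamma>) p)) u"
  using assms(2)
proof (induction p arbitrary: u)
  case (Cons e p)
  then show ?case
    using assms(1) by (auto simp: edge_path_append[OF assms(1)] \<alpha>_einv serre_graph_def)
qed auto

lemma edge_path_edges: "edge_path \<Gamma> u p v \<Longrightarrow> set p \<subseteq> edges \<Gamma>"
  by (induction p arbitrary: u) auto

lemma reduced_path_inverse:
  assumes "serre_graph \<Gamma>" "set p \<subseteq> edges \<Gamma>" "reduced_path \<Gamma> p"
  shows "reduced_path \<Gamma> (rev (map (einv \<Gamma>) p))"
proof -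
  have "successively (\<lambda>e f. einv \<Gamma> e \<noteq> einv \<Gamma> (einv \<Gamma> f)) p"
    using assms(3) unfolding reduced_path_def
  proof (rule successively_mono)
    fix e f assume "e \<in> set p" "f \<in> set p" "f \<noteq> einv \<Gamma> e"
    then show "einv \<Gamma> e \<noteq> einv \<Gamma> (einv \<Gamma> f)"
      using assms(1,2) by (metis serre_graph.einv_einv subsetD)
  qed
  then show ?thesis
    by (simp add: reduced_path_def successively_map)
qed

lemma reduced_path_append:
  "reduced_path \<Gamma> (p @ q) \<longleftrightarrow> reduced_path \<Gamma> p \<and> reduced_path \<Gamma> q \<and>
     (p = [] \<or> q = [] \<or> hd q \<noteq> einv \<Gamma> (last p))"
  by (auto simp: reduced_path_def successively_append_iff)

text \<open>Appending an edge to a reduced path either keeps it reduced or undoes its last edge; in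
  the second case dropping that edge leaves a reduced path with the required end.\<close>

lemma exists_reduced_path:
  assumes "serre_graph \<Gamma>" "edge_path \<Gamma> u p v"
  shows "\<exists>q. edge_path \<Gamma> u q v \<and> reduced_path \<Gamma> q"
  using assms(2)
proof (induction p arbitrary: v rule: rev_induct)
  case Nil
  then show ?case by (metis reduced_path_def successively.simps(1))
next
  case (snoc e p)
  obtain x where x: "edge_path \<Gamma> u p x" "edge_path \<Gamma> x [e] v"
    using snoc.prems edge_path_append[OF assms(1)] by blast
  obtain q where q: "edge_path \<Gamma> u q x" "reduced_path \<Gamma> q"
    using snoc.IH x(1) by blast
  show ?case
  proof (cases "q \<noteq> [] \<and> e = einv \<Gamma> (last q)")
    case False
    then have "reduced_path \<Gamma> (q @ [e])"
      using q(2) by (subst reduced_path_append) (auto simp: reduced_path_def)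
    then show ?thesis using q x edge_path_append[OF assms(1)] by blast
  next
    case True
    then obtain r f where r: "q = r @ [f]" by (metis append_butlast_last_id)
    then have "edge_path \<Gamma> u r (\<alpha>_of \<Gamma> f)" "f \<in> edges \<Gamma>"
      using q(1) by (auto simp: edge_path_append[OF assms(1)])
    moreover have "v = \<alpha>_of \<Gamma> f"
      using True r x(2) \<open>f \<in> edges \<Gamma>\<close> assms(1) by (auto simp: serre_graph_def)
    ultimately show ?thesis using q(2) r by (auto simp: reduced_path_append)
  qed
qed

text \<open>If the paths do not share their last edge, one followed by the inverse of the other is a
  closed reduced path, which a tree forbids. A common last edge is removed by induction.\<close>

lemma tree_reduced_path_unique:
  assumes T: "is_tree T" and "edge_path T u p v" "reduced_path T p"
    and "edge_path T u q v" "reduced_path T q"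
  shows "p = q"
  using assms(2-)
proof (induction p arbitrary: q v rule: rev_induct)
  case Nil
  then show ?case using T by (auto simp: is_tree_def)
next
  have sg: "serre_graph T" using T by (simp add: is_tree_def)
  case (snoc e p)
  show ?case
  proof (cases "q \<noteq> [] \<and> last q = e")
    case True
    then obtain r where r: "q = r @ [e]" by (metis append_butlast_last_id)
    then have "edge_path T u p (\<alpha>_of T e)" "edge_path T u r (\<alpha>_of T e)"
      using snoc.prems by (auto simp: edge_path_append[OF sg])
    then show ?thesis using snoc.IH snoc.prems r by (auto simp: reduced_path_append)
  next
    case False
    let ?q = "rev (map (einv T) q)" and ?p = "p @ [e]"
    have "edge_path T u (?p @ ?q) u"
      using snoc.prems edge_path_append[OF sg] edge_path_inverse[OF sg] by blast
    moreover have "reduced_path T (?p @ ?q)"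
    proof -
      have "set q \<subseteq> edges T" "e \<in> edges T"
        using edge_path_edges snoc.prems(1,3) by (force simp: edge_path_append[OF sg])+
      then have "reduced_path T ?q" "q \<noteq> [] \<Longrightarrow> hd ?q \<noteq> einv T e"
        using reduced_path_inverse[OF sg] snoc.prems(4) False sg
          by (auto simp: hd_rev last_map) (metis last_in_set serre_graph.einv_einv subsetD)
      then show ?thesis
        using snoc.prems(2) by (subst reduced_path_append) auto
    qed
    ultimately show ?thesis using T unfolding is_tree_def by blast
  qed
qed

section \<open>Rooted trees: geodesics and recursion away from the root\<close>

locale rooted_tree =
  fixes T :: "('v, 'e) pregraph" and v\<^sub>0 :: 'v
  assumes tree: "is_tree T" and root: "v\<^sub>0 \<in> verts T"
begin

definition geodesic :: "'v \<Rightarrow> 'e list" where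
  "geodesic u = (SOME p. edge_path T v\<^sub>0 p u \<and> reduced_path T p)"

lemma serre: "serre_graph T"
  using tree by (simp add: is_tree_def)

lemma geodesic:
  assumes "u \<in> verts T"
  shows "edge_path T v\<^sub>0 (geodesic u) u" "reduced_path T (geodesic u)"
proof -
  obtain p where "edge_path T v\<^sub>0 p u"
    using tree root assms unfolding is_tree_def graph_connected_def by blast
  then have "\<exists>p. edge_path T v\<^sub>0 p u \<and> reduced_path T p"
    using exists_reduced_path[OF serre] by blast
  from someI_ex[OF this] show "edge_path T v\<^sub>0 (geodesic u) u" "reduced_path T (geodesic u)"
    unfolding geodesic_def by auto
qed

lemma geodesic_unique:
  assumes "edge_path T v\<^sub>0 p u" "reduced_path T p"
  shows "geodesic u = p"
  using tree_reduced_path_unique[OF tree geodesic assms] edge_path_verts[OF serre assms(1)] by blast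

lemma geodesic_root [simp]: "geodesic v\<^sub>0 = []"
  by (rule geodesic_unique) (simp_all add: root reduced_path_def)

text \<open>Appending \<open>f\<close> to the geodesic of its origin gives a reduced path, hence a
  geodesic, unless \<open>f\<close> undoes the last edge. So each tree edge points either away from
  the root or towards it.\<close>

lemma geodesic_edge:
  assumes "f \<in> edges T"
  shows "geodesic (\<omega>_of T f) = geodesic (\<alpha>_of T f) @ [f] \<or>
         geodesic (\<alpha>_of T f) = geodesic (\<omega>_of T f) @ [einv T f]"
proof -
  let ?p = "geodesic (\<alpha>_of T f)"
  have V: "\<alpha>_of T f \<in> verts T" "\<omega>_of T f \<in> verts T"
    using assms serre by (auto simp: serre_graph_def)
  note p = geodesic[OF V(1)]
  show ?thesis
  proof (cases "?p \<noteq> [] \<and> f = einv T (last ?p)")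
    case False
    then have "reduced_path T (?p @ [f])"
      using p by (subst reduced_path_append) (auto simp: reduced_path_def)
    moreover have "edge_path T v\<^sub>0 (?p @ [f]) (\<omega>_of T f)"
      using p assms V by (auto simp: edge_path_append[OF serre])
    ultimately show ?thesis using geodesic_unique by blast
  next
    case True
    then obtain r g where r: "?p = r @ [g]" by (metis append_butlast_last_id)
    have g: "g \<in> edges T" "edge_path T v\<^sub>0 r (\<alpha>_of T g)"
      using p(1) unfolding r by (auto simp: edge_path_append[OF serre])
    have "f = einv T g" using True r by simp
    then have "g = einv T f" "\<alpha>_of T g = \<omega>_of T f"
      using g serre by (auto simp: serre_graph_def)
    moreover have "geodesic (\<alpha>_of T g) = r"
      using g p(2) r by (intro geodesic_unique) (auto simp: reduced_path_append)
    ultimately show ?thesis using r by simp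
  qed
qed

lemma last_geodesic:
  assumes "u \<in> verts T" "u \<noteq> v\<^sub>0"
  shows "geodesic u \<noteq> []" "last (geodesic u) \<in> edges T" "\<omega>_of T (last (geodesic u)) = u"
proof -
  show ne: "geodesic u \<noteq> []"
    using geodesic(1)[OF assms(1)] assms by auto
  then obtain r g where r: "geodesic u = r @ [g]" by (metis append_butlast_last_id)
  show "last (geodesic u) \<in> edges T" "\<omega>_of T (last (geodesic u)) = u"
    using geodesic(1)[OF assms(1)] unfolding r by (auto simp: edge_path_append[OF serre])
qed

text \<open>Recursion outwards from the root: \<open>F u\<close> folds chosen partners along the
  geodesic of \<open>u\<close>. As \<open>R\<close> is only a relation, one proof serves for gauge
  elements, for homomorphisms and for sets of transported values. The hypothesis \<open>sym\<close>
  covers the edges that point towards the root.\<close>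

theorem tree_choice:
  fixes A :: "'v \<Rightarrow> 'd set" and R :: "'e \<Rightarrow> 'd \<Rightarrow> 'd \<Rightarrow> bool"
  assumes start: "x\<^sub>0 \<in> A v\<^sub>0"
    and step: "\<And>f x. f \<in> edges T \<Longrightarrow> x \<in> A (\<alpha>_of T f) \<Longrightarrow> \<exists>y\<in>A (\<omega>_of T f). R f x y"
    and sym: "\<And>f x y. f \<in> edges T \<Longrightarrow> x \<in> A (\<alpha>_of T f) \<Longrightarrow> y \<in> A (\<omega>_of T f) \<Longrightarrow>
      R f x y \<Longrightarrow> R (einv T f) y x"
  shows "\<exists>F. (\<forall>u\<in>verts T. F u \<in> A u) \<and> F v\<^sub>0 = x\<^sub>0 \<and>
    (\<forall>f\<in>edges T. R f (F (\<alpha>_of T f)) (F (\<omega>_of T f)))"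
proof -
  define g where "g = (\<lambda>x f. SOME y. y \<in> A (\<omega>_of T f) \<and> R f x y)"
  define F where "F = (\<lambda>u. foldl g x\<^sub>0 (geodesic u))"
  have g: "g x f \<in> A (\<omega>_of T f) \<and> R f x (g x f)" if "f \<in> edges T" "x \<in> A (\<alpha>_of T f)" for f x
    unfolding g_def using someI_ex[of "\<lambda>y. y \<in> A (\<omega>_of T f) \<and> R f x y"] step[OF that] by blast
  have "foldl g x\<^sub>0 p \<in> A u" if "edge_path T v\<^sub>0 p u" for p u
    using that
  proof (induction p arbitrary: u rule: rev_induct)
    case (snoc f p)
    then show ?case using g by (auto simp: edge_path_append[OF serre])
  qed (auto simp: start)
  then have A: "F u \<in> A u" if "u \<in> verts T" for u
    using geodesic that unfolding F_def by blast
  have V: "\<alpha>_of T f \<in> verts T" "\<omega>_of T f \<in> verts T" if "f \<in> edges T" for f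
    using that serre by (auto simp: serre_graph_def)
  have up: "R f (F (\<alpha>_of T f)) (F (\<omega>_of T f))"
    if f: "f \<in> edges T" and eq: "geodesic (\<omega>_of T f) = geodesic (\<alpha>_of T f) @ [f]" for f
  proof -
    have "F (\<omega>_of T f) = g (F (\<alpha>_of T f)) f" by (simp add: F_def eq)
    then show ?thesis using g[OF f A[OF V(1)[OF f]]] by simp
  qed
  have "R f (F (\<alpha>_of T f)) (F (\<omega>_of T f))" if f: "f \<in> edges T" for f
    using geodesic_edge[OF f]
  proof
    let ?f = "einv T f"
    assume eq: "geodesic (\<alpha>_of T f) = geodesic (\<omega>_of T f) @ [?f]"
    have inv: "?f \<in> edges T" "einv T ?f = f" "\<alpha>_of T ?f = \<omega>_of T f" "\<omega>_of T ?f = \<alpha>_of T f"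
      using f serre \<alpha>_einv[OF serre] by (auto simp: serre_graph_def)
    have "R ?f (F (\<alpha>_of T ?f)) (F (\<omega>_of T ?f))"
      using up[OF inv(1)] eq inv by simp
    from sym[OF inv(1) _ _ this] show ?thesis using A V[OF f] inv by simp
  qed (rule up[OF f])
  then show ?thesis
    using A by (intro exI[of _ F]) (simp add: F_def)
qed

text \<open>Taking the last edge of the geodesic is a bijection from the vertices other than the
  root to the edges pointing away from it; the remaining edges are the inverses of these.\<close>

lemma card_tree_edges:
  assumes "finite (verts T)"
  shows "finite (edges T)" "card (edges T) + 2 = 2 * card (verts T)"
proof -
  define l where "l = (\<lambda>u. last (geodesic u))"
  define I where "I = l ` (verts T - {v\<^sub>0})"
  have l: "l u \<in> edges T" "\<omega>_of T (l u) = u" if "u \<in> verts T - {v\<^sub>0}" for u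
    using last_geodesic that by (auto simp: l_def)
  have inj: "inj_on l (verts T - {v\<^sub>0})"
    using l(2) by (rule inj_on_inverseI)
  have IE: "I \<subseteq> edges T" using l by (auto simp: I_def)
  have geo: "geodesic (\<omega>_of T f) = geodesic (\<alpha>_of T f) @ [f]" if f: "f \<in> I" for f
  proof -
    obtain u where u: "u \<in> verts T - {v\<^sub>0}" "f = l u" using f by (auto simp: I_def)
    then obtain r where r: "geodesic u = r @ [f]"
      using last_geodesic(1)[of u] by (metis DiffE append_butlast_last_id insertI1 l_def)
    have "edge_path T v\<^sub>0 r (\<alpha>_of T f)" "reduced_path T r"
      using geodesic[of u] u r by (auto simp: edge_path_append[OF serre] reduced_path_append)
    then have "geodesic (\<alpha>_of T f) = r" by (rule geodesic_unique)
    then show ?thesis using r l(2) u by simp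
  qed
  have inI: "f \<in> I" if f: "f \<in> edges T" "geodesic (\<omega>_of T f) = geodesic (\<alpha>_of T f) @ [f]" for f
  proof -
    have "\<omega>_of T f \<in> verts T" "\<omega>_of T f \<noteq> v\<^sub>0"
      using f serre by (auto simp: serre_graph_def) (metis append_is_Nil_conv geodesic_root not_Cons_self2)
    moreover have "f = l (\<omega>_of T f)" by (simp add: l_def f(2))
    ultimately show ?thesis unfolding I_def by blast
  qed
  have edges: "edges T = I \<union> einv T ` I"
  proof
    show "I \<union> einv T ` I \<subseteq> edges T" using IE serre by (auto simp: serre_graph_def)
    show "edges T \<subseteq> I \<union> einv T ` I"
    proof
      fix f assume f: "f \<in> edges T"
      have f': "einv T f \<in> edges T" "einv T (einv T f) = f" "\<omega>_of T (einv T f) = \<alpha>_of T f"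
        using f serre by (auto simp: serre_graph_def)
      from geodesic_edge[OF f] show "f \<in> I \<union> einv T ` I"
        using inI[OF f] inI[OF f'(1)] f' \<alpha>_einv[OF serre f] by (auto simp: image_iff) metis+
    qed
  qed
  have disj: "I \<inter> einv T ` I = {}"
  proof (rule ccontr)
    assume "I \<inter> einv T ` I \<noteq> {}"
    then obtain f where f: "f \<in> I" "einv T f \<in> I" by auto
    then have "\<alpha>_of T (einv T f) = \<omega>_of T f" "\<omega>_of T (einv T f) = \<alpha>_of T f"
      using IE \<alpha>_einv[OF serre] serre by (auto simp: serre_graph_def)
    \<comment> \<open>If an edge and its inverse both pointed outwards, the geodesic would grow by
      two on going there and back.\<close>
    then have "length (geodesic (\<alpha>_of T f)) = length (geodesic (\<alpha>_of T f)) + 2"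
      using geo[OF f(1)] geo[OF f(2)] by simp
    then show False by simp
  qed
  have fin: "finite I" using assms by (simp add: I_def)
  have inj': "inj_on (einv T) I"
    using IE serre by (intro inj_on_inverseI[of _ "einv T"]) (auto simp: serre_graph_def)
  have "card I = card (verts T) - 1"
    using inj root by (simp add: I_def card_image assms)
  moreover have "card (verts T) > 0" using root assms card_gt_0_iff by blast
  moreover have "card (edges T) = card I + card I"
    using fin disj inj' by (simp add: edges card_Un_disjoint card_image)
  ultimately show "card (edges T) + 2 = 2 * card (verts T)" by simp
  show "finite (edges T)" using fin edges by simp
qed

end

section \<open>Maximal trees\<close>

lemma exists_boundary_edge:
  assumes "edge_path \<Gamma> u p v" "u \<in> S" "v \<notin> S"
  shows "\<exists>f\<in>edges \<Gamma>. \<alpha>_of \<Gamma> f \<in> S \<and> \<omega>_of \<Gamma> f \<notin> S"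
  using assms by (induction p arbitrary: u) auto

lemma subgraph_edge_path:
  assumes "subgraph_of \<Delta> \<Gamma>" "edge_path \<Delta> u p v"
  shows "edge_path \<Gamma> u p v"
  using assms(2)
proof (induction p arbitrary: u)
  case Nil
  then show ?case using assms(1) by (auto simp: subgraph_of_def)
next
  case (Cons e p)
  then show ?case using assms(1) by (auto simp: subgraph_of_def)
qed

lemma subgraph_edge_path_iff:
  assumes "subgraph_of \<Delta> \<Gamma>" "set p \<subseteq> edges \<Delta>" "u \<in> verts \<Delta>"
  shows "edge_path \<Delta> u p v \<longleftrightarrow> edge_path \<Gamma> u p v" "reduced_path \<Delta> p \<longleftrightarrow> reduced_path \<Gamma> p"
proof -
  show "edge_path \<Delta> u p v \<longleftrightarrow> edge_path \<Gamma> u p v"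
    using assms(2,3)
  proof (induction p arbitrary: u)
    case Nil
    then show ?case using assms(1) by (auto simp: subgraph_of_def)
  next
    case (Cons e p)
    then have "\<omega>_of \<Delta> e \<in> verts \<Delta>" using assms(1) by (auto simp: subgraph_of_def serre_graph_def)
    then show ?case using Cons assms(1) by (auto simp: subgraph_of_def)
  qed
  have "successively (\<lambda>e f. f \<noteq> einv \<Delta> e) p = successively (\<lambda>e f. f \<noteq> einv \<Gamma> e) p"
    using assms(1,2) by (intro successively_cong) (auto simp: subgraph_of_def)
  then show "reduced_path \<Delta> p \<longleftrightarrow> reduced_path \<Gamma> p"
    by (simp add: reduced_path_def)
qed

text \<open>A reduced path cannot pass through the new vertex, since the only edge into it is
  \<open>f\<close> and the only edge out of it is the inverse of \<open>f\<close>. So a closed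
  reduced path using the new edge starts and ends at the new vertex. Stripping its two outer edges
  leaves a closed reduced path in \<open>T\<close>, which is empty; but the two outer edges alone do
  not form a reduced path.\<close>

lemma tree_attach_leaf:
  assumes \<Gamma>: "serre_graph \<Gamma>" and sub: "subgraph_of T \<Gamma>" and T: "is_tree T"
    and f: "f \<in> edges \<Gamma>" "\<alpha>_of \<Gamma> f \<in> verts T" "\<omega>_of \<Gamma> f \<notin> verts T"
  defines "T' \<equiv> \<Gamma>\<lparr>verts := insert (\<omega>_of \<Gamma> f) (verts T), edges := edges T \<union> {f, einv \<Gamma> f}\<rparr>"
  shows "subgraph_of T' \<Gamma>" "is_tree T'" "subgraph_of T T'"
proof -
  let ?x = "\<omega>_of \<Gamma> f" and ?f = "einv \<Gamma> f"
  have T'[simp]: "verts T' = insert ?x (verts T)" "edges T' = edges T \<union> {f, ?f}"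
    "einv T' = einv \<Gamma>" "\<alpha>_of T' = \<alpha>_of \<Gamma>" "\<omega>_of T' = \<omega>_of \<Gamma>"
    by (simp_all add: T'_def)
  have sT: "serre_graph T" using T by (simp add: is_tree_def)
  have f': "?f \<in> edges \<Gamma>" "?f \<noteq> f" "einv \<Gamma> ?f = f" "\<alpha>_of \<Gamma> ?f = ?x" "\<omega>_of \<Gamma> ?f = \<alpha>_of \<Gamma> f"
    using f \<Gamma> \<alpha>_einv[OF \<Gamma>] by (auto simp: serre_graph_def)
  have same: "einv T e = einv \<Gamma> e" "\<alpha>_of T e = \<alpha>_of \<Gamma> e" "\<omega>_of T e = \<omega>_of \<Gamma> e" "e \<in> edges \<Gamma>"
    if "e \<in> edges T" for e
    using sub that by (auto simp: subgraph_of_def)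
  have T_closed: "einv \<Gamma> e \<in> edges T" "\<alpha>_of \<Gamma> e \<in> verts T" "\<omega>_of \<Gamma> e \<in> verts T" if "e \<in> edges T" for e
    using that sT same[OF that] unfolding serre_graph_def by metis+
  have sT': "serre_graph T'"
    unfolding serre_graph_def
    using f f' T_closed same(4) \<Gamma>[unfolded serre_graph_def] by auto
  have "verts T \<subseteq> verts \<Gamma>" using sub by (simp add: subgraph_of_def)
  moreover have "?x \<in> verts \<Gamma>" using f \<Gamma> by (auto simp: serre_graph_def)
  ultimately show subT': "subgraph_of T' \<Gamma>"
    using sT' f f' same(4) by (auto simp: subgraph_of_def)
  show subTT': "subgraph_of T T'"
    using sT same by (auto simp: subgraph_of_def)
  have toT: "\<exists>p. edge_path T' u p (\<alpha>_of \<Gamma> f)" if "u \<in> verts T'" for u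
  proof (cases "u \<in> verts T")
    case True
    then show ?thesis
      using T f(2) subgraph_edge_path[OF subTT'] unfolding is_tree_def graph_connected_def by blast
  next
    case False
    then have "edge_path T' u [?f] (\<alpha>_of \<Gamma> f)" using that f f' by simp
    then show ?thesis by blast
  qed
  have "graph_connected T'"
    unfolding graph_connected_def
    using toT edge_path_inverse[OF sT'] edge_path_append[OF sT'] by meson
  moreover have "p = []" if p: "edge_path T' u p u" "reduced_path T' p" for u p
  proof (rule ccontr)
    assume "p \<noteq> []"
    have pE: "set p \<subseteq> edges T \<union> {f, ?f}" using edge_path_edges[OF p(1)] by simp
    have in_T: "q = []"
      if q: "edge_path T' w q w" "reduced_path T' q" "f \<notin> set q" "?f \<notin> set q" "set q \<subseteq> edges T \<union> {f, ?f}" for w q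
    proof (rule ccontr)
      assume "q \<noteq> []"
      then obtain e r where e: "q = e # r" by (cases q) auto
      have "set q \<subseteq> edges T" using q by auto
      moreover have "w \<in> verts T" using q(1) T_closed(2) \<open>set q \<subseteq> edges T\<close> e by auto
      ultimately have "edge_path T w q w" "reduced_path T q"
        using subgraph_edge_path_iff[OF subTT'] q by blast+
      then show False using T \<open>q \<noteq> []\<close> unfolding is_tree_def by blast
    qed
    have out_x: "e = ?f" if "e \<in> edges T'" "\<alpha>_of \<Gamma> e = ?x" for e
      using that f(3) T_closed(2) by (metis T'(2) Un_iff empty_iff f'(4) f(2) insert_iff)
    have into_x: "e = f" if "e \<in> edges T'" "\<omega>_of \<Gamma> e = ?x" for e
      using that f(2,3) T_closed(3) by (metis T'(2) Un_iff empty_iff f'(5) insert_iff)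
    have end_f: "r = []" if eq: "p = q @ f # r" for q r
    proof (rule ccontr)
      assume "r \<noteq> []"
      then obtain e s where r: "r = e # s" by (cases r) auto
      then have "e \<in> edges T'" "\<alpha>_of \<Gamma> e = ?x"
        using p(1) unfolding eq by (auto simp: edge_path_append[OF sT'])
      then have "e = ?f" by (rule out_x)
      then show False using p(2) unfolding eq r by (auto simp: reduced_path_append reduced_path_def successively_append_iff)
    qed
    have start_f: "q = []" if eq: "p = q @ ?f # r" for q r
    proof (rule ccontr)
      assume "q \<noteq> []"
      then obtain e s where q: "q = s @ [e]" by (metis append_butlast_last_id)
      then have "e \<in> edges T'" "\<omega>_of \<Gamma> e = ?x"
        using p(1) f' unfolding eq by (auto simp: edge_path_append[OF sT'])
      then have "e = f" by (rule into_x)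
      then show False using p(2) unfolding eq q by (auto simp: reduced_path_append reduced_path_def successively_append_iff)
    qed
    have "u = ?x"
    proof -
      have "f \<in> set p \<or> ?f \<in> set p" using in_T[OF p] pE \<open>p \<noteq> []\<close> by blast
      then show ?thesis
      proof
        assume "f \<in> set p"
        then obtain q r where q: "p = q @ f # r" by (auto dest: split_list)
        then show ?thesis using end_f[OF q] p(1) by (auto simp: edge_path_append[OF sT'])
      next
        assume "?f \<in> set p"
        then obtain q r where q: "p = q @ ?f # r" by (auto dest: split_list)
        then show ?thesis using start_f[OF q] p(1) f' by auto
      qed
    qed
    obtain e q where e: "p = e # q" using \<open>p \<noteq> []\<close> by (cases p) auto
    have "e \<in> edges T'" "\<alpha>_of \<Gamma> e = ?x" and q: "edge_path T' (\<omega>_of \<Gamma> e) q ?x"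
      using p(1) by (simp_all add: e \<open>u = ?x\<close>)
    then have "e = ?f" by (intro out_x)
    have "q \<noteq> []"
    proof
      assume "q = []"
      then show False using q f f'(5) \<open>e = ?f\<close> by auto
    qed
    then obtain r g where g: "q = r @ [g]" by (metis append_butlast_last_id)
    have "g \<in> edges T'" "\<omega>_of \<Gamma> g = ?x"
      using q unfolding g by (auto simp: edge_path_append[OF sT'])
    then have "g = f" by (rule into_x)
    have p_eq: "p = ?f # r @ [f]" using e g \<open>e = ?f\<close> \<open>g = f\<close> by simp
    have "f \<notin> set r"
    proof
      assume "f \<in> set r"
      then obtain a b where "r = a @ f # b" by (auto dest: split_list)
      then show False using end_f[of "?f # a" "b @ [f]"] p_eq by simp
    qed
    moreover have "?f \<notin> set r"
    proof
      assume "?f \<in> set r"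
      then obtain a b where "r = a @ ?f # b" by (auto dest: split_list)
      then show False using start_f[of "?f # a" "b @ [f]"] p_eq by simp
    qed
    moreover have "edge_path T' (\<alpha>_of \<Gamma> f) r (\<alpha>_of \<Gamma> f)"
      using p(1) f' unfolding p_eq by (auto simp: edge_path_append[OF sT'])
    moreover have "reduced_path T' r"
      using p(2) unfolding p_eq by (auto simp: reduced_path_def successively_append_iff successively_Cons)
    moreover have "set r \<subseteq> edges T \<union> {f, ?f}" using pE p_eq by auto
    ultimately have "r = []" using in_T by blast
    then show False using p(2) f' unfolding p_eq by (simp add: reduced_path_def)
  qed
  ultimately show "is_tree T'"
    using sT' by (auto simp: is_tree_def)
qed

text \<open>Otherwise connectedness yields an edge leaving the tree, and attaching it as a leaf
  contradicts maximality.\<close>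

lemma maximal_tree_spanning:
  assumes \<Gamma>: "serre_graph \<Gamma>" "graph_connected \<Gamma>" and T: "maximal_tree T \<Gamma>"
  shows "verts T = verts \<Gamma>"
proof (rule ccontr)
  assume ne: "verts T \<noteq> verts \<Gamma>"
  have sub: "subgraph_of T \<Gamma>" "is_tree T" using T by (auto simp: maximal_tree_def)
  then obtain u v where "v \<in> verts T" "v \<in> verts \<Gamma>" "u \<in> verts \<Gamma>" "u \<notin> verts T"
    using ne by (auto simp: is_tree_def subgraph_of_def)
  then obtain p where "edge_path \<Gamma> v p u"
    using \<Gamma> unfolding graph_connected_def by blast
  from exists_boundary_edge[OF this \<open>v \<in> verts T\<close> \<open>u \<notin> verts T\<close>]
  obtain f where f: "f \<in> edges \<Gamma>" "\<alpha>_of \<Gamma> f \<in> verts T" "\<omega>_of \<Gamma> f \<notin> verts T" by blast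
  from tree_attach_leaf[OF \<Gamma>(1) sub f] T f(3) show False
    unfolding maximal_tree_def by (metis insertI1 pregraph.simps(1) pregraph.simps(6,7) pregraph.surjective pregraph.update_convs(1,2))
qed

text \<open>Euler characteristic 0 means twice as many oriented edges as vertices, which is two more
  than a spanning tree has; \<open>e\<close> and its inverse already account for these two.\<close>

lemma unicyclic_edges:
  assumes \<Gamma>: "serre_graph \<Gamma>" "graph_connected \<Gamma>" "finite (verts \<Gamma>)" "finite (edges \<Gamma>)"
    and chi: "euler_char \<Gamma> = 0"
    and T: "maximal_tree T \<Gamma>" and e: "e \<in> edges \<Gamma>" "e \<notin> edges T"
  shows "edges \<Gamma> = edges T \<union> {e, einv \<Gamma> e}" "einv \<Gamma> e \<notin> edges T"
proof -
  have sub: "subgraph_of T \<Gamma>" "is_tree T" using T by (auto simp: maximal_tree_def)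
  have V: "verts T = verts \<Gamma>" by (rule maximal_tree_spanning[OF \<Gamma>(1,2) T])
  obtain v where "v \<in> verts T" using sub(2) by (auto simp: is_tree_def)
  then interpret rooted_tree T v using sub by unfold_locales
  have ET: "edges T \<subseteq> edges \<Gamma>" using sub by (simp add: subgraph_of_def)
  have e': "einv \<Gamma> e \<in> edges \<Gamma>" "einv \<Gamma> e \<noteq> e" "einv \<Gamma> (einv \<Gamma> e) = e"
    using \<Gamma>(1) e(1) by (auto simp: serre_graph_def)
  show e'T: "einv \<Gamma> e \<notin> edges T"
    using e(2) e'(3) sub serre unfolding subgraph_of_def serre_graph_def by metis
  have "rat_of_nat (card (edges \<Gamma>)) = rat_of_nat (2 * card (verts \<Gamma>))"
    using chi by (simp add: euler_char_def)
  then have "card (edges \<Gamma>) = card (edges T) + 2"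
    using card_tree_edges(2) \<Gamma>(3) V by (simp only: of_nat_eq_iff)
  moreover have "card (edges T \<union> {e, einv \<Gamma> e}) = card (edges T) + 2"
    using e(2) e'(2) e'T finite_subset[OF ET \<Gamma>(4)] by simp
  ultimately show "edges \<Gamma> = edges T \<union> {e, einv \<Gamma> e}"
    using ET e(1) e'(1) \<Gamma>(4) by (metis Un_subset_iff bot_least card_subset_eq insert_subset)
qed

section \<open>Homomorphisms out of the fundamental group\<close>

fun word_val :: "('q, 'm) monoid_scheme \<Rightarrow> ('x \<Rightarrow> 'q) \<Rightarrow> 'x word \<Rightarrow> 'q" where
  "word_val Q m [] = \<one>\<^bsub>Q\<^esub>"
| "word_val Q m ((x, b) # w) = (if b then m x else inv\<^bsub>Q\<^esub> m x) \<otimes>\<^bsub>Q\<^esub> word_val Q m w"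

lemma word_val_closed:
  assumes "group Q" "m \<in> S \<rightarrow> carrier Q" "w \<in> words_over S"
  shows "word_val Q m w \<in> carrier Q"
proof -
  interpret group Q by fact
  show ?thesis using assms(2,3) by (induction w) (auto simp: Pi_iff)
qed

lemma word_val_append:
  assumes "group Q" "m \<in> S \<rightarrow> carrier Q" "v \<in> words_over S" "w \<in> words_over S"
  shows "word_val Q m (v @ w) = word_val Q m v \<otimes>\<^bsub>Q\<^esub> word_val Q m w"
proof -
  interpret group Q by fact
  show ?thesis using assms(3)
  proof (induction v)
    case Nil
    then show ?case using word_val_closed[OF assms(1,2,4)] by simp
  next
    case (Cons l v)
    then show ?case using assms word_val_closed[OF assms(1,2)] by (cases l) (auto simp: m_assoc Pi_iff)
  qed
qed

lemma pres_eq_word_val: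
  assumes Q: "group Q" "m \<in> S \<rightarrow> carrier Q"
    and rel: "\<And>r s. (r, s) \<in> R \<Longrightarrow> r \<in> words_over S \<Longrightarrow> s \<in> words_over S \<Longrightarrow>
      word_val Q m r = word_val Q m s"
    and "(w, w') \<in> pres_eq S R"
  shows "word_val Q m w = word_val Q m w'"
proof -
  interpret group Q by fact
  note app = word_val_append[OF Q] and cl = word_val_closed[OF Q]
  from assms(4) show ?thesis
  proof (induction rule: pres_eq.induct)
    case (cancel u v x b)
    have "m x \<in> carrier Q" using cancel Q by auto
    then have "word_val Q m ([(x, b), (x, \<not> b)] @ v) = word_val Q m v"
      using cl[OF cancel(2)] by (simp add: m_assoc[symmetric])
    then show ?case using cancel by (simp add: app)
  next
    case (relation u v r s)
    then show ?case by (simp add: app rel)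
  qed auto
qed

lemma presented_group_carrier:
  "carrier (presented_group S R) = (\<lambda>w. pres_eq S R `` {w}) ` words_over S"
  by (auto simp: presented_group_def quotient_def)

lemma presented_hom:
  assumes Q: "group Q" "m \<in> S \<rightarrow> carrier Q"
    and rel: "\<And>r s. (r, s) \<in> R \<Longrightarrow> r \<in> words_over S \<Longrightarrow> s \<in> words_over S \<Longrightarrow>
      word_val Q m r = word_val Q m s"
  shows "\<exists>\<Phi>\<in>hom (presented_group S R) Q. \<forall>w\<in>words_over S. \<Phi> (pres_eq S R `` {w}) = word_val Q m w"
proof -
  define \<Phi> where "\<Phi> = (\<lambda>A. word_val Q m (SOME w. w \<in> A))"
  have \<Phi>: "\<Phi> (pres_eq S R `` {w}) = word_val Q m w" if "w \<in> words_over S" for w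
  proof -
    have "w \<in> pres_eq S R `` {w}" using that by (simp add: pres_eq.refl)
    then have "(SOME v. v \<in> pres_eq S R `` {w}) \<in> pres_eq S R `` {w}" by (rule someI)
    then show ?thesis
      unfolding \<Phi>_def using pres_eq_word_val[OF Q rel] by simp
  qed
  have "\<Phi> \<in> hom (presented_group S R) Q"
  proof (rule homI)
    fix x assume "x \<in> carrier (presented_group S R)"
    then show "\<Phi> x \<in> carrier Q"
      using \<Phi> word_val_closed[OF Q] by (auto simp: presented_group_carrier)
  next
    fix x y assume "x \<in> carrier (presented_group S R)" "y \<in> carrier (presented_group S R)"
    then show "\<Phi> (x \<otimes>\<^bsub>presented_group S R\<^esub> y) = \<Phi> x \<otimes>\<^bsub>Q\<^esub> \<Phi> y"
      using \<Phi> word_val_append[OF Q] by (auto simp: presented_group_carrier presented_mult)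
  qed
  then show ?thesis using \<Phi> by blast
qed

lemma presented_group_inv_gen:
  assumes "x \<in> S"
  shows "inv\<^bsub>presented_group S R\<^esub> (pres_eq S R `` {[(x, True)]}) = pres_eq S R `` {[(x, False)]}"
proof -
  interpret group "presented_group S R" by (rule presented_group_is_group)
  have "([(x, False), (x, True)], []) \<in> pres_eq S R"
    using pres_eq.cancel[of "[]" S "[]" x False R] assms by simp
  then have "pres_eq S R `` {[(x, False)]} \<otimes>\<^bsub>presented_group S R\<^esub> pres_eq S R `` {[(x, True)]}
      = \<one>\<^bsub>presented_group S R\<^esub>"
    using equiv_class_eq[OF equiv_pres_eq] assms by (simp add: presented_mult) (simp add: presented_group_def)
  then show ?thesis
    using assms by (intro inv_equality) (auto simp: presented_group_carrier)
qed

lemma presented_group_rel: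
  assumes "(r, s) \<in> R" "r \<in> words_over S" "s \<in> words_over S"
  shows "pres_eq S R `` {r} = pres_eq S R `` {s}"
  using pres_eq.relation[of "[]" S "[]" r s R] assms
  by (intro equiv_class_eq[OF equiv_pres_eq]) simp

section \<open>The fundamental group: generators, relations and maps out of it\<close>

locale graph_of_groups_presentation = finite_graph_of_groups \<Gamma> VG EG \<phi>
  for \<Gamma> :: "('v, 'e) pregraph" and VG :: "'v \<Rightarrow> 'a monoid" and EG :: "'e \<Rightarrow> 'b monoid"
    and \<phi> :: "'e \<Rightarrow> 'b \<Rightarrow> 'a" +
  fixes T\<^sub>0 :: "('v, 'e) pregraph" and P :: "'e set"
  assumes maxtree: "maximal_tree T\<^sub>0 \<Gamma>" and orient: "orientation \<Gamma> P"
begin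

abbreviation G :: "('v, 'e, 'a) gog_gen word set monoid" where
  "G \<equiv> fundamental_group \<Gamma> VG EG \<phi> T\<^sub>0 P"

abbreviation word_class :: "('v, 'e, 'a) gog_gen word \<Rightarrow> ('v, 'e, 'a) gog_gen word set" where
  "word_class w \<equiv> pres_eq (gog_gens \<Gamma> VG P) (gog_rels \<Gamma> VG EG \<phi> T\<^sub>0 P) `` {w}"

definition \<iota> :: "'v \<Rightarrow> 'a \<Rightarrow> ('v, 'e, 'a) gog_gen word set" where
  "\<iota> v a = word_class [(Elt v a, True)]"

text \<open>Negative edges get the inverse letter, so that \<open>stable_rel\<close> holds for every
  edge whatever its sign.\<close>

definition stable :: "'e \<Rightarrow> ('v, 'e, 'a) gog_gen word set" where
  "stable e = (if e \<in> P then word_class [(Stable e, True)]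
     else word_class [(Stable (einv \<Gamma> e), False)])"

sublocale G: group G
  by (rule group_fundamental_group)

lemma serre: "serre_graph \<Gamma>" by unfold_locales

lemma orient_cases:
  assumes "e \<in> edges \<Gamma>"
  shows "e \<in> P \<and> einv \<Gamma> e \<notin> P \<or> e \<notin> P \<and> einv \<Gamma> e \<in> P"
proof -
  have E: "edges \<Gamma> = P \<union> einv \<Gamma> ` P" and disj: "P \<inter> einv \<Gamma> ` P = {}"
    using orient by (auto simp: orientation_def)
  show ?thesis
  proof (cases "e \<in> P")
    case True
    have "einv \<Gamma> e \<in> einv \<Gamma> ` P" using True by (rule imageI)
    then show ?thesis using True disj by blast
  next
    case False
    then obtain f where f: "f \<in> P" "e = einv \<Gamma> f" using assms E by auto
    then have "einv \<Gamma> e = f" using E einv_einv by blast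
    then show ?thesis using f False by simp
  qed
qed

lemma P_edges: "e \<in> P \<Longrightarrow> e \<in> edges \<Gamma>"
  using orient by (auto simp: orientation_def)

lemma gens: "v \<in> verts \<Gamma> \<Longrightarrow> a \<in> carrier (VG v) \<Longrightarrow> Elt v a \<in> gog_gens \<Gamma> VG P"
  "e \<in> P \<Longrightarrow> Stable e \<in> gog_gens \<Gamma> VG P"
  by (auto simp: gog_gens_def)

lemma word_class_closed:
  "w \<in> words_over (gog_gens \<Gamma> VG P) \<Longrightarrow> word_class w \<in> carrier G"
  by (auto simp: fundamental_group_def presented_group_carrier)

lemma word_class_mult:
  "v \<in> words_over (gog_gens \<Gamma> VG P) \<Longrightarrow> w \<in> words_over (gog_gens \<Gamma> VG P) \<Longrightarrow>
     word_class v \<otimes>\<^bsub>G\<^esub> word_class w = word_class (v @ w)"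
  by (simp add: fundamental_group_def presented_mult)

lemma word_class_one: "word_class [] = \<one>\<^bsub>G\<^esub>"
  by (simp add: fundamental_group_def presented_group_def)

lemma word_class_inv:
  "x \<in> gog_gens \<Gamma> VG P \<Longrightarrow> inv\<^bsub>G\<^esub> word_class [(x, True)] = word_class [(x, False)]"
  by (simp add: fundamental_group_def presented_group_inv_gen)

lemma \<phi>_hom: "e \<in> edges \<Gamma> \<Longrightarrow> \<phi> e \<in> hom (EG e) (VG (\<alpha>_of \<Gamma> e))"
  and \<phi>_inj: "e \<in> edges \<Gamma> \<Longrightarrow> inj_on (\<phi> e) (carrier (EG e))"
  using edge_mono by (auto simp: mon_def)

lemma \<phi>_closed: "e \<in> edges \<Gamma> \<Longrightarrow> a \<in> carrier (EG e) \<Longrightarrow> \<phi> e a \<in> carrier (VG (\<alpha>_of \<Gamma> e))"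
  using \<phi>_hom by (auto simp: hom_def)

lemma \<phi>_einv_closed:
  "e \<in> edges \<Gamma> \<Longrightarrow> a \<in> carrier (EG e) \<Longrightarrow> \<phi> (einv \<Gamma> e) a \<in> carrier (VG (\<omega>_of \<Gamma> e))"
  using \<phi>_closed[of "einv \<Gamma> e" a] by (simp add: edge_group_einv einv_closed \<alpha>_einv[OF serre])

lemma \<iota>_closed: "v \<in> verts \<Gamma> \<Longrightarrow> a \<in> carrier (VG v) \<Longrightarrow> \<iota> v a \<in> carrier G"
  by (simp add: \<iota>_def word_class_closed gens)

lemma stable_closed: "e \<in> edges \<Gamma> \<Longrightarrow> stable e \<in> carrier G"
  using orient_cases[of e] by (auto simp: stable_def word_class_closed gens)

lemma \<iota>_hom: "v \<in> verts \<Gamma> \<Longrightarrow> \<iota> v \<in> hom (VG v) G"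
proof (rule homI)
  assume v: "v \<in> verts \<Gamma>"
  show "\<iota> v a \<in> carrier G" if "a \<in> carrier (VG v)" for a
    using that v by (rule \<iota>_closed[rotated])
  show "\<iota> v (a \<otimes>\<^bsub>VG v\<^esub> b) = \<iota> v a \<otimes>\<^bsub>G\<^esub> \<iota> v b" if ab: "a \<in> carrier (VG v)" "b \<in> carrier (VG v)" for a b
  proof -
    interpret group "VG v" using v by (rule vertex_group)
    have "word_class [(Elt v a, True), (Elt v b, True)] = word_class [(Elt v (a \<otimes>\<^bsub>VG v\<^esub> b), True)]"
      using v ab by (intro presented_group_rel) (auto simp: gog_rels_def gens)
    then show ?thesis using v ab by (simp add: \<iota>_def word_class_mult gens)
  qed
qed

lemma stable_einv: "e \<in> edges \<Gamma> \<Longrightarrow> stable (einv \<Gamma> e) = inv\<^bsub>G\<^esub> stable e"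
  using orient_cases[of e] einv_einv[of e] gens(2)[of e] gens(2)[of "einv \<Gamma> e"]
  by (auto simp: stable_def word_class_inv[symmetric] word_class_closed)

lemma stable_rel:
  assumes "e \<in> edges \<Gamma>" "a \<in> carrier (EG e)"
  shows "stable e \<otimes>\<^bsub>G\<^esub> \<iota> (\<omega>_of \<Gamma> e) (\<phi> (einv \<Gamma> e) a) = \<iota> (\<alpha>_of \<Gamma> e) (\<phi> e a) \<otimes>\<^bsub>G\<^esub> stable e"
proof -
  have pos: "stable e \<otimes>\<^bsub>G\<^esub> \<iota> (\<omega>_of \<Gamma> e) (\<phi> (einv \<Gamma> e) a) = \<iota> (\<alpha>_of \<Gamma> e) (\<phi> e a) \<otimes>\<^bsub>G\<^esub> stable e"
    if e: "e \<in> P" "a \<in> carrier (EG e)" for e a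
  proof -
    let ?b = "\<phi> (einv \<Gamma> e) a"
    have eE: "e \<in> edges \<Gamma>" using e P_edges by simp
    note gg = gens(1)[OF \<omega>_closed[OF eE] \<phi>_einv_closed[OF eE e(2)]] gens(2)[OF e(1)]
      gens(1)[OF \<alpha>_closed[OF eE] \<phi>_closed[OF eE e(2)]]
    have "word_class [(Stable e, True), (Elt (\<omega>_of \<Gamma> e) ?b, True), (Stable e, False)]
        = word_class [(Elt (\<alpha>_of \<Gamma> e) (\<phi> e a), True)]"
      using e gg by (intro presented_group_rel) (auto simp: gog_rels_def)
    moreover have "word_class [(Stable e, True), (Elt (\<omega>_of \<Gamma> e) ?b, True), (Stable e, False)]
        = word_class [(Stable e, True)] \<otimes>\<^bsub>G\<^esub> word_class [(Elt (\<omega>_of \<Gamma> e) ?b, True)] \<otimes>\<^bsub>G\<^esub> word_class [(Stable e, False)]"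
      using gg by (simp add: word_class_mult)
    ultimately have "stable e \<otimes>\<^bsub>G\<^esub> \<iota> (\<omega>_of \<Gamma> e) ?b \<otimes>\<^bsub>G\<^esub> inv\<^bsub>G\<^esub> stable e = \<iota> (\<alpha>_of \<Gamma> e) (\<phi> e a)"
      using e(1) gg by (simp add: stable_def \<iota>_def word_class_inv)
    moreover have "stable e \<in> carrier G" "\<iota> (\<omega>_of \<Gamma> e) ?b \<in> carrier G" "\<iota> (\<alpha>_of \<Gamma> e) (\<phi> e a) \<in> carrier G"
      using eE stable_closed \<iota>_closed \<omega>_closed \<alpha>_closed \<phi>_closed \<phi>_einv_closed e(2) by auto
    ultimately show ?thesis by (metis G.inv_solve_right G.m_closed)
  qed
  show ?thesis
  proof (cases "e \<in> P")
    case True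
    then show ?thesis using pos assms by simp
  next
    case False
    let ?e = "einv \<Gamma> e"
    have "?e \<in> P" using False orient_cases assms by blast
    then have "stable ?e \<otimes>\<^bsub>G\<^esub> \<iota> (\<omega>_of \<Gamma> ?e) (\<phi> (einv \<Gamma> ?e) a) = \<iota> (\<alpha>_of \<Gamma> ?e) (\<phi> ?e a) \<otimes>\<^bsub>G\<^esub> stable ?e"
      using assms by (intro pos) (auto simp: edge_group_einv)
    then have "inv\<^bsub>G\<^esub> stable e \<otimes>\<^bsub>G\<^esub> \<iota> (\<alpha>_of \<Gamma> e) (\<phi> e a) = \<iota> (\<omega>_of \<Gamma> e) (\<phi> ?e a) \<otimes>\<^bsub>G\<^esub> inv\<^bsub>G\<^esub> stable e"
      using assms by (simp add: stable_einv \<omega>_einv einv_einv \<alpha>_einv[OF serre])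
    moreover have "stable e \<in> carrier G" "\<iota> (\<alpha>_of \<Gamma> e) (\<phi> e a) \<in> carrier G" "\<iota> (\<omega>_of \<Gamma> e) (\<phi> ?e a) \<in> carrier G"
      using assms stable_closed \<iota>_closed \<omega>_closed \<alpha>_closed \<phi>_closed \<phi>_einv_closed by auto
    ultimately show ?thesis
      by (metis G.inv_closed G.inv_solve_left G.inv_solve_right G.m_assoc G.m_closed)
  qed
qed

lemma stable_tree:
  assumes "e \<in> edges T\<^sub>0"
  shows "stable e = \<one>\<^bsub>G\<^esub>"
proof -
  have sub: "subgraph_of T\<^sub>0 \<Gamma>" using maxtree by (simp add: maximal_tree_def)
  have pos: "stable f = \<one>\<^bsub>G\<^esub>" if "f \<in> edges T\<^sub>0" "f \<in> P" for f
  proof -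
    have "word_class [(Stable f, True)] = word_class []"
      using that by (intro presented_group_rel) (auto simp: gog_rels_def gens)
    then show ?thesis using that by (simp add: stable_def word_class_one)
  qed
  show ?thesis
  proof (cases "e \<in> P")
    case False
    have e: "e \<in> edges \<Gamma>" "einv \<Gamma> e \<in> edges T\<^sub>0"
      using sub assms unfolding subgraph_of_def serre_graph_def by (metis subsetD)+
    then have "stable (einv \<Gamma> e) = \<one>\<^bsub>G\<^esub>" using pos False orient_cases by blast
    then show ?thesis using stable_einv[OF e(1)] stable_closed[OF e(1)] by simp
  qed (rule pos[OF assms])
qed

lemma \<iota>_inv: "v \<in> verts \<Gamma> \<Longrightarrow> a \<in> carrier (VG v) \<Longrightarrow> \<iota> v (inv\<^bsub>VG v\<^esub> a) = inv\<^bsub>G\<^esub> \<iota> v a"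
  using group_hom.hom_inv[of "VG v" G "\<iota> v" a] \<iota>_hom vertex_group
  by (simp add: group_hom_def group_hom_axioms_def G.group_axioms)

text \<open>Inverse letters are covered by the two cases: the inverse of a vertex letter comes from
  the inverse vertex element, and that of a stable letter is the letter of the inverse edge. Letters
  are prepended, as path representations will require.\<close>

lemma G_induct [consumes 1, case_names one vertex edge]:
  assumes "x \<in> carrier G"
    and one: "Q \<one>\<^bsub>G\<^esub>"
    and vertex: "\<And>v a y. v \<in> verts \<Gamma> \<Longrightarrow> a \<in> carrier (VG v) \<Longrightarrow> y \<in> carrier G \<Longrightarrow> Q y \<Longrightarrow> Q (\<iota> v a \<otimes>\<^bsub>G\<^esub> y)"
    and edge: "\<And>e y. e \<in> edges \<Gamma> \<Longrightarrow> y \<in> carrier G \<Longrightarrow> Q y \<Longrightarrow> Q (stable e \<otimes>\<^bsub>G\<^esub> y)"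
  shows "Q x"
proof -
  obtain w where w: "w \<in> words_over (gog_gens \<Gamma> VG P)" "x = word_class w"
    using assms(1) by (auto simp: fundamental_group_def presented_group_carrier)
  have "Q (word_class w)" using w(1)
  proof (induction w)
    case Nil
    then show ?case using one word_class_one by simp
  next
    case (Cons l w)
    obtain s b where l: "l = (s, b)" by (cases l)
    have s: "s \<in> gog_gens \<Gamma> VG P" and w: "w \<in> words_over (gog_gens \<Gamma> VG P)" using Cons.prems l by auto
    have IH: "Q (word_class w)" "word_class w \<in> carrier G" using Cons.IH w word_class_closed by auto
    have eq: "word_class (l # w) = word_class [(s, b)] \<otimes>\<^bsub>G\<^esub> word_class w"
      using s w l by (simp add: word_class_mult)
    show ?case
    proof (cases s)
      case (Elt v a)
      then have va: "v \<in> verts \<Gamma>" "a \<in> carrier (VG v)" using s by (auto simp: gog_gens_def)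
      then have "word_class [(s, b)] = \<iota> v (if b then a else inv\<^bsub>VG v\<^esub> a)"
        using Elt s word_class_inv[OF s] \<iota>_inv by (auto simp: \<iota>_def)
      moreover have "(if b then a else inv\<^bsub>VG v\<^esub> a) \<in> carrier (VG v)"
        using va group.inv_closed[OF vertex_group] by auto
      ultimately show ?thesis using vertex[OF va(1) _ IH(2,1)] unfolding eq by simp
    next
      case (Stable e)
      then have e: "e \<in> P" using s by (auto simp: gog_gens_def)
      have "word_class [(s, b)] = stable (if b then e else einv \<Gamma> e)"
        using e orient_cases[of e] P_edges[OF e] Stable by (auto simp: stable_def einv_einv)
      moreover have "(if b then e else einv \<Gamma> e) \<in> edges \<Gamma>" using P_edges[OF e] einv_closed by auto
      ultimately show ?thesis using edge[OF _ IH(2,1)] unfolding eq by simp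
    qed
  qed
  then show ?thesis using w by simp
qed

text \<open>The values \<open>q\<close> satisfy the edge relations but need not be trivial on
  \<open>T\<^sub>0\<close>, as the presentation demands. Let \<open>p v\<close> be the product of
  the values along the \<open>T\<^sub>0\<close>-path from a root to \<open>v\<close>. Conjugating
  \<open>\<psi> v\<close> by \<open>p v\<close>, and multiplying \<open>q e\<close> by
  \<open>p\<close> at its origin on the left and by the inverse of \<open>p\<close> at its end on
  the right, preserves the relations and makes the tree letters trivial.\<close>

lemma gauged_hom:
  assumes Q: "group (Q :: ('q, 'm) monoid_scheme)"
    and \<psi>: "\<And>v. v \<in> verts \<Gamma> \<Longrightarrow> \<psi> v \<in> hom (VG v) Q"
    and q: "\<And>e. e \<in> edges \<Gamma> \<Longrightarrow> q e \<in> carrier Q"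
    and q_einv: "\<And>e. e \<in> edges \<Gamma> \<Longrightarrow> q (einv \<Gamma> e) = inv\<^bsub>Q\<^esub> q e"
    and rel: "\<And>e a. e \<in> edges \<Gamma> \<Longrightarrow> a \<in> carrier (EG e) \<Longrightarrow>
      q e \<otimes>\<^bsub>Q\<^esub> \<psi> (\<omega>_of \<Gamma> e) (\<phi> (einv \<Gamma> e) a) = \<psi> (\<alpha>_of \<Gamma> e) (\<phi> e a) \<otimes>\<^bsub>Q\<^esub> q e"
  shows "\<exists>\<Phi> p. \<Phi> \<in> hom G Q \<and> (\<forall>v\<in>verts \<Gamma>. p v \<in> carrier Q) \<and>
    (\<forall>v\<in>verts \<Gamma>. \<forall>a\<in>carrier (VG v). \<Phi> (\<iota> v a) = p v \<otimes>\<^bsub>Q\<^esub> \<psi> v a \<otimes>\<^bsub>Q\<^esub> inv\<^bsub>Q\<^esub> p v) \<and>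
    (\<forall>e\<in>edges \<Gamma>. \<Phi> (stable e) = p (\<alpha>_of \<Gamma> e) \<otimes>\<^bsub>Q\<^esub> q e \<otimes>\<^bsub>Q\<^esub> inv\<^bsub>Q\<^esub> p (\<omega>_of \<Gamma> e))"
proof -
  interpret Q: group Q by fact
  have sub: "subgraph_of T\<^sub>0 \<Gamma>" "is_tree T\<^sub>0" using maxtree by (auto simp: maximal_tree_def)
  obtain v\<^sub>0 where "v\<^sub>0 \<in> verts T\<^sub>0" using sub(2) by (auto simp: is_tree_def)
  then interpret T: rooted_tree T\<^sub>0 v\<^sub>0 using sub by unfold_locales
  have TE: "f \<in> edges \<Gamma>" "einv T\<^sub>0 f = einv \<Gamma> f" "\<alpha>_of T\<^sub>0 f = \<alpha>_of \<Gamma> f" "\<omega>_of T\<^sub>0 f = \<omega>_of \<Gamma> f"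
    if "f \<in> edges T\<^sub>0" for f
    using sub that by (auto simp: subgraph_of_def)
  have VT: "verts T\<^sub>0 = verts \<Gamma>" by (rule maximal_tree_spanning[OF serre connected maxtree])
  have "\<exists>p. (\<forall>u\<in>verts T\<^sub>0. p u \<in> carrier Q) \<and> p v\<^sub>0 = \<one>\<^bsub>Q\<^esub> \<and>
    (\<forall>f\<in>edges T\<^sub>0. p (\<alpha>_of T\<^sub>0 f) \<otimes>\<^bsub>Q\<^esub> q f = p (\<omega>_of T\<^sub>0 f))"
  proof (rule T.tree_choice)
    fix f x assume f: "f \<in> edges T\<^sub>0" "x \<in> carrier Q"
    then show "\<exists>y\<in>carrier Q. x \<otimes>\<^bsub>Q\<^esub> q f = y" using q TE by auto
  next
    fix f x y assume "f \<in> edges T\<^sub>0" "x \<in> carrier Q" "y \<in> carrier Q" "x \<otimes>\<^bsub>Q\<^esub> q f = y"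
    then show "y \<otimes>\<^bsub>Q\<^esub> q (einv T\<^sub>0 f) = x"
      using q q_einv TE by (metis Q.inv_solve_right)
  qed simp
  then obtain p where p0: "\<forall>u\<in>verts T\<^sub>0. p u \<in> carrier Q"
    "\<forall>f\<in>edges T\<^sub>0. p (\<alpha>_of T\<^sub>0 f) \<otimes>\<^bsub>Q\<^esub> q f = p (\<omega>_of T\<^sub>0 f)" by blast
  have p: "p u \<in> carrier Q" if "u \<in> verts \<Gamma>" for u
    using p0(1) that VT by simp
  have pT: "p (\<alpha>_of \<Gamma> f) \<otimes>\<^bsub>Q\<^esub> q f = p (\<omega>_of \<Gamma> f)" if "f \<in> edges T\<^sub>0" for f
    using p0(2) that TE by metis
  define q' where "q' = (\<lambda>e. p (\<alpha>_of \<Gamma> e) \<otimes>\<^bsub>Q\<^esub> q e \<otimes>\<^bsub>Q\<^esub> inv\<^bsub>Q\<^esub> p (\<omega>_of \<Gamma> e))"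
  define \<psi>' where "\<psi>' = (\<lambda>v a. p v \<otimes>\<^bsub>Q\<^esub> \<psi> v a \<otimes>\<^bsub>Q\<^esub> inv\<^bsub>Q\<^esub> p v)"
  define m where "m = (\<lambda>g. case g of Elt v a \<Rightarrow> \<psi>' v a | Stable e \<Rightarrow> q' e)"
  have \<psi>_cl: "\<psi> v a \<in> carrier Q" if "v \<in> verts \<Gamma>" "a \<in> carrier (VG v)" for v a
    using \<psi> that by (auto simp: hom_def)
  have \<psi>'_cl: "\<psi>' v a \<in> carrier Q" if "v \<in> verts \<Gamma>" "a \<in> carrier (VG v)" for v a
    using \<psi>_cl p that by (simp add: \<psi>'_def)
  have q'_cl: "q' e \<in> carrier Q" if "e \<in> edges \<Gamma>" for e
    using q p that \<alpha>_closed \<omega>_closed by (simp add: q'_def)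
  have q'_einv: "q' (einv \<Gamma> e) = inv\<^bsub>Q\<^esub> q' e" if e: "e \<in> edges \<Gamma>" for e
    using e q p \<alpha>_closed \<omega>_closed q_einv
    by (simp add: q'_def \<omega>_einv \<alpha>_einv[OF serre] Q.inv_mult_group Q.m_assoc)
  have canc: "inv\<^bsub>Q\<^esub> p u \<otimes>\<^bsub>Q\<^esub> (p u \<otimes>\<^bsub>Q\<^esub> x) = x" if "u \<in> verts \<Gamma>" "x \<in> carrier Q" for u x
    using p that by (simp add: Q.m_assoc[symmetric])
  have rel': "q' e \<otimes>\<^bsub>Q\<^esub> \<psi>' (\<omega>_of \<Gamma> e) (\<phi> (einv \<Gamma> e) a) = \<psi>' (\<alpha>_of \<Gamma> e) (\<phi> e a) \<otimes>\<^bsub>Q\<^esub> q' e"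
    if e: "e \<in> edges \<Gamma>" "a \<in> carrier (EG e)" for e a
  proof -
    have c: "p (\<alpha>_of \<Gamma> e) \<in> carrier Q" "p (\<omega>_of \<Gamma> e) \<in> carrier Q" "q e \<in> carrier Q"
      "\<psi> (\<omega>_of \<Gamma> e) (\<phi> (einv \<Gamma> e) a) \<in> carrier Q" "\<psi> (\<alpha>_of \<Gamma> e) (\<phi> e a) \<in> carrier Q"
      "\<alpha>_of \<Gamma> e \<in> verts \<Gamma>" "\<omega>_of \<Gamma> e \<in> verts \<Gamma>"
      using e p q \<psi>_cl \<alpha>_closed \<omega>_closed \<phi>_closed \<phi>_einv_closed by auto
    have "q' e \<otimes>\<^bsub>Q\<^esub> \<psi>' (\<omega>_of \<Gamma> e) (\<phi> (einv \<Gamma> e) a)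
      = p (\<alpha>_of \<Gamma> e) \<otimes>\<^bsub>Q\<^esub> (q e \<otimes>\<^bsub>Q\<^esub> \<psi> (\<omega>_of \<Gamma> e) (\<phi> (einv \<Gamma> e) a)) \<otimes>\<^bsub>Q\<^esub> inv\<^bsub>Q\<^esub> p (\<omega>_of \<Gamma> e)"
      using c by (simp add: q'_def \<psi>'_def Q.m_assoc canc)
    also have "\<dots> = \<psi>' (\<alpha>_of \<Gamma> e) (\<phi> e a) \<otimes>\<^bsub>Q\<^esub> q' e"
      unfolding rel[OF e] using c by (simp add: q'_def \<psi>'_def Q.m_assoc canc)
    finally show ?thesis .
  qed
  have m: "m \<in> gog_gens \<Gamma> VG P \<rightarrow> carrier Q"
    using \<psi>'_cl q'_cl P_edges by (auto simp: m_def gog_gens_def)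
  have "\<exists>\<Phi>\<in>hom (presented_group (gog_gens \<Gamma> VG P) (gog_rels \<Gamma> VG EG \<phi> T\<^sub>0 P)) Q.
     \<forall>w\<in>words_over (gog_gens \<Gamma> VG P). \<Phi> (word_class w) = word_val Q m w"
  proof (rule presented_hom[OF Q m])
    fix r s assume "(r, s) \<in> gog_rels \<Gamma> VG EG \<phi> T\<^sub>0 P"
    then consider (mult) v a b where "v \<in> verts \<Gamma>" "a \<in> carrier (VG v)" "b \<in> carrier (VG v)"
        "r = [(Elt v a, True), (Elt v b, True)]" "s = [(Elt v (a \<otimes>\<^bsub>VG v\<^esub> b), True)]"
      | (conj) e a where "e \<in> P" "a \<in> carrier (EG e)"
        "r = [(Stable e, True), (Elt (\<omega>_of \<Gamma> e) (\<phi> (einv \<Gamma> e) a), True), (Stable e, False)]"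
        "s = [(Elt (\<alpha>_of \<Gamma> e) (\<phi> e a), True)]"
      | (tree) f where "f \<in> edges T\<^sub>0" "f \<in> P" "r = [(Stable f, True)]" "s = []"
      by (auto simp: gog_rels_def)
    then show "word_val Q m r = word_val Q m s"
    proof cases
      case mult
      interpret group "VG v" using mult by (simp add: vertex_group)
      have "\<psi> v (a \<otimes>\<^bsub>VG v\<^esub> b) = \<psi> v a \<otimes>\<^bsub>Q\<^esub> \<psi> v b" using \<psi> mult by (auto simp: hom_def)
      then show ?thesis using mult p \<psi>_cl
        by (simp add: m_def \<psi>'_def Q.m_assoc canc)
    next
      case conj
      have e: "e \<in> edges \<Gamma>" using conj P_edges by simp
      have c: "q' e \<in> carrier Q" "\<psi>' (\<omega>_of \<Gamma> e) (\<phi> (einv \<Gamma> e) a) \<in> carrier Q" "\<psi>' (\<alpha>_of \<Gamma> e) (\<phi> e a) \<in> carrier Q"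
        using q'_cl \<psi>'_cl e conj(2) \<alpha>_closed \<omega>_closed \<phi>_closed \<phi>_einv_closed by auto
      have "word_val Q m r = q' e \<otimes>\<^bsub>Q\<^esub> \<psi>' (\<omega>_of \<Gamma> e) (\<phi> (einv \<Gamma> e) a) \<otimes>\<^bsub>Q\<^esub> inv\<^bsub>Q\<^esub> q' e"
        using conj c by (simp add: m_def Q.m_assoc)
      also have "\<dots> = \<psi>' (\<alpha>_of \<Gamma> e) (\<phi> e a)"
        unfolding rel'[OF e conj(2)] using c by (simp add: Q.m_assoc)
      finally show ?thesis using conj c by (simp add: m_def)
    next
      case tree
      have "q' f = \<one>\<^bsub>Q\<^esub>"
        using pT[OF tree(1)] p \<omega>_closed TE(1)[OF tree(1)] by (simp add: q'_def)
      then show ?thesis using tree by (simp add: m_def)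
    qed
  qed
  then obtain \<Phi> where \<Phi>: "\<Phi> \<in> hom G Q"
    and \<Phi>w: "\<And>w. w \<in> words_over (gog_gens \<Gamma> VG P) \<Longrightarrow> \<Phi> (word_class w) = word_val Q m w"
    unfolding fundamental_group_def by blast
  have "\<Phi> (\<iota> v a) = \<psi>' v a" if "v \<in> verts \<Gamma>" "a \<in> carrier (VG v)" for v a
    using that \<Phi>w[of "[(Elt v a, True)]"] \<psi>'_cl by (simp add: \<iota>_def gens m_def)
  moreover have "\<Phi> (stable e) = q' e" if "e \<in> edges \<Gamma>" for e
  proof (cases "e \<in> P")
    case True
    then show ?thesis using that \<Phi>w[of "[(Stable e, True)]"] q'_cl by (simp add: stable_def gens m_def)
  next
    case False
    then have "einv \<Gamma> e \<in> P" using orient_cases that by blast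
    then show ?thesis
      using that False \<Phi>w[of "[(Stable (einv \<Gamma> e), False)]"] q'_cl q'_einv by (simp add: stable_def gens m_def)
  qed
  ultimately show ?thesis using \<Phi> p unfolding q'_def \<psi>'_def by blast
qed

end

section \<open>Detecting virtual retracts by actions\<close>

text \<open>Each fibre of \<open>\<theta>\<close> lies in a single coset, so one representative per
  fibre lists all cosets.\<close>

lemma (in group) finite_index_by_map:
  assumes K: "subgroup K G" and F: "finite F" "\<theta> \<in> carrier G \<rightarrow> F"
    and same: "\<And>x y. x \<in> carrier G \<Longrightarrow> y \<in> carrier G \<Longrightarrow> \<theta> x = \<theta> y \<Longrightarrow> x \<otimes> inv y \<in> K"
  shows "finite (rcosets K)"
proof (rule finite_subset)
  let ?r = "\<lambda>t. K #> (SOME x. x \<in> carrier G \<and> \<theta> x = t)"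
  show "rcosets K \<subseteq> ?r ` F"
  proof
    fix C assume "C \<in> rcosets K"
    then obtain x where x: "x \<in> carrier G" "C = K #> x" by (auto simp: RCOSETS_def)
    let ?y = "SOME y. y \<in> carrier G \<and> \<theta> y = \<theta> x"
    have y: "?y \<in> carrier G" "\<theta> ?y = \<theta> x"
      using someI[of "\<lambda>y. y \<in> carrier G \<and> \<theta> y = \<theta> x" x] x by auto
    have "K #> ?y = K #> x"
    proof (rule coset_mult_inv1[symmetric])
      show "K #> (x \<otimes> inv ?y) = K"
        using K same[OF x(1) y(1)] x y by (intro coset_join2) auto
    qed (use x y K subgroup.subset in auto)
    then show "C \<in> ?r ` F" using x F by blast
  qed
  show "finite (?r ` F)" using F by simp
qed

section \<open>Permutations commuting with translation, and the retracts they detect\<close>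

definition shift :: "int \<Rightarrow> 'x \<times> int \<Rightarrow> 'x \<times> int" where
  "shift k p = (fst p, snd p + k)"

text \<open>On \<open>S\<close> times the integers an element amounts to a permutation of
  \<open>S\<close> with an integer attached to each point, that is, to an element of the wreath
  product of the integers with the symmetric group of \<open>S\<close>. Taking bijections of the
  whole type lets the multiplication be plain composition.\<close>

definition shift_group :: "'x set \<Rightarrow> ('x \<times> int \<Rightarrow> 'x \<times> int) monoid" where
  "shift_group S = \<lparr>carrier = {f. bij f \<and> (\<forall>p k. f (shift k p) = shift k (f p)) \<and> f ` (S \<times> UNIV) = S \<times> UNIV},
     monoid.mult = (\<lambda>f g. f \<circ> g), monoid.one = id\<rparr>"

lemma shift_group_simps [simp]:
  "f \<otimes>\<^bsub>shift_group S\<^esub> g = f \<circ> g" "\<one>\<^bsub>shift_group S\<^esub> = id"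
  by (simp_all add: shift_group_def)

lemma shift_groupI:
  "bij f \<Longrightarrow> (\<And>p k. f (shift k p) = shift k (f p)) \<Longrightarrow> f ` (S \<times> UNIV) = S \<times> UNIV \<Longrightarrow>
     f \<in> carrier (shift_group S)"
  by (simp add: shift_group_def)

lemma shift_groupD:
  assumes "f \<in> carrier (shift_group S)"
  shows "bij f" "f (shift k p) = shift k (f p)" "f ` (S \<times> UNIV) = S \<times> UNIV"
  using assms by (simp_all add: shift_group_def del: split_paired_All)

lemma inv_shift_group_closed:
  assumes "f \<in> carrier (shift_group S)"
  shows "inv_into UNIV f \<in> carrier (shift_group S)"
proof -
  note f = shift_groupD[OF assms]
  have "inv_into UNIV f (shift k p) = shift k (inv_into UNIV f p)" for p k
    by (metis f(1,2) bij_inv_eq_iff)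
  moreover have "inv_into UNIV f ` (S \<times> UNIV) = S \<times> UNIV"
    by (metis f(1,3) bij_is_inj image_inv_f_f)
  ultimately show ?thesis
    using f(1) by (intro shift_groupI) (simp_all add: bij_imp_bij_inv)
qed

lemma group_shift_group: "group (shift_group S)"
proof (rule groupI)
  fix f g assume fg: "f \<in> carrier (shift_group S)" "g \<in> carrier (shift_group S)"
  then have "(f \<circ> g) ` (S \<times> UNIV) = S \<times> UNIV"
    unfolding image_comp[symmetric] by (simp add: shift_groupD(3))
  then show "f \<otimes>\<^bsub>shift_group S\<^esub> g \<in> carrier (shift_group S)"
    using fg unfolding shift_group_simps
    by (intro shift_groupI) (simp_all add: shift_groupD(2) bij_comp[OF shift_groupD(1) shift_groupD(1)])
next
  fix f assume f: "f \<in> carrier (shift_group S)"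
  then have "inv_into UNIV f \<circ> f = id" by (simp add: shift_group_def bij_is_inj)
  then show "\<exists>g\<in>carrier (shift_group S). g \<otimes>\<^bsub>shift_group S\<^esub> f = \<one>\<^bsub>shift_group S\<^esub>"
    using inv_shift_group_closed[OF f] by auto
qed (auto simp: shift_group_def)

lemma inv_shift_group:
  assumes "f \<in> carrier (shift_group S)"
  shows "inv\<^bsub>shift_group S\<^esub> f = inv_into UNIV f"
proof -
  interpret group "shift_group S" by (rule group_shift_group)
  have "inv_into UNIV f \<circ> f = id" using assms by (simp add: shift_group_def bij_is_inj)
  then show ?thesis
    using assms by (intro inv_equality) (auto simp: inv_shift_group_closed)
qed

lemma (in group) subgroup_powers: "g \<in> carrier G \<Longrightarrow> subgroup (range (\<lambda>i::int. g [^] i)) G"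
  using generate_is_subgroup[of "{g}"] by (simp add: generate_pow full_SetCompr_eq)

text \<open>On the stabiliser \<open>L\<close> of the point \<open>x\<close> of \<open>S\<close>,
  the displacement \<open>c h x\<close> is a homomorphism to the integers, because the cocycle
  identity then involves a single point. As \<open>g\<close> has displacement \<open>s\<close>, the
  elements whose displacement is divisible by \<open>s\<close> retract to the powers of
  \<open>g\<close> by sending \<open>h\<close> to the power \<open>c h x div s\<close>.\<close>

lemma (in group) detect_infinite:
  assumes \<Phi>: "\<Phi> \<in> hom G (shift_group S)" and S: "finite S" and g: "g \<in> carrier G"
    and p: "p \<in> S \<times> UNIV" and s: "\<Phi> g p = shift s p" "s \<noteq> 0"
  shows "virtual_retract (range (\<lambda>i::int. g [^] i)) G"
proof -
  define \<pi> where "\<pi> = (\<lambda>h y. fst (\<Phi> h (y, 0)))"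
  define c where "c = (\<lambda>h y. snd (\<Phi> h (y, 0)))"
  obtain x n where pxn: "p = (x, n)" by (cases p)
  have x: "x \<in> S" using p pxn by simp
  have car: "\<Phi> h \<in> carrier (shift_group S)" if "h \<in> carrier G" for h
    using \<Phi> that by (auto simp: hom_def)
  have act: "\<Phi> h (y, k) = (\<pi> h y, k + c h y)" if "h \<in> carrier G" for h y k
  proof -
    have "\<Phi> h (shift k (y, 0)) = shift k (\<Phi> h (y, 0))"
      using car[OF that] by (simp add: shift_group_def)
    then show ?thesis by (simp add: shift_def \<pi>_def c_def)
  qed
  have mult: "\<pi> (h \<otimes> h') y = \<pi> h (\<pi> h' y)" "c (h \<otimes> h') y = c h (\<pi> h' y) + c h' y"
    if "h \<in> carrier G" "h' \<in> carrier G" for h h' y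
  proof -
    have "\<Phi> (h \<otimes> h') (y, 0) = \<Phi> h (\<Phi> h' (y, 0))"
      using \<Phi> that by (simp add: hom_def)
    then show "\<pi> (h \<otimes> h') y = \<pi> h (\<pi> h' y)" "c (h \<otimes> h') y = c h (\<pi> h' y) + c h' y"
      using that by (simp_all add: act)
  qed
  have one: "\<pi> \<one> y = y" "c \<one> y = 0" for y
  proof -
    have "\<Phi> \<one> = id" using hom_one[OF \<Phi> is_group group_shift_group] by simp
    then show "\<pi> \<one> y = y" "c \<one> y = 0" by (simp_all add: \<pi>_def c_def)
  qed
  have \<pi>S: "\<pi> h y \<in> S" if "h \<in> carrier G" "y \<in> S" for h y
  proof -
    have "\<Phi> h (y, 0) \<in> \<Phi> h ` (S \<times> UNIV)" using that by simp
    also have "\<dots> = S \<times> UNIV" using car[OF that(1)] by (simp add: shift_group_def)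
    finally show ?thesis using that by (simp add: act)
  qed
  have gx: "\<pi> g x = x" "c g x = s"
    using s(1) g by (simp_all add: pxn act shift_def)
  define L where "L = {h \<in> carrier G. \<pi> h x = x}"
  have c_inv: "\<pi> (inv h) x = x" "c (inv h) x = - c h x" if "h \<in> L" for h
  proof -
    have h: "h \<in> carrier G" "\<pi> h x = x" using that by (auto simp: L_def)
    have "\<pi> (inv h \<otimes> h) x = \<pi> (inv h) x" using h by (simp only: mult inv_closed)
    then show 1: "\<pi> (inv h) x = x" using h one by simp
    have "c (inv h \<otimes> h) x = c (inv h) x + c h x" using h by (simp only: mult inv_closed)
    then show "c (inv h) x = - c h x" using h one by simp
  qed
  have L: "subgroup L G"
    by (rule subgroupI) (use c_inv one in \<open>auto simp: L_def mult\<close>)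
  have c_hom: "(\<lambda>h. c h x) \<in> hom (G\<lparr>carrier := L\<rparr>) integer_group"
    by (rule homI) (auto simp: L_def mult)
  define K where "K = {h \<in> L. s dvd c h x}"
  have K: "subgroup K G"
    using L c_inv by (intro subgroupI) (auto simp: K_def L_def mult one subgroup_def intro!: exI[of _ "\<one>"])
  have gL: "g \<in> L" using g gx by (simp add: L_def)
  have c_pow: "c (g [^] i) x = i * s" and pow_L: "g [^] i \<in> L" for i :: int
  proof -
    interpret H: group_hom "G\<lparr>carrier := L\<rparr>" integer_group "\<lambda>h. c h x"
      using c_hom L by (simp add: group_hom_def group_hom_axioms_def subgroup.subgroup_is_group is_group)
    have eq: "g [^]\<^bsub>G\<lparr>carrier := L\<rparr>\<^esub> i = g [^] i"
      using int_pow_consistent[OF L gL] by simp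
    show "c (g [^] i) x = i * s"
      using H.hom_int_pow[of g i] gL gx by (simp add: eq mult.commute)
    show "g [^] i \<in> L" using gL L by (metis subgroup_int_pow_closed)
  qed
  define \<rho> where "\<rho> = (\<lambda>h. g [^] (c h x div s))"
  let ?H = "range (\<lambda>i::int. g [^] i)"
  have HK: "?H \<subseteq> K" using c_pow pow_L by (auto simp: K_def)
  have "\<rho> \<in> hom (G\<lparr>carrier := K\<rparr>) (G\<lparr>carrier := ?H\<rparr>)"
  proof (rule homI)
    fix h h' assume hh: "h \<in> carrier (G\<lparr>carrier := K\<rparr>)" "h' \<in> carrier (G\<lparr>carrier := K\<rparr>)"
    then have "c (h \<otimes> h') x div s = c h x div s + c h' x div s"
      by (auto simp: K_def L_def mult div_add)
    then show "\<rho> (h \<otimes>\<^bsub>G\<lparr>carrier := K\<rparr>\<^esub> h') = \<rho> h \<otimes>\<^bsub>G\<lparr>carrier := ?H\<rparr>\<^esub> \<rho> h'"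
      using g by (simp add: \<rho>_def int_pow_mult)
  qed (auto simp: \<rho>_def)
  moreover have "\<rho> h = h" if "h \<in> ?H" for h
    using that s(2) by (auto simp: \<rho>_def c_pow)
  moreover have "finite (rcosets K)"
  proof (rule finite_index_by_map[OF K])
    \<comment> \<open>The cocycle modulo \<open>s\<close> is recorded at every point of
      \<open>S\<close>, since for \<open>h\<close> and \<open>h'\<close> with equal data it is
      compared at the point to which \<open>inv h'\<close> takes \<open>x\<close>.\<close>
    let ?\<theta> = "\<lambda>h. restrict (\<lambda>y. (\<pi> h y, c h y mod s)) S"
    let ?F = "S \<rightarrow>\<^sub>E (S \<times> {- \<bar>s\<bar>..\<bar>s\<bar>})"
    show "finite ?F" using S by (intro finite_PiE) auto
    \<comment> \<open>\<open>s\<close> may be negative and then so are the remainders, hence the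
      symmetric interval.\<close>
    have "k mod s \<in> {- \<bar>s\<bar>..\<bar>s\<bar>}" for k
      using s(2) abs_mod_less[of s k] by auto
    then show "?\<theta> \<in> carrier G \<rightarrow> ?F" using \<pi>S by auto
    fix h h' assume h: "h \<in> carrier G" "h' \<in> carrier G" and eq: "?\<theta> h = ?\<theta> h'"
    let ?z = "\<pi> (inv h') x"
    have z: "?z \<in> S" using \<pi>S h x by simp
    have "?\<theta> h ?z = ?\<theta> h' ?z" using eq by simp
    then have hz: "\<pi> h ?z = \<pi> h' ?z" "c h ?z mod s = c h' ?z mod s" using z by auto
    have "\<pi> (h' \<otimes> inv h') x = \<pi> h' ?z" "c (h' \<otimes> inv h') x = c h' ?z + c (inv h') x"
      using h by (simp_all only: mult inv_closed)
    then have h'z: "\<pi> h' ?z = x" "c h' ?z + c (inv h') x = 0" using h one by simp_all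
    have "(c h ?z + c (inv h') x) mod s = (c h' ?z + c (inv h') x) mod s"
      using hz(2) by (metis mod_add_left_eq)
    then have "s dvd c h ?z + c (inv h') x" using h'z(2) by (simp add: mod_eq_0_iff_dvd)
    then show "h \<otimes> inv h' \<in> K" using h hz h'z by (simp add: K_def L_def mult)
  qed
  ultimately show ?thesis
    using K HK subgroup_powers[OF g] unfolding virtual_retract_def by blast
qed

text \<open>\<open>K\<close> consists of the elements that permute \<open>S\<close> like some power
  of \<open>g\<close>. Faithfulness makes this power unique as a group element, and sending
  \<open>h\<close> to it is the retraction. \<open>K\<close> contains the kernel of the permutation
  action on the finite set \<open>S\<close>, hence has finite index.\<close>

lemma (in group) detect_finite:
  assumes \<Phi>: "\<Phi> \<in> hom G (shift_group S)" and S: "finite S" and g: "g \<in> carrier G"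
    and faithful: "\<And>i::int. (\<And>y. y \<in> S \<Longrightarrow> fst (\<Phi> (g [^] i) (y, 0)) = y) \<Longrightarrow> g [^] i = \<one>"
  shows "virtual_retract (range (\<lambda>i::int. g [^] i)) G"
proof -
  define \<pi> where "\<pi> = (\<lambda>h y. fst (\<Phi> h (y, 0)))"
  have car: "\<Phi> h \<in> carrier (shift_group S)" if "h \<in> carrier G" for h
    using \<Phi> that by (auto simp: hom_def)
  have act: "fst (\<Phi> h (y, k)) = \<pi> h y" if "h \<in> carrier G" for h y k
  proof -
    have "\<Phi> h (shift k (y, 0)) = shift k (\<Phi> h (y, 0))"
      using car[OF that] by (simp add: shift_group_def)
    then show ?thesis by (simp add: shift_def \<pi>_def)
  qed
  have mult: "\<pi> (h \<otimes> h') y = \<pi> h (\<pi> h' y)"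
    if "h \<in> carrier G" "h' \<in> carrier G" for h h' y
  proof -
    have "\<Phi> (h \<otimes> h') (y, 0) = \<Phi> h (\<Phi> h' (y, 0))"
      using \<Phi> that by (simp add: hom_def)
    then show ?thesis
      using that act[of h "fst (\<Phi> h' (y, 0))" "snd (\<Phi> h' (y, 0))"] by (simp add: \<pi>_def)
  qed
  have one: "\<pi> \<one> y = y" for y
    using hom_one[OF \<Phi> is_group group_shift_group] by (simp add: \<pi>_def)
  have \<pi>S: "\<pi> h y \<in> S" if "h \<in> carrier G" "y \<in> S" for h y
  proof -
    have "\<Phi> h (y, 0) \<in> \<Phi> h ` (S \<times> UNIV)" using that by simp
    also have "\<dots> = S \<times> UNIV" using car[OF that(1)] by (simp add: shift_group_def)
    finally show ?thesis by (auto simp: \<pi>_def)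
  qed
  have pow: "g [^] (i::int) \<in> carrier G" for i using g by simp
  have canc: "\<pi> (inv h) (\<pi> h y) = y" if "h \<in> carrier G" for h y
    using that mult[of "inv h" h y] one by simp
  have canc': "\<pi> h (\<pi> (inv h) y) = y" if "h \<in> carrier G" for h y
    using that mult[of h "inv h" y] one by simp
  have uniq: "g [^] i = g [^] j" if "\<And>y. y \<in> S \<Longrightarrow> \<pi> (g [^] i) y = \<pi> (g [^] j) y" for i j :: int
  proof -
    have "g [^] (i - j) = \<one>"
    proof (rule faithful)
      fix y assume y: "y \<in> S"
      have "g [^] (i - j) = g [^] i \<otimes> inv (g [^] j)" using g by (simp add: int_pow_diff)
      then have "\<pi> (g [^] (i - j)) y = \<pi> (g [^] i) (\<pi> (inv (g [^] j)) y)" using mult pow by simp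
      also have "\<dots> = \<pi> (g [^] j) (\<pi> (inv (g [^] j)) y)" using \<pi>S pow y by (intro that) simp
      also have "\<dots> = y" using canc' pow by simp
      finally show "fst (\<Phi> (g [^] (i - j)) (y, 0)) = y" by (simp add: \<pi>_def)
    qed
    then show ?thesis using g by (simp add: int_pow_diff) (metis inv_closed inv_equality inv_inv int_pow_closed)
  qed
  define K where "K = {h \<in> carrier G. \<exists>i::int. \<forall>y\<in>S. \<pi> h y = \<pi> (g [^] i) y}"
  define \<rho> where "\<rho> = (\<lambda>h. g [^] (SOME i::int. \<forall>y\<in>S. \<pi> h y = \<pi> (g [^] i) y))"
  let ?H = "range (\<lambda>i::int. g [^] i)"
  have \<rho>: "\<rho> h = g [^] i" if "\<forall>y\<in>S. \<pi> h y = \<pi> (g [^] i) y" for h and i :: int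
  proof -
    let ?j = "SOME i::int. \<forall>y\<in>S. \<pi> h y = \<pi> (g [^] i) y"
    have "\<forall>y\<in>S. \<pi> h y = \<pi> (g [^] ?j) y" using that by (rule someI)
    then show ?thesis unfolding \<rho>_def using that by (intro uniq) simp
  qed
  have K_mult: "\<forall>y\<in>S. \<pi> (h \<otimes> h') y = \<pi> (g [^] (i + j)) y"
    if "h \<in> carrier G" "h' \<in> carrier G" "\<forall>y\<in>S. \<pi> h y = \<pi> (g [^] i) y" "\<forall>y\<in>S. \<pi> h' y = \<pi> (g [^] j) y"
    for h h' and i j :: int
    using that \<pi>S pow g by (simp add: int_pow_mult mult)
  have K: "subgroup K G"
  proof (rule subgroupI)
    show "K \<subseteq> carrier G" by (auto simp: K_def)
    have "\<one> \<in> K" using exI[of _ "0::int"] by (simp add: K_def)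
    then show "K \<noteq> {}" by blast
    fix h assume h: "h \<in> K"
    then obtain i :: int where i: "h \<in> carrier G" "\<forall>y\<in>S. \<pi> h y = \<pi> (g [^] i) y" by (auto simp: K_def)
    have "\<pi> (inv h) y = \<pi> (g [^] (- i)) y" if y: "y \<in> S" for y
    proof -
      have z: "\<pi> (g [^] (- i)) y \<in> S" using \<pi>S pow y by simp
      have "\<pi> h (\<pi> (g [^] (- i)) y) = \<pi> (g [^] i) (\<pi> (inv (g [^] i)) y)"
        using i(2) z g by (simp add: int_pow_neg)
      then show ?thesis using canc' canc i(1) pow by metis
    qed
    then show "inv h \<in> K" using i by (auto simp: K_def)
    fix h' assume "h' \<in> K"
    then obtain j :: int where "h' \<in> carrier G" "\<forall>y\<in>S. \<pi> h' y = \<pi> (g [^] j) y" by (auto simp: K_def)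
    then show "h \<otimes> h' \<in> K" using i K_mult[of h h' i j] by (auto simp: K_def)
  qed
  have HK: "?H \<subseteq> K" using pow by (auto simp: K_def)
  have "\<rho> \<in> hom (G\<lparr>carrier := K\<rparr>) (G\<lparr>carrier := ?H\<rparr>)"
  proof (rule homI)
    fix h h' assume "h \<in> carrier (G\<lparr>carrier := K\<rparr>)" "h' \<in> carrier (G\<lparr>carrier := K\<rparr>)"
    then obtain i j :: int where i: "h \<in> carrier G" "\<forall>y\<in>S. \<pi> h y = \<pi> (g [^] i) y"
      and j: "h' \<in> carrier G" "\<forall>y\<in>S. \<pi> h' y = \<pi> (g [^] j) y" by (auto simp: K_def)
    have "\<rho> (h \<otimes> h') = g [^] (i + j)" by (rule \<rho>[OF K_mult[OF i(1) j(1) i(2) j(2)]])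
    then show "\<rho> (h \<otimes>\<^bsub>G\<lparr>carrier := K\<rparr>\<^esub> h') = \<rho> h \<otimes>\<^bsub>G\<lparr>carrier := ?H\<rparr>\<^esub> \<rho> h'"
      using \<rho>[OF i(2)] \<rho>[OF j(2)] g by (simp add: int_pow_mult)
  qed (auto simp: \<rho>_def)
  moreover have "\<rho> h = h" if "h \<in> ?H" for h
    using that \<rho> by auto
  moreover have "finite (rcosets K)"
  proof (rule finite_index_by_map[OF K])
    let ?\<theta> = "\<lambda>h. restrict (\<pi> h) S"
    show "finite (S \<rightarrow>\<^sub>E S)" using S by (intro finite_PiE) auto
    show "?\<theta> \<in> carrier G \<rightarrow> (S \<rightarrow>\<^sub>E S)" using \<pi>S by auto
    fix h h' assume h: "h \<in> carrier G" "h' \<in> carrier G" and eq: "?\<theta> h = ?\<theta> h'"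
    have "\<pi> (h \<otimes> inv h') y = \<pi> (g [^] (0::int)) y" if "y \<in> S" for y
    proof -
      have z: "\<pi> (inv h') y \<in> S" using \<pi>S h that by simp
      have "?\<theta> h (\<pi> (inv h') y) = ?\<theta> h' (\<pi> (inv h') y)" using eq by simp
      then have "\<pi> h (\<pi> (inv h') y) = \<pi> h' (\<pi> (inv h') y)" using z by simp
      then show ?thesis using h by (simp add: mult canc' one)
    qed
    then show "h \<otimes> inv h' \<in> K" using h unfolding K_def by blast
  qed
  ultimately show ?thesis
    using K HK subgroup_powers[OF g] unfolding virtual_retract_def by blast
qed

lemma (in group) VRC_by_elements:
  assumes "\<And>g. g \<in> carrier G \<Longrightarrow> virtual_retract (range (\<lambda>i::int. g [^] i)) G"
  shows "property_VRC G"
  unfolding property_VRC_def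
proof (intro allI impI, elim conjE)
  fix H assume H: "subgroup H G" "cyclic_group (G\<lparr>carrier := H\<rparr>)"
  interpret H: group "G\<lparr>carrier := H\<rparr>" using H(1) by (rule subgroup.subgroup_is_group) (rule is_group)
  obtain g where g: "g \<in> H" "H = range (\<lambda>n::int. g [^]\<^bsub>G\<lparr>carrier := H\<rparr>\<^esub> n)"
    using H(2) unfolding H.cyclic_group by auto
  then have "H = range (\<lambda>n::int. g [^] n)"
    using int_pow_consistent[OF H(1) g(1)] by simp
  moreover have "g \<in> carrier G" using g(1) H(1) by (metis subgroup.mem_carrier)
  ultimately show "virtual_retract H G" using assms by metis
qed

section \<open>From (VRC) to balancedness\<close>

lemma (in group) conjugate_pow:
  assumes "x \<in> carrier G" "h \<in> carrier G"
  shows "(h \<otimes> x \<otimes> inv h) [^] (i::int) = h \<otimes> x [^] i \<otimes> inv h"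
proof -
  have "(\<lambda>x. h \<otimes> x \<otimes> inv h) \<in> hom G G"
  proof (rule homI)
    fix x y assume xy: "x \<in> carrier G" "y \<in> carrier G"
    have "inv h \<otimes> (h \<otimes> z) = z" if "z \<in> carrier G" for z
      using assms(2) that by (simp add: m_assoc[symmetric])
    then show "h \<otimes> (x \<otimes> y) \<otimes> inv h = h \<otimes> x \<otimes> inv h \<otimes> (h \<otimes> y \<otimes> inv h)"
      using xy assms(2) by (simp add: m_assoc)
  qed (use assms in simp)
  then interpret C: group_hom G G "\<lambda>x. h \<otimes> x \<otimes> inv h"
    by (simp add: group_hom_def group_hom_axioms_def is_group)
  show ?thesis using C.hom_int_pow[OF assms(1)] by simp
qed

lemma (in group) cyclic_powers:
  assumes g: "g \<in> carrier G"
  shows "cyclic_group (G\<lparr>carrier := range (\<lambda>i::int. g [^] i)\<rparr>)"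
proof -
  define H where "H = range (\<lambda>i::int. g [^] i)"
  have H: "subgroup H G" unfolding H_def by (rule subgroup_powers[OF g])
  interpret H: group "G\<lparr>carrier := H\<rparr>" using H by (rule subgroup.subgroup_is_group) (rule is_group)
  have gH: "g \<in> H" using g unfolding H_def by (metis int_pow_1 rangeI)
  have "H = range (\<lambda>i::int. g [^]\<^bsub>G\<lparr>carrier := H\<rparr>\<^esub> i)"
    unfolding int_pow_consistent[OF H gH, symmetric] by (rule H_def)
  then show ?thesis
    unfolding H_def[symmetric] H.cyclic_group using gH by auto
qed

theorem (in group) VRC_imp_balanced:
  assumes "property_VRC G"
  shows "balanced G"
  unfolding balanced_def
proof (intro ballI impI allI)
  fix g and k l :: int
  assume g: "g \<in> carrier G" "ord g = 0" and kl: "k \<noteq> 0" "l \<noteq> 0"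
    and conj: "conjugate_in G (g [^] k) (g [^] l)"
  obtain h where h: "h \<in> carrier G" "h \<otimes> g [^] k \<otimes> inv h = g [^] l"
    using conj by (auto simp: conjugate_in_def)
  let ?H = "range (\<lambda>i::int. g [^] i)"
  have H: "subgroup ?H G" by (rule subgroup_powers[OF g(1)])
  have "virtual_retract ?H G" using cyclic_powers[OF g(1)] assms H by (simp add: property_VRC_def)
  then obtain K \<rho> where K: "subgroup K G" "finite (rcosets K)" "?H \<subseteq> K"
    and \<rho>: "\<rho> \<in> hom (G\<lparr>carrier := K\<rparr>) (G\<lparr>carrier := ?H\<rparr>)" "\<And>x. x \<in> ?H \<Longrightarrow> \<rho> x = x"
    unfolding virtual_retract_def by blast
  \<comment> \<open>In the inductive step, conjugation by \<open>h [^] n\<close> turns the exponent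
    \<open>k ^ n * k\<close> into \<open>l ^ n * k\<close>, and conjugation by \<open>h\<close>
    turns this into \<open>l ^ Suc n\<close>.\<close>
  have iter: "h [^] (n::nat) \<otimes> g [^] (k ^ n) \<otimes> inv (h [^] n) = g [^] (l ^ n)" for n
  proof (induction n)
    case 0
    then show ?case using g by simp
  next
    case (Suc n)
    have "h [^] Suc n \<otimes> g [^] (k ^ Suc n) \<otimes> inv (h [^] Suc n)
        = h \<otimes> (h [^] n \<otimes> g [^] (k ^ n * k) \<otimes> inv (h [^] n)) \<otimes> inv h"
    proof -
      have "h [^] Suc n = h \<otimes> h [^] n" using h(1) by (rule nat_pow_Suc2)
      then show ?thesis
        using g h(1) by (simp only: inv_mult_group m_assoc m_closed nat_pow_closed int_pow_closed inv_closed power_Suc mult.commute)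
    qed
    also have "h [^] n \<otimes> g [^] (k ^ n * k) \<otimes> inv (h [^] n) = (h [^] n \<otimes> g [^] (k ^ n) \<otimes> inv (h [^] n)) [^] k"
      using g h by (simp add: conjugate_pow int_pow_pow)
    also have "\<dots> = (g [^] k) [^] (l ^ n)" using g by (simp add: Suc.IH int_pow_pow mult.commute)
    also have "h \<otimes> (g [^] k) [^] (l ^ n) \<otimes> inv h = (h \<otimes> g [^] k \<otimes> inv h) [^] (l ^ n)"
      by (rule conjugate_pow[symmetric]) (use g h in simp_all)
    also have "\<dots> = g [^] (l ^ Suc n)" using g h by (simp add: int_pow_pow)
    finally show ?case .
  qed
  \<comment> \<open>By finite index two powers of \<open>h\<close> lie in the same coset of
    \<open>K\<close>; their quotient is a positive power in \<open>K\<close>.\<close>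
  have "\<exists>n>0. h [^] (n::nat) \<in> K"
  proof -
    have "\<not> inj_on (\<lambda>n::nat. K #> h [^] n) UNIV"
    proof
      assume "inj_on (\<lambda>n::nat. K #> h [^] n) UNIV"
      moreover have "range (\<lambda>n::nat. K #> h [^] n) \<subseteq> rcosets K" using h by (auto simp: RCOSETS_def)
      ultimately show False using K(2) by (meson finite_imageD finite_subset infinite_UNIV_nat)
    qed
    then obtain a b :: nat where "a < b" "K #> h [^] a = K #> h [^] b"
      unfolding inj_on_def by (metis linorder_neq_iff)
    then have eq: "K #> h [^] b = K #> h [^] a" by simp
    have "h [^] b \<in> K #> h [^] a"
      using K(1) h eq by (metis nat_pow_closed rcos_self)
    then obtain y where y: "y \<in> K" "h [^] b = y \<otimes> h [^] a" by (auto simp: r_coset_def)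
    have "h [^] b = h [^] (b - a) \<otimes> h [^] a" using h \<open>a < b\<close> by (simp add: nat_pow_mult)
    then have "h [^] (b - a) = y" using y K(1) h by (metis nat_pow_closed right_cancel subgroup.mem_carrier)
    then show ?thesis using y \<open>a < b\<close> by (intro exI[of _ "b - a"]) simp
  qed
  then obtain n :: nat where n: "n > 0" "h [^] n \<in> K" by blast
  let ?h = "h [^] n"
  have hc: "?h \<in> carrier G" using h by simp
  have gK: "g [^] i \<in> K" for i :: int using K(3) by blast
  have eq: "?h \<otimes> g [^] (k ^ n) = g [^] (l ^ n) \<otimes> ?h"
    using iter[of n] g hc by (metis inv_solve_right int_pow_closed m_closed)
  \<comment> \<open>The image of \<open>?h\<close> is itself a power of \<open>g\<close>. It
    therefore commutes with the powers of \<open>g\<close> and cancels, and infinite order of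
    \<open>g\<close> lets the exponents be compared.\<close>
  obtain m :: int where m: "\<rho> ?h = g [^] m" using \<rho>(1) n(2) by (force simp: hom_def Pi_iff)
  have "\<rho> (?h \<otimes> g [^] (k ^ n)) = \<rho> (g [^] (l ^ n) \<otimes> ?h)" using eq by simp
  then have "g [^] m \<otimes> g [^] (k ^ n) = g [^] (l ^ n) \<otimes> g [^] m"
    using \<rho> n(2) gK m by (simp add: hom_def)
  then have "g [^] (m + k ^ n) = g [^] (l ^ n + m)" using g by (simp add: int_pow_mult)
  then have "k ^ n = l ^ n" using g by (simp add: int_pow_eq)
  then have "\<bar>k\<bar> = \<bar>l\<bar>" using n(1) by (metis abs_ge_zero power_abs power_eq_iff_eq_base)
  then show "l = k \<or> l = - k" by linarith
qed

section \<open>Elliptic and hyperbolic elements\<close>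

lemma (in group) conjugate_in_trans:
  assumes "conjugate_in G x y" "conjugate_in G y z" "x \<in> carrier G"
  shows "conjugate_in G x z"
proof -
  obtain h k where h: "h \<in> carrier G" "h \<otimes> x \<otimes> inv h = y" and k: "k \<in> carrier G" "k \<otimes> y \<otimes> inv k = z"
    using assms by (auto simp: conjugate_in_def)
  have "(k \<otimes> h) \<otimes> x \<otimes> inv (k \<otimes> h) = z"
    using h(1) k(1) assms(3) by (simp add: h(2)[symmetric] k(2)[symmetric] m_assoc inv_mult_group)
  then show ?thesis unfolding conjugate_in_def using h(1) k(1) m_closed by blast
qed

lemma (in group) conjugate_in_refl: "x \<in> carrier G \<Longrightarrow> conjugate_in G x x"
  unfolding conjugate_in_def by (intro bexI[of _ \<one>]) auto

lemma (in group) conjugate_in_rotate: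
  assumes "x \<in> carrier G" "y \<in> carrier G"
  shows "conjugate_in G (x \<otimes> y) (y \<otimes> x)"
  unfolding conjugate_in_def using assms by (intro bexI[of _ y]) (simp_all add: m_assoc)

context graph_of_groups_presentation
begin

text \<open>A letter \<open>(a, e)\<close> is a vertex element followed by an edge. The vertex
  element after the last edge is kept apart, in \<open>path_rep\<close>, so that closed paths can be
  rotated letter by letter.\<close>

fun gpath :: "'v \<Rightarrow> ('a \<times> 'e) list \<Rightarrow> 'v \<Rightarrow> bool" where
  "gpath u [] v \<longleftrightarrow> u \<in> verts \<Gamma> \<and> u = v"
| "gpath u ((a, e) # w) v \<longleftrightarrow>
     e \<in> edges \<Gamma> \<and> \<alpha>_of \<Gamma> e = u \<and> a \<in> carrier (VG u) \<and> gpath (\<omega>_of \<Gamma> e) w v"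

fun gval :: "('a \<times> 'e) list \<Rightarrow> ('v, 'e, 'a) gog_gen word set" where
  "gval [] = \<one>\<^bsub>G\<^esub>"
| "gval ((a, e) # w) = \<iota> (\<alpha>_of \<Gamma> e) a \<otimes>\<^bsub>G\<^esub> (stable e \<otimes>\<^bsub>G\<^esub> gval w)"

lemma gpath_verts: "gpath u w v \<Longrightarrow> u \<in> verts \<Gamma> \<and> v \<in> verts \<Gamma>"
  by (induction u w v rule: gpath.induct) (use \<alpha>_closed in auto)

lemma gval_closed: "gpath u w v \<Longrightarrow> gval w \<in> carrier G"
  by (induction u w v rule: gpath.induct) (use \<alpha>_closed \<iota>_closed stable_closed in auto)

lemma gpath_append: "gpath u (w @ w') v \<longleftrightarrow> (\<exists>x. gpath u w x \<and> gpath x w' v)"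
proof (induction w arbitrary: u)
  case Nil
  then show ?case using gpath_verts by auto
next
  case (Cons l w)
  then show ?case by (cases l) auto
qed

lemma gval_append: "gpath u w x \<Longrightarrow> gpath x w' v \<Longrightarrow> gval (w @ w') = gval w \<otimes>\<^bsub>G\<^esub> gval w'"
proof (induction u w x rule: gpath.induct)
  case (1 u x)
  then show ?case using gval_closed by auto
next
  case (2 u a e w x)
  then have "\<iota> (\<alpha>_of \<Gamma> e) a \<in> carrier G" "stable e \<in> carrier G" "gval w \<in> carrier G" "gval w' \<in> carrier G"
    using \<alpha>_closed[of e] \<iota>_closed[of u a] stable_closed[of e] gval_closed by auto
  then show ?case using 2 by (simp add: G.m_assoc)
qed

lemma gpath_lmult:
  assumes "gpath u ((a, e) # w) v" "b \<in> carrier (VG u)"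
  shows "gpath u ((b \<otimes>\<^bsub>VG u\<^esub> a, e) # w) v"
    "gval ((b \<otimes>\<^bsub>VG u\<^esub> a, e) # w) = \<iota> u b \<otimes>\<^bsub>G\<^esub> gval ((a, e) # w)"
proof -
  have e: "e \<in> edges \<Gamma>" "\<alpha>_of \<Gamma> e = u" "a \<in> carrier (VG u)" "gpath (\<omega>_of \<Gamma> e) w v" "u \<in> verts \<Gamma>"
    using assms \<alpha>_closed by auto
  interpret group "VG u" using e by (simp add: vertex_group)
  show "gpath u ((b \<otimes>\<^bsub>VG u\<^esub> a, e) # w) v" using e assms(2) by simp
  have "\<iota> u (b \<otimes>\<^bsub>VG u\<^esub> a) = \<iota> u b \<otimes>\<^bsub>G\<^esub> \<iota> u a"
    using \<iota>_hom[OF e(5)] e(3) assms(2) by (simp add: hom_def)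
  then show "gval ((b \<otimes>\<^bsub>VG u\<^esub> a, e) # w) = \<iota> u b \<otimes>\<^bsub>G\<^esub> gval ((a, e) # w)"
    using e assms(2) gval_closed[OF e(4)] \<iota>_closed stable_closed by (simp add: G.m_assoc)
qed

text \<open>The start vertex varies because the induction over \<open>G\<close> prepends letters;
  the end \<open>v\<^sub>0\<close> and the trailing element there stay in place.\<close>

definition path_rep :: "'v \<Rightarrow> 'v \<Rightarrow> ('v, 'e, 'a) gog_gen word set \<Rightarrow> bool" where
  "path_rep v\<^sub>0 u x \<longleftrightarrow>
     (\<exists>w a. gpath u w v\<^sub>0 \<and> a \<in> carrier (VG v\<^sub>0) \<and> x = gval w \<otimes>\<^bsub>G\<^esub> \<iota> v\<^sub>0 a)"

lemma path_rep_vertex: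
  assumes "path_rep v\<^sub>0 u x" "b \<in> carrier (VG u)"
  shows "path_rep v\<^sub>0 u (\<iota> u b \<otimes>\<^bsub>G\<^esub> x)"
proof -
  obtain w a where w: "gpath u w v\<^sub>0" "a \<in> carrier (VG v\<^sub>0)" "x = gval w \<otimes>\<^bsub>G\<^esub> \<iota> v\<^sub>0 a"
    using assms(1) by (auto simp: path_rep_def)
  have V: "u \<in> verts \<Gamma>" "v\<^sub>0 \<in> verts \<Gamma>" using gpath_verts w(1) by auto
  interpret group "VG u" using V by (simp add: vertex_group)
  have cl: "gval w \<in> carrier G" "\<iota> v\<^sub>0 a \<in> carrier G" "\<iota> u b \<in> carrier G"
    using gval_closed[OF w(1)] \<iota>_closed V w(2) assms(2) by auto
  show ?thesis
  proof (cases w)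
    case Nil
    then have uv: "u = v\<^sub>0" using w(1) by simp
    have "\<iota> u b \<otimes>\<^bsub>G\<^esub> x = gval [] \<otimes>\<^bsub>G\<^esub> \<iota> u (b \<otimes>\<^bsub>VG u\<^esub> a)"
      using \<iota>_hom[OF V(1)] w assms(2) cl Nil uv by (simp add: hom_def)
    then show ?thesis
      unfolding path_rep_def using m_closed[OF assms(2), of a] w(1,2) Nil uv
      by (intro exI[of _ "[]"] exI[of _ "b \<otimes>\<^bsub>VG u\<^esub> a"]) simp
  next
    case (Cons l r)
    obtain c e where l: "l = (c, e)" by (cases l)
    have "gpath u ((c, e) # r) v\<^sub>0" using w(1) Cons l by simp
    from gpath_lmult[OF this assms(2)] show ?thesis
      unfolding path_rep_def using w(2,3) cl Cons l by (metis G.m_assoc)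
  qed
qed

lemma path_rep_edge:
  assumes "path_rep v\<^sub>0 (\<omega>_of \<Gamma> e) x" "e \<in> edges \<Gamma>"
  shows "path_rep v\<^sub>0 (\<alpha>_of \<Gamma> e) (stable e \<otimes>\<^bsub>G\<^esub> x)"
proof -
  obtain w a where w: "gpath (\<omega>_of \<Gamma> e) w v\<^sub>0" "a \<in> carrier (VG v\<^sub>0)" "x = gval w \<otimes>\<^bsub>G\<^esub> \<iota> v\<^sub>0 a"
    using assms(1) by (auto simp: path_rep_def)
  have V: "\<alpha>_of \<Gamma> e \<in> verts \<Gamma>" "v\<^sub>0 \<in> verts \<Gamma>" using gpath_verts w(1) \<alpha>_closed assms(2) by auto
  interpret group "VG (\<alpha>_of \<Gamma> e)" using V by (simp add: vertex_group)
  have one: "\<iota> (\<alpha>_of \<Gamma> e) \<one>\<^bsub>VG (\<alpha>_of \<Gamma> e)\<^esub> = \<one>\<^bsub>G\<^esub>"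
    using hom_one[OF \<iota>_hom[OF V(1)] is_group G.is_group] .
  have cl: "gval w \<in> carrier G" "\<iota> v\<^sub>0 a \<in> carrier G" "stable e \<in> carrier G"
    using gval_closed[OF w(1)] \<iota>_closed V w(2) stable_closed assms(2) by auto
  show ?thesis
    unfolding path_rep_def
    using w assms(2) cl one
    by (intro exI[of _ "(\<one>\<^bsub>VG (\<alpha>_of \<Gamma> e)\<^esub>, e) # w"] exI[of _ a]) (simp add: G.m_assoc)
qed

lemma path_rep_closed: "path_rep v\<^sub>0 u x \<Longrightarrow> x \<in> carrier G"
  using gval_closed \<iota>_closed gpath_verts by (auto simp: path_rep_def)

text \<open>The start can be moved along \<open>T\<^sub>0\<close>: its stable letters are trivial in
  \<open>G\<close>, so prefixing a tree path does not change the element.\<close>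

lemma path_rep_base:
  assumes "path_rep v\<^sub>0 u x" "u' \<in> verts \<Gamma>"
  shows "path_rep v\<^sub>0 u' x"
proof -
  have T: "subgraph_of T\<^sub>0 \<Gamma>" "is_tree T\<^sub>0" using maxtree by (auto simp: maximal_tree_def)
  have VT: "verts T\<^sub>0 = verts \<Gamma>" by (rule maximal_tree_spanning[OF serre connected maxtree])
  have "u \<in> verts \<Gamma>" using assms(1) gpath_verts by (auto simp: path_rep_def)
  then obtain p where "edge_path T\<^sub>0 u' p u"
    using T(2) assms(2) VT unfolding is_tree_def graph_connected_def by blast
  then show ?thesis
  proof (induction p arbitrary: u')
    case Nil
    then show ?case using assms(1) by simp
  next
    case (Cons e p)
    then have e: "e \<in> edges T\<^sub>0" "\<alpha>_of T\<^sub>0 e = u'" "path_rep v\<^sub>0 (\<omega>_of T\<^sub>0 e) x" by auto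
    then have e': "e \<in> edges \<Gamma>" "\<alpha>_of \<Gamma> e = u'" "path_rep v\<^sub>0 (\<omega>_of \<Gamma> e) x"
      using T(1) by (auto simp: subgraph_of_def)
    have "path_rep v\<^sub>0 (\<alpha>_of \<Gamma> e) (stable e \<otimes>\<^bsub>G\<^esub> x)" by (rule path_rep_edge[OF e'(3,1)])
    then show ?case using stable_tree[OF e(1)] path_rep_closed[OF e'(3)] e'(2) by simp
  qed
qed

lemma exists_path_rep:
  assumes "x \<in> carrier G" "v\<^sub>0 \<in> verts \<Gamma>"
  shows "path_rep v\<^sub>0 v\<^sub>0 x"
  using assms(1)
proof (induction rule: G_induct)
  case one
  interpret group "VG v\<^sub>0" using assms(2) by (rule vertex_group)
  have "\<iota> v\<^sub>0 \<one>\<^bsub>VG v\<^sub>0\<^esub> = \<one>\<^bsub>G\<^esub>"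
    using hom_one[OF \<iota>_hom[OF assms(2)] is_group G.is_group] .
  then show ?case
    unfolding path_rep_def using assms(2) by (intro exI[of _ "[]"] exI[of _ "\<one>\<^bsub>VG v\<^sub>0\<^esub>"]) simp
next
  case (vertex v a y)
  then show ?case using path_rep_base path_rep_vertex assms(2) by blast
next
  case (edge e y)
  then show ?case using path_rep_base path_rep_edge assms(2) \<omega>_closed by blast
qed

text \<open>The vertex element between the edges of letters \<open>i\<close> and
  \<open>i + 1\<close> is stored in letter \<open>i + 1\<close>. A violation is a backtracking turn
  whose vertex element comes from the edge group, that is, a turn which the edge relation can
  remove.\<close>

definition cyc_reduced :: "('a \<times> 'e) list \<Rightarrow> bool" where
  "cyc_reduced w \<longleftrightarrow> (\<forall>i<length w.
     snd (w ! (Suc i mod length w)) = einv \<Gamma> (snd (w ! i)) \<longrightarrow>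
     fst (w ! (Suc i mod length w)) \<notin> \<phi> (einv \<Gamma> (snd (w ! i))) ` carrier (EG (snd (w ! i))))"

lemma closed_gpath_rotate:
  assumes "gpath u w u"
  shows "\<exists>v. gpath v (rotate i w) v \<and> conjugate_in G (gval w) (gval (rotate i w))"
proof -
  let ?j = "i mod length w"
  have eq: "rotate i w = drop ?j w @ take ?j w" by (rule rotate_drop_take)
  obtain v where v: "gpath u (take ?j w) v" "gpath v (drop ?j w) u"
    using assms by (metis append_take_drop_id gpath_append)
  have "gval w = gval (take ?j w) \<otimes>\<^bsub>G\<^esub> gval (drop ?j w)"
    using gval_append[OF v] by simp
  moreover have "gval (rotate i w) = gval (drop ?j w) \<otimes>\<^bsub>G\<^esub> gval (take ?j w)"
    using gval_append[OF v(2,1)] eq by simp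
  moreover have "gpath v (rotate i w) v" using v eq gpath_append by auto
  ultimately show ?thesis
    using G.conjugate_in_rotate[OF gval_closed[OF v(1)] gval_closed[OF v(2)]] by auto
qed

definition elliptic :: "('v, 'e, 'a) gog_gen word set \<Rightarrow> bool" where
  "elliptic x \<longleftrightarrow> (\<exists>v\<in>verts \<Gamma>. \<exists>a\<in>carrier (VG v). conjugate_in G x (\<iota> v a))"

definition hyperbolic :: "('v, 'e, 'a) gog_gen word set \<Rightarrow> bool" where
  "hyperbolic x \<longleftrightarrow>
     (\<exists>v w. w \<noteq> [] \<and> gpath v w v \<and> cyc_reduced w \<and> conjugate_in G x (gval w))"

text \<open>Induction on the length. A rotation brings a violating turn to the front, where the edge
  relation replaces its two edges by one vertex element. This is merged into the next letter,
  shortening the path by two; if no letter is left, the element is elliptic.\<close>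

lemma closed_gpath_cases:
  assumes "gpath u w u" "w \<noteq> []"
  shows "elliptic (gval w) \<or> hyperbolic (gval w)"
  using assms
proof (induction "length w" arbitrary: u w rule: less_induct)
  case less
  have gw: "gval w \<in> carrier G" by (rule gval_closed[OF less.prems(1)])
  show ?case
  proof (cases "cyc_reduced w")
    case True
    then show ?thesis using less.prems G.conjugate_in_refl[OF gw] unfolding hyperbolic_def by blast
  next
    case False
    let ?n = "length w"
    obtain i where i: "i < ?n" "snd (w ! (Suc i mod ?n)) = einv \<Gamma> (snd (w ! i))"
      "fst (w ! (Suc i mod ?n)) \<in> \<phi> (einv \<Gamma> (snd (w ! i))) ` carrier (EG (snd (w ! i)))"
      using False by (auto simp: cyc_reduced_def)
    obtain v where v: "gpath v (rotate i w) v" "conjugate_in G (gval w) (gval (rotate i w))"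
      using closed_gpath_rotate[OF less.prems(1)] by blast
    have nth: "rotate i w ! 0 = w ! i" using i(1) less.prems(2) nth_rotate[of 0 w i] by simp
    obtain a e r\<^sub>1 where r1: "rotate i w = (a, e) # r\<^sub>1"
      using less.prems(2) by (metis neq_Nil_conv rotate_is_Nil_conv surj_pair)
    have wi: "w ! i = (a, e)" using nth r1 by simp
    have e: "e \<in> edges \<Gamma>" "\<alpha>_of \<Gamma> e = v" "a \<in> carrier (VG v)" "gpath (\<omega>_of \<Gamma> e) r\<^sub>1 v"
      using v(1) r1 by auto
    \<comment> \<open>In a path of length one the letter is its own cyclic successor, so a violation
      would make \<open>e\<close> its own inverse.\<close>
    have "r\<^sub>1 \<noteq> []"
    proof
      assume "r\<^sub>1 = []"
      then have "?n = 1" using r1 by (metis length_Cons length_rotate list.size(3) One_nat_def)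
      then have "einv \<Gamma> e = e" using i wi by simp
      then show False using einv_neq e(1) by blast
    qed
    then obtain b f r where r: "r\<^sub>1 = (b, f) # r" by (metis neq_Nil_conv surj_pair)
    have "?n > 1" using r1 r by (metis length_Cons length_rotate less_Suc_eq_0_disj Suc_less_eq One_nat_def)
    then have "w ! (Suc i mod ?n) = rotate i w ! 1" using nth_rotate[of 1 w i] by simp
    then have wi1: "w ! (Suc i mod ?n) = (b, f)" using r1 r by simp
    obtain z where z: "z \<in> carrier (EG e)" "b = \<phi> (einv \<Gamma> e) z" and f: "f = einv \<Gamma> e"
      using i(2,3) wi wi1 by auto
    have V: "v \<in> verts \<Gamma>" using gpath_verts v(1) by blast
    interpret Gv: group "VG v" using V by (rule vertex_group)
    have gr: "gpath v r v" using e r f \<omega>_einv by auto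
    let ?c = "a \<otimes>\<^bsub>VG v\<^esub> \<phi> e z"
    have \<phi>z: "\<phi> e z \<in> carrier (VG v)" using \<phi>_closed[OF e(1) z(1)] e(2) by simp
    have c: "?c \<in> carrier (VG v)" using \<phi>z e(3) by simp
    have cl: "\<iota> v a \<in> carrier G" "stable e \<in> carrier G" "\<iota> (\<omega>_of \<Gamma> e) b \<in> carrier G" "gval r \<in> carrier G"
      "\<iota> v (\<phi> e z) \<in> carrier G"
      using \<iota>_closed V e stable_closed gval_closed[OF gr] \<omega>_closed \<phi>_einv_closed z \<phi>z by auto
    have "\<alpha>_of \<Gamma> f = \<omega>_of \<Gamma> e" using f \<alpha>_einv[OF serre e(1)] by simp
    then have "gval (rotate i w) = \<iota> v a \<otimes>\<^bsub>G\<^esub> (stable e \<otimes>\<^bsub>G\<^esub> \<iota> (\<omega>_of \<Gamma> e) b \<otimes>\<^bsub>G\<^esub> inv\<^bsub>G\<^esub> stable e) \<otimes>\<^bsub>G\<^esub> gval r"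
      using r1 r e f cl by (simp add: stable_einv G.m_assoc)
    also have "stable e \<otimes>\<^bsub>G\<^esub> \<iota> (\<omega>_of \<Gamma> e) b \<otimes>\<^bsub>G\<^esub> inv\<^bsub>G\<^esub> stable e = \<iota> v (\<phi> e z)"
      using stable_rel[OF e(1) z(1)] cl z(2) e(2) by (simp add: G.m_assoc)
    finally have val: "gval (rotate i w) = \<iota> v ?c \<otimes>\<^bsub>G\<^esub> gval r"
      using \<iota>_hom[OF V] e(3) \<phi>z by (simp add: hom_def)
    show ?thesis
    proof (cases r)
      case Nil
      then have "gval (rotate i w) = \<iota> v ?c" using val \<iota>_closed[OF V c] by simp
      then show ?thesis using v(2) V c unfolding elliptic_def by auto
    next
      case (Cons l s)
      obtain d g where l: "l = (d, g)" by (cases l)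
      let ?w = "(?c \<otimes>\<^bsub>VG v\<^esub> d, g) # s"
      have w': "gpath v ?w v" "gval ?w = gval (rotate i w)"
        using gpath_lmult[of v d g s v ?c] gr Cons l c val by auto
      have "length (rotate i w) = length s + 3" unfolding r1 r Cons by simp
      then have "length ?w < length w" by simp
      then have "elliptic (gval ?w) \<or> hyperbolic (gval ?w)" using less.hyps w'(1) by blast
      then show ?thesis
        using G.conjugate_in_trans[OF v(2) _ gw] w'(2) unfolding elliptic_def hyperbolic_def by metis
    qed
  qed
qed

theorem elliptic_or_hyperbolic:
  assumes "x \<in> carrier G"
  shows "elliptic x \<or> hyperbolic x"
proof -
  obtain v where v: "v \<in> verts \<Gamma>" using nonempty by blast
  obtain w a where w: "gpath v w v" "a \<in> carrier (VG v)" "x = gval w \<otimes>\<^bsub>G\<^esub> \<iota> v a"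
    using exists_path_rep[OF assms v] by (auto simp: path_rep_def)
  have cl: "gval w \<in> carrier G" "\<iota> v a \<in> carrier G" using gval_closed w \<iota>_closed v by auto
  have conj: "conjugate_in G x (\<iota> v a \<otimes>\<^bsub>G\<^esub> gval w)"
    unfolding w(3) by (rule G.conjugate_in_rotate[OF cl])
  show ?thesis
  proof (cases w)
    case Nil
    then show ?thesis using conj cl v w unfolding elliptic_def by auto
  next
    case (Cons l s)
    obtain d g where l: "l = (d, g)" by (cases l)
    let ?w = "(a \<otimes>\<^bsub>VG v\<^esub> d, g) # s"
    have w': "gpath v ?w v" "gval ?w = \<iota> v a \<otimes>\<^bsub>G\<^esub> gval w"
      using gpath_lmult[of v d g s v a] w Cons l by auto
    then have "elliptic (gval ?w) \<or> hyperbolic (gval ?w)" using closed_gpath_cases by blast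
    then show ?thesis
      using G.conjugate_in_trans[OF conj _ assms] w'(2) unfolding elliptic_def hyperbolic_def by metis
  qed
qed

end

section \<open>Extending partial equivariant bijections\<close>

text \<open>Being the identity off \<open>S\<close> makes it a bijection of the whole type as soon
  as \<open>\<sigma>\<close> permutes \<open>S\<close>, as \<open>shift_group\<close>
  requires.\<close>

definition lift_shift :: "'x set \<Rightarrow> ('x \<Rightarrow> 'x) \<Rightarrow> ('x \<Rightarrow> int) \<Rightarrow> 'x \<times> int \<Rightarrow> 'x \<times> int" where
  "lift_shift S \<sigma> c = (\<lambda>(x, k). if x \<in> S then (\<sigma> x, k + c x) else (x, k))"

lemma lift_shift_apply [simp]: "x \<in> S \<Longrightarrow> lift_shift S \<sigma> c (x, k) = (\<sigma> x, k + c x)"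
  by (simp add: lift_shift_def)

lemma lift_shift_comp:
  assumes "\<And>x. x \<in> S \<Longrightarrow> \<tau> x \<in> S"
  shows "lift_shift S \<sigma> c \<circ> lift_shift S \<tau> d = lift_shift S (\<lambda>x. \<sigma> (\<tau> x)) (\<lambda>x. d x + c (\<tau> x))"
  using assms by (auto simp: lift_shift_def fun_eq_iff)

lemma lift_shift_cong:
  assumes "\<And>x. x \<in> S \<Longrightarrow> \<sigma> x = \<tau> x" "\<And>x. x \<in> S \<Longrightarrow> c x = d x"
  shows "lift_shift S \<sigma> c = lift_shift S \<tau> d"
  using assms by (auto simp: lift_shift_def fun_eq_iff)

lemma lift_shift_id:
  assumes "\<And>x. x \<in> S \<Longrightarrow> \<sigma> x = x" "\<And>x. x \<in> S \<Longrightarrow> c x = 0"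
  shows "lift_shift S \<sigma> c = id"
  using assms by (auto simp: lift_shift_def fun_eq_iff)

lemma lift_shift_closed:
  assumes "bij_betw \<sigma> S S"
  shows "lift_shift S \<sigma> c \<in> carrier (shift_group S)"
proof -
  define \<tau> where "\<tau> = inv_into S \<sigma>"
  have \<sigma>: "\<sigma> x \<in> S" "\<tau> (\<sigma> x) = x" "\<tau> x \<in> S" "\<sigma> (\<tau> x) = x" if "x \<in> S" for x
    using assms that bij_betw_inv_into_left[OF assms] bij_betw_inv_into_right[OF assms]
      bij_betw_inv_into[OF assms] by (auto simp: \<tau>_def bij_betw_apply)
  let ?f = "lift_shift S \<sigma> c" and ?g = "lift_shift S \<tau> (\<lambda>x. - c (\<tau> x))"
  have fg: "?f \<circ> ?g = id" "?g \<circ> ?f = id"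
    using \<sigma> by (auto simp: lift_shift_comp intro!: lift_shift_id)
  have maps: "?f ` (S \<times> UNIV) \<subseteq> S \<times> UNIV" "?g ` (S \<times> UNIV) \<subseteq> S \<times> UNIV"
    using \<sigma> by (auto simp: lift_shift_def)
  show ?thesis
  proof (rule shift_groupI)
    show "bij ?f" using fg by (metis o_bij)
    show "?f (shift k p) = shift k (?f p)" for k p
      by (cases p) (simp add: lift_shift_def shift_def)
    have "S \<times> UNIV = ?f ` (?g ` (S \<times> UNIV))" using fg(1) by (simp add: image_comp)
    also have "\<dots> \<subseteq> ?f ` (S \<times> UNIV)" by (rule image_mono[OF maps(2)])
    finally show "?f ` (S \<times> UNIV) = S \<times> UNIV" by (rule subset_antisym[OF maps(1)])
  qed
qed

text \<open>The last axiom forces all points, under both actions, to have the same stabiliser. So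
  both are free actions of one quotient of \<open>H\<close>, and two such actions on a finite set
  have equally many orbits.\<close>

locale free_action_pair = group H for H (structure) +
  fixes S :: "'x set" and \<rho> \<rho>' :: "'a \<Rightarrow> 'x \<Rightarrow> 'x"
  assumes fin: "finite S"
    and closed: "z \<in> carrier H \<Longrightarrow> x \<in> S \<Longrightarrow> \<rho> z x \<in> S"
    and closed': "z \<in> carrier H \<Longrightarrow> x \<in> S \<Longrightarrow> \<rho>' z x \<in> S"
    and mult: "z \<in> carrier H \<Longrightarrow> z' \<in> carrier H \<Longrightarrow> x \<in> S \<Longrightarrow> \<rho> (z \<otimes> z') x = \<rho> z (\<rho> z' x)"
    and mult': "z \<in> carrier H \<Longrightarrow> z' \<in> carrier H \<Longrightarrow> x \<in> S \<Longrightarrow> \<rho>' (z \<otimes> z') x = \<rho>' z (\<rho>' z' x)"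
    and one: "x \<in> S \<Longrightarrow> \<rho> \<one> x = x"
    and one': "x \<in> S \<Longrightarrow> \<rho>' \<one> x = x"
    and same_stabilizer: "z \<in> carrier H \<Longrightarrow> x \<in> S \<Longrightarrow> y \<in> S \<Longrightarrow> \<rho> z x = x \<longleftrightarrow> \<rho>' z y = y"
begin

lemma inv_act: "z \<in> carrier H \<Longrightarrow> x \<in> S \<Longrightarrow> \<rho> (inv z) (\<rho> z x) = x"
  using mult[of "inv z" z x] one by simp

lemma inv_act': "z \<in> carrier H \<Longrightarrow> x \<in> S \<Longrightarrow> \<rho>' (inv z) (\<rho>' z x) = x"
  using mult'[of "inv z" z x] one' by simp

lemma act_eq_iff:
  assumes "z \<in> carrier H" "z' \<in> carrier H" "x \<in> S" "y \<in> S"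
  shows "\<rho> z x = \<rho> z' x \<longleftrightarrow> \<rho>' z y = \<rho>' z' y"
proof -
  have "\<rho> z x = \<rho> z' x \<longleftrightarrow> \<rho> (inv z' \<otimes> z) x = x"
    using assms inv_act[of z' x] inv_act[of "inv z'" "\<rho> z x"] by (auto simp: mult closed)
  moreover have "\<rho>' z y = \<rho>' z' y \<longleftrightarrow> \<rho>' (inv z' \<otimes> z) y = y"
    using assms inv_act'[of z' y] inv_act'[of "inv z'" "\<rho>' z y"] by (auto simp: mult' closed')
  ultimately show ?thesis using assms same_stabilizer[of "inv z' \<otimes> z" x y] by simp
qed

definition partial_iso :: "('x \<times> 'x) set \<Rightarrow> bool" where
  "partial_iso R \<longleftrightarrow> R \<subseteq> S \<times> S \<and> (\<forall>z\<in>carrier H. \<forall>(x, y)\<in>R. (\<rho> z x, \<rho>' z y) \<in> R) \<and>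
     (\<forall>(x, y)\<in>R. \<forall>(x', y')\<in>R. x = x' \<longleftrightarrow> y = y')"

lemma partial_isoD:
  assumes "partial_iso R"
  shows "R \<subseteq> S \<times> S" "z \<in> carrier H \<Longrightarrow> (x, y) \<in> R \<Longrightarrow> (\<rho> z x, \<rho>' z y) \<in> R"
    "(x, y) \<in> R \<Longrightarrow> (x', y') \<in> R \<Longrightarrow> x = x' \<longleftrightarrow> y = y'"
  using assms unfolding partial_iso_def by auto

text \<open>Matching the orbit of \<open>x\<close> with that of \<open>y\<close> is well defined and
  injective because stabilisers agree. Invariance of \<open>R\<close> keeps the new orbits away from
  its domain and range.\<close>

lemma partial_iso_extend:
  assumes R: "partial_iso R" and x: "x \<in> S" "x \<notin> Domain R" and y: "y \<in> S" "y \<notin> Range R"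
  shows "partial_iso (R \<union> (\<lambda>z. (\<rho> z x, \<rho>' z y)) ` carrier H)"
proof -
  let ?O = "(\<lambda>z. (\<rho> z x, \<rho>' z y)) ` carrier H"
  note RD = partial_isoD[OF R]
  have new: "\<rho> z x \<noteq> x'" "\<rho>' z y \<noteq> y'" if "(x', y') \<in> R" "z \<in> carrier H" for x' y' z
  proof -
    have "(\<rho> (inv z) x', \<rho>' (inv z) y') \<in> R" using that RD by simp
    then show "\<rho> z x \<noteq> x'" "\<rho>' z y \<noteq> y'"
      using inv_act[OF that(2) x(1)] inv_act'[OF that(2) y(1)] x(2) y(2) by (metis Domain.DomainI, metis Range.RangeI)
  qed
  show ?thesis
    unfolding partial_iso_def
  proof (intro conjI)
    show "R \<union> ?O \<subseteq> S \<times> S" using RD(1) x y closed closed' by auto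
    have "(\<rho> z (\<rho> z' x), \<rho>' z (\<rho>' z' y)) \<in> ?O" if "z \<in> carrier H" "z' \<in> carrier H" for z z'
      using that x y by (simp add: mult[symmetric] mult'[symmetric])
    then show "\<forall>z\<in>carrier H. \<forall>(x, y)\<in>R \<union> ?O. (\<rho> z x, \<rho>' z y) \<in> R \<union> ?O"
      using RD(2) by auto
    show "\<forall>(x, y)\<in>R \<union> ?O. \<forall>(x', y')\<in>R \<union> ?O. x = x' \<longleftrightarrow> y = y'"
    proof (clarify)
      fix a b a' b' assume ab: "(a, b) \<in> R \<union> ?O" "(a', b') \<in> R \<union> ?O"
      show "a = a' \<longleftrightarrow> b = b'"
        using ab act_eq_iff[OF _ _ x(1) y(1)] RD(3) new
        by (elim UnE imageE) (auto, metis+)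
    qed
  qed
qed

text \<open>A maximal partial isomorphism has a domain and a range of the same size. If one of them
  is not all of \<open>S\<close>, neither is the other, and one more pair of orbits could be
  matched.\<close>

lemma partial_iso_total:
  assumes R: "partial_iso R"
  shows "\<exists>\<sigma>. bij_betw \<sigma> S S \<and> (\<forall>(x, y)\<in>R. \<sigma> x = y) \<and> (\<forall>z\<in>carrier H. \<forall>x\<in>S. \<sigma> (\<rho> z x) = \<rho>' z (\<sigma> x))"
proof -
  let ?P = "{R. partial_iso R}"
  have "finite ?P"
  proof (rule finite_subset)
    show "?P \<subseteq> Pow (S \<times> S)" using partial_isoD(1) by blast
  qed (simp add: fin)
  then have "\<exists>M\<in>?P. R \<subseteq> M \<and> (\<forall>b\<in>?P. M \<subseteq> b \<longrightarrow> M = b)"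
    by (rule finite_has_maximal2) (use R in simp)
  then obtain M where M: "partial_iso M" "R \<subseteq> M" "\<And>R'. partial_iso R' \<Longrightarrow> M \<subseteq> R' \<Longrightarrow> M = R'"
    by (metis mem_Collect_eq)
  note MD = partial_isoD[OF M(1)]
  have finM: "finite M" using MD(1) fin finite_subset by blast
  have "inj_on fst M" "inj_on snd M" using MD(3) by (auto simp: inj_on_def)
  then have card: "card (Domain M) = card (Range M)" by (simp add: Domain_fst Range_snd card_image)
  have sub: "Domain M \<subseteq> S" "Range M \<subseteq> S" using MD(1) by auto
  have full: "Domain M = S \<and> Range M = S"
  proof (rule ccontr)
    assume "\<not> ?thesis"
    then have "Domain M \<noteq> S" "Range M \<noteq> S"
      using card sub fin card_subset_eq by metis+
    then obtain x y where xy: "x \<in> S" "x \<notin> Domain M" "y \<in> S" "y \<notin> Range M" using sub by blast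
    have "M = M \<union> (\<lambda>z. (\<rho> z x, \<rho>' z y)) ` carrier H"
      using partial_iso_extend[OF M(1) xy] by (intro M(3)) auto
    then have "(\<rho> \<one> x, \<rho>' \<one> y) \<in> M" by blast
    then show False using xy one by auto
  qed
  define \<sigma> where "\<sigma> = (\<lambda>x. THE y. (x, y) \<in> M)"
  have \<sigma>_eq: "\<sigma> x = y" if "(x, y) \<in> M" for x y
    unfolding \<sigma>_def using that MD(3) by (intro the_equality) blast+
  have \<sigma>: "(x, \<sigma> x) \<in> M" if "x \<in> S" for x
    using that full \<sigma>_eq by (metis DomainE)
  have "bij_betw \<sigma> S S"
  proof (rule bij_betwI')
    show "\<And>x y. x \<in> S \<Longrightarrow> y \<in> S \<Longrightarrow> (\<sigma> x = \<sigma> y) = (x = y)" using \<sigma> MD(3) by blast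
    show "\<And>x. x \<in> S \<Longrightarrow> \<sigma> x \<in> S" using \<sigma> full by blast
    show "\<And>y. y \<in> S \<Longrightarrow> \<exists>x\<in>S. y = \<sigma> x" using full \<sigma>_eq by (metis DomainI RangeE)
  qed
  moreover have "\<sigma> (\<rho> z x) = \<rho>' z (\<sigma> x)" if "z \<in> carrier H" "x \<in> S" for z x
    using \<sigma>[OF that(2)] that(1) MD(2) \<sigma>_eq by blast
  ultimately show ?thesis using \<sigma>_eq M(2) by blast
qed

text \<open>The prescribed points lie in distinct orbits on either side, so matching
  \<open>x j\<close> with \<open>y j\<close> and propagating along the orbits gives a partial
  isomorphism to be completed. With \<open>J\<close> empty this merely provides an equivariant
  bijection.\<close>

lemma equivariant_bijection:
  fixes J :: "'j set" and k :: "'j \<Rightarrow> int"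
  assumes pts: "\<And>j. j \<in> J \<Longrightarrow> x j \<in> S" "\<And>j. j \<in> J \<Longrightarrow> y j \<in> S"
    and disj: "\<And>i j z. i \<in> J \<Longrightarrow> j \<in> J \<Longrightarrow> z \<in> carrier H \<Longrightarrow> x i = \<rho> z (x j) \<Longrightarrow> i = j"
      "\<And>i j z. i \<in> J \<Longrightarrow> j \<in> J \<Longrightarrow> z \<in> carrier H \<Longrightarrow> y i = \<rho>' z (y j) \<Longrightarrow> i = j"
  shows "\<exists>\<sigma> c. bij_betw \<sigma> S S \<and> (\<forall>z\<in>carrier H. \<forall>x\<in>S. \<sigma> (\<rho> z x) = \<rho>' z (\<sigma> x)) \<and>
    (\<forall>z\<in>carrier H. \<forall>x\<in>S. c (\<rho> z x) = c x) \<and> (\<forall>j\<in>J. \<sigma> (x j) = y j \<and> c (x j) = k j)"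
proof -
  let ?R = "{(\<rho> z (x j), \<rho>' z (y j)) |z j. z \<in> carrier H \<and> j \<in> J}"
  have orbit: "i = j" if "i \<in> J" "j \<in> J" "z \<in> carrier H" "z' \<in> carrier H" "\<rho> z (x i) = \<rho> z' (x j)" for i j z z'
  proof (rule disj(1))
    show "x i = \<rho> (inv z \<otimes> z') (x j)"
      using that pts by (simp add: mult) (metis inv_act)
  qed (use that in auto)
  have orbit': "i = j" if "i \<in> J" "j \<in> J" "z \<in> carrier H" "z' \<in> carrier H" "\<rho>' z (y i) = \<rho>' z' (y j)" for i j z z'
  proof (rule disj(2))
    show "y i = \<rho>' (inv z \<otimes> z') (y j)"
      using that pts by (simp add: mult') (metis inv_act')
  qed (use that in auto)
  have "partial_iso ?R"
    unfolding partial_iso_def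
  proof (intro conjI)
    show "?R \<subseteq> S \<times> S" using pts closed closed' by auto
    show "\<forall>z\<in>carrier H. \<forall>(a, b)\<in>?R. (\<rho> z a, \<rho>' z b) \<in> ?R"
    proof clarify
      fix z z' j assume "z \<in> carrier H" "z' \<in> carrier H" "j \<in> J"
      then show "\<exists>za ja. (\<rho> z (\<rho> z' (x j)), \<rho>' z (\<rho>' z' (y j))) = (\<rho> za (x ja), \<rho>' za (y ja)) \<and> za \<in> carrier H \<and> ja \<in> J"
        using pts by (intro exI[of _ "z \<otimes> z'"] exI[of _ j]) (simp add: mult mult')
    qed
    show "\<forall>(a, b)\<in>?R. \<forall>(a', b')\<in>?R. a = a' \<longleftrightarrow> b = b'"
    proof clarify
      fix z z' i j assume *: "z \<in> carrier H" "z' \<in> carrier H" "i \<in> J" "j \<in> J"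
      show "\<rho> z (x i) = \<rho> z' (x j) \<longleftrightarrow> \<rho>' z (y i) = \<rho>' z' (y j)"
        using orbit[OF *(3,4,1,2)] orbit'[OF *(3,4,1,2)] act_eq_iff[OF *(1,2)] pts *(3,4) by metis
    qed
  qed
  from partial_iso_total[OF this] obtain \<sigma> where \<sigma>: "bij_betw \<sigma> S S" "\<forall>(a, b)\<in>?R. \<sigma> a = b"
    "\<forall>z\<in>carrier H. \<forall>x\<in>S. \<sigma> (\<rho> z x) = \<rho>' z (\<sigma> x)" by blast
  define in_orbit where "in_orbit = (\<lambda>a j. j \<in> J \<and> (\<exists>z\<in>carrier H. a = \<rho> z (x j)))"
  \<comment> \<open>Constant on orbits by construction, with 0 on the orbits that contain no
    prescribed point.\<close>
  define c where "c = (\<lambda>a. if \<exists>j. in_orbit a j then k (SOME j. in_orbit a j) else 0)"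
  have inv_orbit: "in_orbit (\<rho> z a) = in_orbit a" if z: "z \<in> carrier H" "a \<in> S" for z a
  proof
    fix j
    show "in_orbit (\<rho> z a) j = in_orbit a j"
    proof
      assume "in_orbit a j"
      then obtain z' where "j \<in> J" "z' \<in> carrier H" "a = \<rho> z' (x j)" by (auto simp: in_orbit_def)
      then show "in_orbit (\<rho> z a) j"
        unfolding in_orbit_def using z pts by (auto simp: mult intro!: bexI[of _ "z \<otimes> z'"])
    next
      assume "in_orbit (\<rho> z a) j"
      then obtain z' where z': "j \<in> J" "z' \<in> carrier H" "\<rho> z a = \<rho> z' (x j)" by (auto simp: in_orbit_def)
      then have "a = \<rho> (inv z \<otimes> z') (x j)" using z pts by (simp add: mult) (metis inv_act)
      then show "in_orbit a j" unfolding in_orbit_def using z z' by blast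
    qed
  qed
  have "c (x j) = k j" if j: "j \<in> J" for j
  proof -
    have in_j: "in_orbit (x j) j"
      unfolding in_orbit_def using j pts one by (auto intro!: bexI[of _ \<one>])
    have "i = j" if "in_orbit (x j) i" for i
      using that disj(1)[of j i] j unfolding in_orbit_def by blast
    then have "(SOME i. in_orbit (x j) i) = j" using in_j by (metis someI)
    then show ?thesis using in_j by (auto simp: c_def)
  qed
  moreover have "\<sigma> (x j) = y j" if j: "j \<in> J" for j
  proof -
    have "(\<rho> \<one> (x j), \<rho>' \<one> (y j)) \<in> ?R" using j by blast
    then show ?thesis using \<sigma>(2) one one' pts j by auto
  qed
  ultimately show ?thesis
    using \<sigma>(1,3) inv_orbit by (intro exI[of _ \<sigma>] exI[of _ c]) (auto simp: c_def)
qed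

end

section \<open>Actions on finite sets of cosets\<close>

text \<open>Commutativity makes the stabiliser of every coset equal to \<open>N\<close> itself
  rather than to a conjugate, so that stabilisers do not vary from point to point.\<close>

lemma (in comm_group) lcos_fix_iff:
  assumes N: "subgroup N G" and a: "a \<in> carrier G" and x: "x \<in> carrier G"
  shows "a <# (x <# N) = x <# N \<longleftrightarrow> a \<in> N"
proof -
  have sub: "N \<subseteq> carrier G" using N by (rule subgroup.subset)
  have eq: "a <# (x <# N) = (a \<otimes> x) <# N"
    using a x sub by (simp add: lcos_m_assoc)
  show ?thesis
  proof
    assume "a \<in> N"
    then have "a <# N = N" using N a by (intro coset_join3)
    then have "x <# (a <# N) = x <# N" by simp
    then show "a <# (x <# N) = x <# N" using a x sub eq by (simp add: lcos_m_assoc m_comm)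
  next
    assume *: "a <# (x <# N) = x <# N"
    have "(a \<otimes> x) \<otimes> \<one> \<in> (a \<otimes> x) <# N"
      using subgroup.one_closed[OF N] unfolding l_coset_def by blast
    then have "a \<otimes> x \<in> x <# N" using * eq a x by simp
    then obtain m where "m \<in> N" "a \<otimes> x = x \<otimes> m" unfolding l_coset_def by blast
    moreover have "m \<in> carrier G" using \<open>m \<in> N\<close> sub by blast
    ultimately show "a \<in> N" using a x by (metis m_comm l_cancel)
  qed
qed

locale abelian_graph_of_groups = graph_of_groups_presentation \<Gamma> VG EG \<phi> T\<^sub>0 P
  for \<Gamma> :: "('v, 'e) pregraph" and VG :: "'v \<Rightarrow> 'a monoid" and EG :: "'e \<Rightarrow> 'b monoid"
    and \<phi> :: "'e \<Rightarrow> 'b \<Rightarrow> 'a" and T\<^sub>0 :: "('v, 'e) pregraph" and P :: "'e set" +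
  assumes vertex_comm: "v \<in> verts \<Gamma> \<Longrightarrow> comm_group (VG v)"
    and vertex_fg: "v \<in> verts \<Gamma> \<Longrightarrow> finitely_generated_group (VG v)"
begin

definition cosets :: "('v \<Rightarrow> 'a set) \<Rightarrow> 'v \<Rightarrow> 'a set set" where
  "cosets N v = (\<lambda>x. x <#\<^bsub>VG v\<^esub> N v) ` carrier (VG v)"

text \<open>By the last clause the subgroups at the two ends of an edge have the same preimage in
  the edge group, which is what gives the two actions of the edge group equal stabilisers.\<close>

definition compatible_system :: "('v \<Rightarrow> 'a set) \<Rightarrow> bool" where
  "compatible_system N \<longleftrightarrow>
     (\<forall>v\<in>verts \<Gamma>. subgroup (N v) (VG v) \<and> finite (cosets N v)) \<and>
     (\<forall>e\<in>edges \<Gamma>. \<forall>z\<in>carrier (EG e).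
        \<phi> e z \<in> N (\<alpha>_of \<Gamma> e) \<longleftrightarrow> \<phi> (einv \<Gamma> e) z \<in> N (\<omega>_of \<Gamma> e))"

text \<open>All vertex groups have to act on one set, so a point has a coset coordinate for every
  vertex. The second factor supplies \<open>n\<close> disjoint copies, one chart for each letter of
  a word of length \<open>n\<close>.\<close>

definition points :: "('v \<Rightarrow> 'a set) \<Rightarrow> nat \<Rightarrow> (('v \<Rightarrow> 'a set) \<times> nat) set" where
  "points N n = (\<Pi>\<^sub>E v\<in>verts \<Gamma>. cosets N v) \<times> {..<n}"

definition move :: "'v \<Rightarrow> 'a \<Rightarrow> ('v \<Rightarrow> 'a set) \<times> nat \<Rightarrow> ('v \<Rightarrow> 'a set) \<times> nat" where
  "move v a = (\<lambda>(y, i). (y(v := a <#\<^bsub>VG v\<^esub> y v), i))"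

context
  fixes N :: "'v \<Rightarrow> 'a set" and n :: nat
  assumes N: "compatible_system N"
begin

lemma N_subgroup: "v \<in> verts \<Gamma> \<Longrightarrow> subgroup (N v) (VG v)"
  using N by (simp add: compatible_system_def)

lemma finite_points: "finite (points N n)"
  using N finite_verts unfolding points_def compatible_system_def
  by (intro finite_cartesian_product finite_PiE) auto

lemma coset_move:
  assumes "v \<in> verts \<Gamma>" "C \<in> cosets N v" "a \<in> carrier (VG v)"
  shows "a <#\<^bsub>VG v\<^esub> C \<in> cosets N v"
    "b \<in> carrier (VG v) \<Longrightarrow> b <#\<^bsub>VG v\<^esub> (a <#\<^bsub>VG v\<^esub> C) = (b \<otimes>\<^bsub>VG v\<^esub> a) <#\<^bsub>VG v\<^esub> C"
    "\<one>\<^bsub>VG v\<^esub> <#\<^bsub>VG v\<^esub> C = C"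
    "a <#\<^bsub>VG v\<^esub> C = C \<longleftrightarrow> a \<in> N v"
proof -
  interpret comm_group "VG v" using assms(1) by (rule vertex_comm)
  have sub: "N v \<subseteq> carrier (VG v)" using N_subgroup[OF assms(1)] by (rule subgroup.subset)
  obtain x where x: "x \<in> carrier (VG v)" "C = x <#\<^bsub>VG v\<^esub> N v" using assms(2) by (auto simp: cosets_def)
  have C: "C \<subseteq> carrier (VG v)" using x sub by (simp add: l_coset_subset_G)
  have "a <#\<^bsub>VG v\<^esub> C = (a \<otimes>\<^bsub>VG v\<^esub> x) <#\<^bsub>VG v\<^esub> N v"
    using x sub assms(3) by (simp add: lcos_m_assoc)
  then show "a <#\<^bsub>VG v\<^esub> C \<in> cosets N v" using x assms(3) unfolding cosets_def by blast
  show "b <#\<^bsub>VG v\<^esub> (a <#\<^bsub>VG v\<^esub> C) = (b \<otimes>\<^bsub>VG v\<^esub> a) <#\<^bsub>VG v\<^esub> C" if "b \<in> carrier (VG v)"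
    using that C assms(3) by (simp add: lcos_m_assoc)
  show "\<one>\<^bsub>VG v\<^esub> <#\<^bsub>VG v\<^esub> C = C" using C by (rule lcos_mult_one)
  show "a <#\<^bsub>VG v\<^esub> C = C \<longleftrightarrow> a \<in> N v"
    unfolding x(2) by (rule lcos_fix_iff[OF N_subgroup[OF assms(1)] assms(3) x(1)])
qed

lemma points_coset: "(y, i) \<in> points N n \<Longrightarrow> v \<in> verts \<Gamma> \<Longrightarrow> y v \<in> cosets N v"
  by (auto simp: points_def)

lemma move_closed:
  assumes "v \<in> verts \<Gamma>" "a \<in> carrier (VG v)" "x \<in> points N n"
  shows "move v a x \<in> points N n"
proof -
  obtain y i where x: "x = (y, i)" by (cases x)
  have "a <#\<^bsub>VG v\<^esub> y v \<in> cosets N v" using coset_move(1) points_coset assms x by blast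
  then show ?thesis using assms x by (auto simp: move_def points_def PiE_iff extensional_def)
qed

lemma move_mult:
  assumes "v \<in> verts \<Gamma>" "a \<in> carrier (VG v)" "b \<in> carrier (VG v)" "x \<in> points N n"
  shows "move v (b \<otimes>\<^bsub>VG v\<^esub> a) x = move v b (move v a x)"
  using assms coset_move(2)[OF assms(1) points_coset assms(2,3)] by (cases x) (auto simp: move_def)

lemma move_one:
  assumes "v \<in> verts \<Gamma>" "x \<in> points N n"
  shows "move v \<one>\<^bsub>VG v\<^esub> x = x"
proof -
  interpret comm_group "VG v" using assms(1) by (rule vertex_comm)
  show ?thesis
    using assms coset_move(3)[OF assms(1) points_coset one_closed] by (cases x) (auto simp: move_def)
qed

lemma move_fix_iff:
  assumes "v \<in> verts \<Gamma>" "a \<in> carrier (VG v)" "x \<in> points N n"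
  shows "move v a x = x \<longleftrightarrow> a \<in> N v"
proof -
  obtain y i where x: "x = (y, i)" by (cases x)
  have "y(v := C) = y \<longleftrightarrow> C = y v" for C by (auto simp: fun_upd_idem_iff)
  then have "move v a x = x \<longleftrightarrow> a <#\<^bsub>VG v\<^esub> y v = y v"
    by (simp add: move_def x)
  then show ?thesis using coset_move(4) points_coset assms x by blast
qed

lemma move_bij:
  assumes "v \<in> verts \<Gamma>" "a \<in> carrier (VG v)"
  shows "bij_betw (move v a) (points N n) (points N n)"
proof -
  interpret comm_group "VG v" using assms(1) by (rule vertex_comm)
  have inv: "move v (inv\<^bsub>VG v\<^esub> a) (move v a x) = x" "move v a (move v (inv\<^bsub>VG v\<^esub> a) x) = x"
    if "x \<in> points N n" for x
    using that assms move_one by (simp_all add: move_mult[symmetric])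
  show ?thesis
    by (rule bij_betw_byWitness[of _ "move v (inv\<^bsub>VG v\<^esub> a)"]) (use inv move_closed assms in auto)
qed

lemma edge_actions:
  assumes e: "e \<in> edges \<Gamma>"
  shows "free_action_pair (EG e) (points N n)
    (\<lambda>z. move (\<omega>_of \<Gamma> e) (\<phi> (einv \<Gamma> e) z)) (\<lambda>z. move (\<alpha>_of \<Gamma> e) (\<phi> e z))"
proof -
  have V: "\<alpha>_of \<Gamma> e \<in> verts \<Gamma>" "\<omega>_of \<Gamma> e \<in> verts \<Gamma>" using e \<alpha>_closed \<omega>_closed by auto
  interpret H: group "EG e" using e by (rule edge_group)
  have hom: "\<phi> e \<in> hom (EG e) (VG (\<alpha>_of \<Gamma> e))" "\<phi> (einv \<Gamma> e) \<in> hom (EG e) (VG (\<omega>_of \<Gamma> e))"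
    using \<phi>_hom[OF e] \<phi>_hom[OF einv_closed[OF e]] e by (simp_all add: edge_group_einv \<alpha>_einv[OF serre])
  have one: "\<phi> e \<one>\<^bsub>EG e\<^esub> = \<one>\<^bsub>VG (\<alpha>_of \<Gamma> e)\<^esub>" "\<phi> (einv \<Gamma> e) \<one>\<^bsub>EG e\<^esub> = \<one>\<^bsub>VG (\<omega>_of \<Gamma> e)\<^esub>"
    using hom_one[OF hom(1) H.is_group vertex_group[OF V(1)]] hom_one[OF hom(2) H.is_group vertex_group[OF V(2)]] .
  show ?thesis
  proof (unfold_locales, goal_cases)
    \<comment> \<open>Equality of stabilisers: both sides say that \<open>z\<close> lies in the
      common preimage of the two subgroups.\<close>
    case 8
    then show ?case
      using V e N by (simp add: move_fix_iff \<phi>_closed \<phi>_einv_closed compatible_system_def)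
  qed (use hom V e in \<open>simp_all add: finite_points move_closed \<phi>_closed \<phi>_einv_closed hom_mult move_mult one move_one\<close>)
qed

text \<open>Equivariance of \<open>\<sigma> e\<close> and invariance of the cocycle
  \<open>c e\<close> together are the edge relation in \<open>shift_group\<close>. Choices are made
  for positive edges only, and negative edges receive the inverses.\<close>

lemma action_hom:
  assumes \<sigma>: "\<And>e. e \<in> P \<Longrightarrow> bij_betw (\<sigma> e) (points N n) (points N n)"
    and equiv: "\<And>e z x. e \<in> P \<Longrightarrow> z \<in> carrier (EG e) \<Longrightarrow> x \<in> points N n \<Longrightarrow>
      \<sigma> e (move (\<omega>_of \<Gamma> e) (\<phi> (einv \<Gamma> e) z) x) = move (\<alpha>_of \<Gamma> e) (\<phi> e z) (\<sigma> e x)"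
    and invar: "\<And>e z x. e \<in> P \<Longrightarrow> z \<in> carrier (EG e) \<Longrightarrow> x \<in> points N n \<Longrightarrow>
      c e (move (\<omega>_of \<Gamma> e) (\<phi> (einv \<Gamma> e) z) x) = c e x"
  defines "Q \<equiv> shift_group (points N n)"
    and "\<psi> \<equiv> (\<lambda>v a. lift_shift (points N n) (move v a) (\<lambda>_. 0))"
    and "q\<^sub>0 \<equiv> (\<lambda>e. lift_shift (points N n) (\<sigma> e) (c e))"
  shows "\<exists>\<Phi> p. \<Phi> \<in> hom G Q \<and> (\<forall>v\<in>verts \<Gamma>. p v \<in> carrier Q) \<and>
    (\<forall>v\<in>verts \<Gamma>. \<forall>a\<in>carrier (VG v). \<Phi> (\<iota> v a) = p v \<otimes>\<^bsub>Q\<^esub> \<psi> v a \<otimes>\<^bsub>Q\<^esub> inv\<^bsub>Q\<^esub> p v) \<and>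
    (\<forall>e\<in>edges \<Gamma>. \<Phi> (stable e) =
       p (\<alpha>_of \<Gamma> e) \<otimes>\<^bsub>Q\<^esub> (if e \<in> P then q\<^sub>0 e else inv\<^bsub>Q\<^esub> q\<^sub>0 (einv \<Gamma> e)) \<otimes>\<^bsub>Q\<^esub> inv\<^bsub>Q\<^esub> p (\<omega>_of \<Gamma> e))"
proof -
  interpret Q: group Q unfolding Q_def by (rule group_shift_group)
  let ?q = "\<lambda>e. if e \<in> P then q\<^sub>0 e else inv\<^bsub>Q\<^esub> q\<^sub>0 (einv \<Gamma> e)"
  have mult: "f \<otimes>\<^bsub>Q\<^esub> g = f \<circ> g" for f g by (simp add: Q_def)
  have q0: "q\<^sub>0 e \<in> carrier Q" if "e \<in> P" for e
    unfolding q\<^sub>0_def Q_def using \<sigma>[OF that] by (rule lift_shift_closed)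
  have \<psi>_cl: "\<psi> v a \<in> carrier Q" if "v \<in> verts \<Gamma>" "a \<in> carrier (VG v)" for v a
    unfolding \<psi>_def Q_def using move_bij[OF that] by (rule lift_shift_closed)
  have rel: "q\<^sub>0 e \<otimes>\<^bsub>Q\<^esub> \<psi> (\<omega>_of \<Gamma> e) (\<phi> (einv \<Gamma> e) z) = \<psi> (\<alpha>_of \<Gamma> e) (\<phi> e z) \<otimes>\<^bsub>Q\<^esub> q\<^sub>0 e"
    if e: "e \<in> P" "z \<in> carrier (EG e)" for e z
  proof -
    have eE: "e \<in> edges \<Gamma>" using P_edges e by simp
    have \<sigma>_in: "\<sigma> e x \<in> points N n" if "x \<in> points N n" for x
      using \<sigma>[OF e(1)] that bij_betw_apply by metis
    have m_in: "move (\<omega>_of \<Gamma> e) (\<phi> (einv \<Gamma> e) z) x \<in> points N n" if "x \<in> points N n" for x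
      using eE that e(2) by (simp add: move_closed \<omega>_closed \<phi>_einv_closed)
    show ?thesis
      unfolding mult q\<^sub>0_def \<psi>_def
      by (subst lift_shift_comp, erule m_in, subst lift_shift_comp, erule \<sigma>_in, rule lift_shift_cong)
        (simp_all add: equiv[OF e] invar[OF e])
  qed
  show ?thesis
  proof (rule gauged_hom[OF Q.is_group])
    show "\<psi> v \<in> hom (VG v) Q" if v: "v \<in> verts \<Gamma>" for v
    proof (rule homI)
      fix a b assume ab: "a \<in> carrier (VG v)" "b \<in> carrier (VG v)"
      then show "\<psi> v (a \<otimes>\<^bsub>VG v\<^esub> b) = \<psi> v a \<otimes>\<^bsub>Q\<^esub> \<psi> v b"
        unfolding mult \<psi>_def using v
        by (subst lift_shift_comp) (auto simp: move_closed move_mult intro!: lift_shift_cong)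
    qed (rule \<psi>_cl[OF v])
    fix e assume e: "e \<in> edges \<Gamma>"
    show "?q e \<in> carrier Q" using q0 orient_cases[OF e] by auto
    show "?q (einv \<Gamma> e) = inv\<^bsub>Q\<^esub> ?q e"
      using q0 orient_cases[OF e] einv_einv[OF e] by auto
    fix z assume z: "z \<in> carrier (EG e)"
    show "?q e \<otimes>\<^bsub>Q\<^esub> \<psi> (\<omega>_of \<Gamma> e) (\<phi> (einv \<Gamma> e) z) = \<psi> (\<alpha>_of \<Gamma> e) (\<phi> e z) \<otimes>\<^bsub>Q\<^esub> ?q e"
    proof (cases "e \<in> P")
      case True
      then show ?thesis using rel z by simp
    next
      case False
      let ?e = "einv \<Gamma> e"
      have eP: "?e \<in> P" using False orient_cases[OF e] by blast
      have "q\<^sub>0 ?e \<otimes>\<^bsub>Q\<^esub> \<psi> (\<alpha>_of \<Gamma> e) (\<phi> e z) = \<psi> (\<omega>_of \<Gamma> e) (\<phi> ?e z) \<otimes>\<^bsub>Q\<^esub> q\<^sub>0 ?e"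
        using rel[OF eP] z e by (simp add: edge_group_einv einv_einv \<omega>_einv \<alpha>_einv[OF serre])
      moreover have "\<psi> (\<alpha>_of \<Gamma> e) (\<phi> e z) \<in> carrier Q" "\<psi> (\<omega>_of \<Gamma> e) (\<phi> ?e z) \<in> carrier Q"
        using \<psi>_cl \<alpha>_closed \<omega>_closed \<phi>_closed \<phi>_einv_closed e z by auto
      ultimately have "inv\<^bsub>Q\<^esub> q\<^sub>0 ?e \<otimes>\<^bsub>Q\<^esub> \<psi> (\<omega>_of \<Gamma> e) (\<phi> ?e z) = \<psi> (\<alpha>_of \<Gamma> e) (\<phi> e z) \<otimes>\<^bsub>Q\<^esub> inv\<^bsub>Q\<^esub> q\<^sub>0 ?e"
        using q0[OF eP] by (metis Q.inv_closed Q.inv_solve_left Q.inv_solve_right Q.m_assoc Q.m_closed)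
      then show ?thesis using False by simp
    qed
  qed
qed

lemma base_point:
  assumes "i < n"
  shows "((\<lambda>v\<in>verts \<Gamma>. N v), i) \<in> points N n"
proof -
  have "N v \<in> cosets N v" if "v \<in> verts \<Gamma>" for v
  proof -
    interpret comm_group "VG v" using that by (rule vertex_comm)
    have "\<one>\<^bsub>VG v\<^esub> <#\<^bsub>VG v\<^esub> N v = N v"
      using N_subgroup[OF that] by (intro lcos_mult_one) (rule subgroup.subset)
    then show ?thesis unfolding cosets_def by (metis imageI one_closed)
  qed
  then show ?thesis using assms by (auto simp: points_def)
qed

end

text \<open>Arbitrary equivariant bijections serve as stable letters, with one copy of the points
  and the zero cocycle. The gauge \<open>p v\<close> conjugates the action of a vertex group, hence
  triviality is tested at the image of a base point under \<open>p v\<close>.\<close>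

theorem torsion_action:
  assumes N: "compatible_system N"
  shows "\<exists>(S :: (('v \<Rightarrow> 'a set) \<times> nat) set) \<Phi>. finite S \<and> \<Phi> \<in> hom G (shift_group S) \<and>
    (\<forall>v\<in>verts \<Gamma>. \<forall>a\<in>carrier (VG v). (\<forall>x\<in>S. fst (\<Phi> (\<iota> v a) (x, 0)) = x) \<longrightarrow> a \<in> N v)"
proof -
  let ?S = "points N 1"
  let ?Q = "shift_group ?S"
  interpret Q: group ?Q by (rule group_shift_group)
  define good where "good = (\<lambda>e \<sigma>. bij_betw \<sigma> ?S ?S \<and> (\<forall>z\<in>carrier (EG e). \<forall>x\<in>?S.
    \<sigma> (move (\<omega>_of \<Gamma> e) (\<phi> (einv \<Gamma> e) z) x) = move (\<alpha>_of \<Gamma> e) (\<phi> e z) (\<sigma> x)))"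
  have "\<exists>\<sigma>. good e \<sigma>" if "e \<in> P" for e
    using free_action_pair.equivariant_bijection[OF edge_actions[OF N P_edges[OF that]], of "{}" undefined 1 undefined]
    unfolding good_def by auto
  then obtain \<sigma> where \<sigma>: "\<And>e. e \<in> P \<Longrightarrow> good e (\<sigma> e)" by metis
  from action_hom[OF N, of \<sigma> 1 "\<lambda>_ _. 0"] \<sigma>
  obtain \<Phi> p where \<Phi>: "\<Phi> \<in> hom G ?Q" and p: "\<And>v. v \<in> verts \<Gamma> \<Longrightarrow> p v \<in> carrier ?Q"
    and \<Phi>\<iota>: "\<And>v a. v \<in> verts \<Gamma> \<Longrightarrow> a \<in> carrier (VG v) \<Longrightarrow>
      \<Phi> (\<iota> v a) = p v \<otimes>\<^bsub>?Q\<^esub> lift_shift ?S (move v a) (\<lambda>_. 0) \<otimes>\<^bsub>?Q\<^esub> inv\<^bsub>?Q\<^esub> p v"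
    unfolding good_def by (metis (no_types, lifting))
  have "a \<in> N v" if va: "v \<in> verts \<Gamma>" "a \<in> carrier (VG v)"
    and triv: "\<forall>x\<in>?S. fst (\<Phi> (\<iota> v a) (x, 0)) = x" for v a
  proof -
    let ?b = "((\<lambda>v\<in>verts \<Gamma>. N v), 0) :: ('v \<Rightarrow> 'a set) \<times> nat"
    have b: "?b \<in> ?S" using base_point[OF N] by simp
    note pv = p[OF va(1)]
    let ?x = "p v (?b, 0)"
    have "?x \<in> p v ` (?S \<times> UNIV)" using b by blast
    then have x: "fst ?x \<in> ?S" using shift_groupD(3)[OF pv] by auto
    have car: "\<Phi> (\<iota> v a) \<in> carrier ?Q" using \<Phi> \<iota>_closed[OF va] by (auto simp: hom_def)
    have "fst (\<Phi> (\<iota> v a) ?x) = fst ?x"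
    proof -
      have "?x = shift (snd ?x) (fst ?x, 0)" by (simp add: shift_def)
      then have "\<Phi> (\<iota> v a) ?x = shift (snd ?x) (\<Phi> (\<iota> v a) (fst ?x, 0))"
        using shift_groupD(2)[OF car] by metis
      then show ?thesis using triv x by (simp add: shift_def)
    qed
    moreover have "\<Phi> (\<iota> v a) ?x = p v (move v a ?b, 0)"
      using \<Phi>\<iota>[OF va] pv b by (simp add: inv_shift_group bij_is_inj[OF shift_groupD(1)[OF pv]])
    ultimately have "fst (p v (move v a ?b, 0)) = fst (p v (?b, 0))" by simp
    \<comment> \<open>Equal first coordinates put both points in one translation orbit. Since
      \<open>p v\<close> commutes with translation and is injective, this can be pulled back through
      it.\<close>
    then have "p v (move v a ?b, 0) = shift (snd (p v (move v a ?b, 0)) - snd ?x) ?x"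
      by (simp add: shift_def prod_eq_iff)
    also have "\<dots> = p v (shift (snd (p v (move v a ?b, 0)) - snd ?x) (?b, 0))"
      by (simp only: shift_groupD(2)[OF pv])
    finally have "move v a ?b = ?b"
      using bij_is_inj[OF shift_groupD(1)[OF pv]] by (auto simp: inj_eq shift_def)
    then show ?thesis using move_fix_iff[OF N va b] by simp
  qed
  then show ?thesis using \<Phi> finite_points[OF N] by blast
qed

end

section \<open>Hyperbolic elements: an action read off a cyclically reduced word\<close>

context graph_of_groups_presentation
begin

lemma gpath_nth:
  assumes "gpath u w v" "i < length w"
  shows "snd (w ! i) \<in> edges \<Gamma>" "fst (w ! i) \<in> carrier (VG (\<alpha>_of \<Gamma> (snd (w ! i))))"
    "\<alpha>_of \<Gamma> (snd (w ! 0)) = u"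
    "Suc i < length w \<Longrightarrow> \<alpha>_of \<Gamma> (snd (w ! Suc i)) = \<omega>_of \<Gamma> (snd (w ! i))"
    "Suc i = length w \<Longrightarrow> \<omega>_of \<Gamma> (snd (w ! i)) = v"
proof -
  have "snd (w ! i) \<in> edges \<Gamma> \<and> fst (w ! i) \<in> carrier (VG (\<alpha>_of \<Gamma> (snd (w ! i)))) \<and>
    \<alpha>_of \<Gamma> (snd (w ! 0)) = u \<and>
    (Suc i < length w \<longrightarrow> \<alpha>_of \<Gamma> (snd (w ! Suc i)) = \<omega>_of \<Gamma> (snd (w ! i))) \<and>
    (Suc i = length w \<longrightarrow> \<omega>_of \<Gamma> (snd (w ! i)) = v)"
    using assms
  proof (induction u w v arbitrary: i rule: gpath.induct)
    case (2 u a e w v)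
    show ?case
    proof (cases i)
      case 0
      then show ?thesis using 2 by (cases w) auto
    next
      case (Suc j)
      then have "j < length w" "gpath (\<omega>_of \<Gamma> e) w v" using 2 by auto
      moreover have "((a, e) # w) ! length w = w ! j" if "Suc j = length w"
        using that by (metis nth_Cons_Suc)
      ultimately show ?thesis using "2.IH"[of j] 2 Suc by simp
    qed
  qed simp
  then show "snd (w ! i) \<in> edges \<Gamma>" "fst (w ! i) \<in> carrier (VG (\<alpha>_of \<Gamma> (snd (w ! i))))"
    "\<alpha>_of \<Gamma> (snd (w ! 0)) = u"
    "Suc i < length w \<Longrightarrow> \<alpha>_of \<Gamma> (snd (w ! Suc i)) = \<omega>_of \<Gamma> (snd (w ! i))"
    "Suc i = length w \<Longrightarrow> \<omega>_of \<Gamma> (snd (w ! i)) = v"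
    by blast+
qed

end

lemma Suc_mod_inj:
  assumes "i < n" "j < n" "Suc i mod n = Suc j mod n"
  shows "i = j"
  using assms by (metis Suc_inject less_Suc_eq mod_Suc mod_less nat.distinct(1))

context abelian_graph_of_groups
begin

lemma move_snd [simp]: "snd (move v a x) = snd x"
  by (cases x) (simp add: move_def)

text \<open>Reading \<open>w\<close> cyclically prescribes \<open>s\<^sub>e\<close> on finitely many orbits: the letter
  \<open>(a\<^sub>i, e\<^sub>i)\<close> has to take the base point of chart \<open>i + 1\<close> to that of chart \<open>i\<close>. Since \<open>w\<close> stays
  cyclically reduced modulo \<open>N\<close>, these orbits are distinct, so the prescription extends to
  an action; the cocycle counting crossings of the first edge then takes the value 1 on \<open>w\<close>.\<close>

theorem hyperbolic_action:
  assumes N: "compatible_system N" and w: "gpath u w u" "w \<noteq> []"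
    and sep: "\<And>i z. i < length w \<Longrightarrow> snd (w ! (Suc i mod length w)) = einv \<Gamma> (snd (w ! i)) \<Longrightarrow>
      z \<in> carrier (EG (snd (w ! i))) \<Longrightarrow>
      \<phi> (einv \<Gamma> (snd (w ! i))) z \<otimes>\<^bsub>VG (\<omega>_of \<Gamma> (snd (w ! i)))\<^esub>
        inv\<^bsub>VG (\<omega>_of \<Gamma> (snd (w ! i)))\<^esub> fst (w ! (Suc i mod length w)) \<notin> N (\<omega>_of \<Gamma> (snd (w ! i)))"
  shows "\<exists>(S :: (('v \<Rightarrow> 'a set) \<times> nat) set) \<Phi> x. finite S \<and> \<Phi> \<in> hom G (shift_group S) \<and>
    x \<in> S \<times> UNIV \<and> \<Phi> (gval w) x = shift 1 x"
proof -
  define n where "n = length w"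
  define a where "a = (\<lambda>i. fst (w ! i))"
  define e where "e = (\<lambda>i. snd (w ! i))"
  define nx where "nx = (\<lambda>i. Suc i mod n)"
  define b where "b = (\<lambda>i::nat. ((\<lambda>v\<in>verts \<Gamma>. N v), i))"
  let ?S = "points N n"
  let ?Q = "shift_group ?S"
  interpret Q: group ?Q by (rule group_shift_group)
  have n: "n > 0" using w by (simp add: n_def)
  have nx: "nx i < n" for i using n by (simp add: nx_def)
  have eE: "e i \<in> edges \<Gamma>" and aV: "a i \<in> carrier (VG (\<alpha>_of \<Gamma> (e i)))" if "i < n" for i
    using gpath_nth(1,2)[OF w(1)] that by (auto simp: n_def a_def e_def)
  have \<alpha>nx: "\<alpha>_of \<Gamma> (e (nx i)) = \<omega>_of \<Gamma> (e i)" if i: "i < n" for i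
  proof (cases "Suc i < n")
    case True
    then show ?thesis using gpath_nth(4)[OF w(1)] i by (auto simp: n_def e_def nx_def)
  next
    case False
    then have "Suc i = n" using i by simp
    then show ?thesis using gpath_nth(3,5)[OF w(1), of i] i by (auto simp: n_def e_def nx_def)
  qed
  have V: "\<alpha>_of \<Gamma> (e i) \<in> verts \<Gamma>" if "i < n" for i using eE[OF that] by (rule \<alpha>_closed)
  have bS: "b i \<in> ?S" if "i < n" for i using base_point[OF N that] by (simp add: b_def)
  have snd_b [simp]: "snd (b i) = i" for i by (simp add: b_def)
  have ia: "inv\<^bsub>VG (\<alpha>_of \<Gamma> (e i))\<^esub> a i \<in> carrier (VG (\<alpha>_of \<Gamma> (e i)))" if "i < n" for i
    using group.inv_closed[OF vertex_group[OF V[OF that]] aV[OF that]] .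
  \<comment> \<open>The point of chart \<open>i\<close> that the vertex element \<open>a i\<close>
    takes to the base point \<open>b i\<close>. Hence the edge letter of position \<open>i\<close>
    has to take \<open>b (nx i)\<close> to \<open>bk i\<close>.\<close>
  define bk where "bk = (\<lambda>i. move (\<alpha>_of \<Gamma> (e i)) (inv\<^bsub>VG (\<alpha>_of \<Gamma> (e i))\<^esub> a i) (b i))"
  have backS: "bk i \<in> ?S" if "i < n" for i
    unfolding bk_def using move_closed[OF N V ia bS] that by blast
  have move_back: "move (\<alpha>_of \<Gamma> (e i)) (a i) (bk i) = b i" if i: "i < n" for i
  proof -
    interpret Gv: group "VG (\<alpha>_of \<Gamma> (e i))" using V[OF i] by (rule vertex_group)
    show ?thesis
      unfolding bk_def move_mult[OF N V[OF i] ia[OF i] aV[OF i] bS[OF i], symmetric]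
      using aV[OF i] move_one[OF N V[OF i] bS[OF i]] by simp
  qed
  define J where "J = (\<lambda>f. {i. i < n \<and> (e i = f \<or> e i = einv \<Gamma> f)})"
  \<comment> \<open>If letter \<open>i\<close> crosses \<open>f\<close> backwards, its prescription
    concerns the inverse of \<open>f\<close>, so source and target change roles.\<close>
  define src where "src = (\<lambda>f i. if e i = f then b (nx i) else bk i)"
  define tgt where "tgt = (\<lambda>f i. if e i = f then bk i else b (nx i))"
  have srcS: "src f i \<in> ?S" and tgtS: "tgt f i \<in> ?S" if "i \<in> J f" for f i
    using that bS backS nx by (auto simp: src_def tgt_def J_def)
  \<comment> \<open>The only way in which two prescribed sources can share an orbit: chart numbers
    force the letters to be consecutive and to backtrack, and then \<open>sep\<close> excludes
    it.\<close>
  have meet: False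
    if ij: "i < n" "j = nx i" "e i = f" "e j = einv \<Gamma> f" and z: "z \<in> carrier (EG f)"
      and eq: "b j = move (\<omega>_of \<Gamma> f) (\<phi> (einv \<Gamma> f) z) (bk j)" for i j f z
  proof -
    have fE: "f \<in> edges \<Gamma>" using eE ij by blast
    have vj: "\<alpha>_of \<Gamma> (e j) = \<omega>_of \<Gamma> f" using \<alpha>nx ij by blast
    have jn: "j < n" using nx ij by simp
    interpret Gv: group "VG (\<omega>_of \<Gamma> f)" using \<omega>_closed[OF fE] by (rule vertex_group)
    have \<phi>z: "\<phi> (einv \<Gamma> f) z \<in> carrier (VG (\<omega>_of \<Gamma> f))" using \<phi>_einv_closed[OF fE z] .
    have iaj: "inv\<^bsub>VG (\<omega>_of \<Gamma> f)\<^esub> a j \<in> carrier (VG (\<omega>_of \<Gamma> f))" using ia[OF jn] vj by simp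
    have "move (\<omega>_of \<Gamma> f) (\<phi> (einv \<Gamma> f) z \<otimes>\<^bsub>VG (\<omega>_of \<Gamma> f)\<^esub> inv\<^bsub>VG (\<omega>_of \<Gamma> f)\<^esub> a j) (b j) = b j"
      using eq vj move_mult[OF N \<omega>_closed[OF fE] iaj \<phi>z bS[OF jn]] by (simp add: bk_def)
    then have "\<phi> (einv \<Gamma> f) z \<otimes>\<^bsub>VG (\<omega>_of \<Gamma> f)\<^esub> inv\<^bsub>VG (\<omega>_of \<Gamma> f)\<^esub> a j \<in> N (\<omega>_of \<Gamma> f)"
      using move_fix_iff[OF N \<omega>_closed[OF fE] _ bS[OF jn]] \<phi>z iaj by simp
    moreover have "snd (w ! (Suc i mod length w)) = einv \<Gamma> (snd (w ! i))" "z \<in> carrier (EG (snd (w ! i)))"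
      "snd (w ! i) = f" "fst (w ! (Suc i mod length w)) = a j"
      using ij z by (auto simp: e_def a_def nx_def n_def)
    ultimately show False using sep[of i z] ij(1) by (simp add: n_def)
  qed
  have distinct: "i = j"
    if f: "f \<in> edges \<Gamma>" and ij: "i \<in> J f" "j \<in> J f" and z: "z \<in> carrier (EG f)"
      and eq: "src f i = move (\<omega>_of \<Gamma> f) (\<phi> (einv \<Gamma> f) z) (src f j)" for f i j z
  proof -
    have ijn: "i < n" "j < n" using ij by (auto simp: J_def)
    have snds: "snd (src f i) = snd (src f j)" using eq by simp
    have snd_src: "snd (src f i) = (if e i = f then nx i else i)" for i
      by (simp add: src_def bk_def)
    consider "e i = f" "e j = f" | "e i \<noteq> f" "e j \<noteq> f" | "e i = f" "e j \<noteq> f" | "e i \<noteq> f" "e j = f" by blast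
    then show ?thesis
    proof cases
      case 1
      then show ?thesis using snds snd_src ijn Suc_mod_inj by (simp add: nx_def)
    next
      case 2
      then show ?thesis using snds snd_src by simp
    next
      case 3
      then have "j = nx i" "e j = einv \<Gamma> f" using snds snd_src ij by (auto simp: J_def)
      then show ?thesis using meet[of i j f z] 3 eq ijn z by (simp add: src_def)
    next
      case 4
      then have i: "i = nx j" "e i = einv \<Gamma> f" using snds snd_src ij by (auto simp: J_def)
      interpret H: group "EG f" using f by (rule edge_group)
      interpret pair: free_action_pair "EG f" ?S "\<lambda>z. move (\<omega>_of \<Gamma> f) (\<phi> (einv \<Gamma> f) z)"
        "\<lambda>z. move (\<alpha>_of \<Gamma> f) (\<phi> f z)"
        by (rule edge_actions[OF N f])
      have "bk i = move (\<omega>_of \<Gamma> f) (\<phi> (einv \<Gamma> f) z) (b i)"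
        using eq 4 i by (simp add: src_def)
      then have "b i = move (\<omega>_of \<Gamma> f) (\<phi> (einv \<Gamma> f) (inv\<^bsub>EG f\<^esub> z)) (bk i)"
        using pair.inv_act[OF z bS[OF ijn(1)]] by simp
      then show ?thesis using meet[of j i f "inv\<^bsub>EG f\<^esub> z"] 4 i ijn z by simp
    qed
  qed
  have J_einv: "J (einv \<Gamma> f) = J f" if "f \<in> edges \<Gamma>" for f
    using einv_einv[OF that] by (auto simp: J_def)
  have tgt_src: "tgt f i = src (einv \<Gamma> f) i" if "f \<in> edges \<Gamma>" "i \<in> J f" for f i
    using that einv_neq[OF that(1)] by (auto simp: tgt_def src_def J_def)
  \<comment> \<open>Targets of \<open>f\<close> are sources of its inverse, so this is
    \<open>distinct\<close> for the inverse edge.\<close>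
  have distinct': "i = j"
    if f: "f \<in> edges \<Gamma>" and ij: "i \<in> J f" "j \<in> J f" and z: "z \<in> carrier (EG f)"
      and eq: "tgt f i = move (\<alpha>_of \<Gamma> f) (\<phi> f z) (tgt f j)" for f i j z
    using distinct[OF einv_closed[OF f], of i j z] ij z eq
    by (simp add: J_einv[OF f] edge_group_einv[OF f] \<omega>_einv[OF f] einv_einv[OF f] tgt_src[OF f ij(1)] tgt_src[OF f ij(2)])
  \<comment> \<open>Only position 0 has a nonzero value, with the sign of its direction, even if its
    edge occurs again in \<open>w\<close>. One pass through \<open>w\<close> therefore gains exactly
    1.\<close>
  define k :: "'e \<Rightarrow> nat \<Rightarrow> int" where
    "k = (\<lambda>f i. if i = 0 then (if e i = f then 1 else - 1) else 0)"
  define good where "good = (\<lambda>f (\<sigma>, c). bij_betw \<sigma> ?S ?S \<and>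
    (\<forall>z\<in>carrier (EG f). \<forall>x\<in>?S. \<sigma> (move (\<omega>_of \<Gamma> f) (\<phi> (einv \<Gamma> f) z) x) = move (\<alpha>_of \<Gamma> f) (\<phi> f z) (\<sigma> x)) \<and>
    (\<forall>z\<in>carrier (EG f). \<forall>x\<in>?S. c (move (\<omega>_of \<Gamma> f) (\<phi> (einv \<Gamma> f) z) x) = c x) \<and>
    (\<forall>i\<in>J f. \<sigma> (src f i) = tgt f i \<and> c (src f i) = k f i))"
  have "\<exists>\<sigma>c. good f \<sigma>c" if f: "f \<in> P" for f
  proof -
    note fE = P_edges[OF f]
    from free_action_pair.equivariant_bijection[OF edge_actions[OF N fE], of "J f" "src f" n "tgt f" "k f"]
      srcS tgtS distinct[OF fE] distinct'[OF fE]
    show ?thesis unfolding good_def by auto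
  qed
  then obtain \<sigma>c where \<sigma>c: "\<And>f. f \<in> P \<Longrightarrow> good f (\<sigma>c f)" by metis
  define \<sigma> where "\<sigma> = (\<lambda>f. fst (\<sigma>c f))"
  define c where "c = (\<lambda>f. snd (\<sigma>c f))"
  have gd: "good f (\<sigma> f, c f)" if "f \<in> P" for f using \<sigma>c[OF that] by (simp add: \<sigma>_def c_def)
  define q\<^sub>0 where "q\<^sub>0 = (\<lambda>f. lift_shift ?S (\<sigma> f) (c f))"
  define q where "q = (\<lambda>f. if f \<in> P then q\<^sub>0 f else inv\<^bsub>?Q\<^esub> q\<^sub>0 (einv \<Gamma> f))"
  define \<psi> where "\<psi> = (\<lambda>v a. lift_shift ?S (move v a) (\<lambda>_. 0))"
  have "\<exists>\<Phi> p. \<Phi> \<in> hom G ?Q \<and> (\<forall>v\<in>verts \<Gamma>. p v \<in> carrier ?Q) \<and>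
    (\<forall>v\<in>verts \<Gamma>. \<forall>a\<in>carrier (VG v). \<Phi> (\<iota> v a) = p v \<otimes>\<^bsub>?Q\<^esub> \<psi> v a \<otimes>\<^bsub>?Q\<^esub> inv\<^bsub>?Q\<^esub> p v) \<and>
    (\<forall>f\<in>edges \<Gamma>. \<Phi> (stable f) = p (\<alpha>_of \<Gamma> f) \<otimes>\<^bsub>?Q\<^esub> q f \<otimes>\<^bsub>?Q\<^esub> inv\<^bsub>?Q\<^esub> p (\<omega>_of \<Gamma> f))"
    unfolding q_def q\<^sub>0_def \<psi>_def
  proof (rule action_hom[OF N])
    fix f assume "f \<in> P"
    note gf = gd[OF this, unfolded good_def prod.case]
    show "bij_betw (\<sigma> f) ?S ?S" using gf by blast
    fix z x assume "z \<in> carrier (EG f)" "x \<in> ?S"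
    then show "\<sigma> f (move (\<omega>_of \<Gamma> f) (\<phi> (einv \<Gamma> f) z) x) = move (\<alpha>_of \<Gamma> f) (\<phi> f z) (\<sigma> f x)"
      "c f (move (\<omega>_of \<Gamma> f) (\<phi> (einv \<Gamma> f) z) x) = c f x"
      using gf by blast+
  qed
  then obtain \<Phi> p where \<Phi>: "\<Phi> \<in> hom G ?Q" and p: "\<And>v. v \<in> verts \<Gamma> \<Longrightarrow> p v \<in> carrier ?Q"
    and \<Phi>\<iota>: "\<And>v a. v \<in> verts \<Gamma> \<Longrightarrow> a \<in> carrier (VG v) \<Longrightarrow>
      \<Phi> (\<iota> v a) = p v \<otimes>\<^bsub>?Q\<^esub> \<psi> v a \<otimes>\<^bsub>?Q\<^esub> inv\<^bsub>?Q\<^esub> p v"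
    and \<Phi>s: "\<And>f. f \<in> edges \<Gamma> \<Longrightarrow> \<Phi> (stable f) = p (\<alpha>_of \<Gamma> f) \<otimes>\<^bsub>?Q\<^esub> q f \<otimes>\<^bsub>?Q\<^esub> inv\<^bsub>?Q\<^esub> p (\<omega>_of \<Gamma> f)"
    by metis
  have pinv: "(inv\<^bsub>?Q\<^esub> p v) (p v x) = x" if "v \<in> verts \<Gamma>" for v x
    using inv_shift_group[OF p[OF that]] bij_is_inj[OF shift_groupD(1)[OF p[OF that]]] by simp
  have q_step: "q (e i) (b (nx i), m) = (bk i, m + (if i = 0 then 1 else 0))" if i: "i < n" for i m
  proof (cases "e i \<in> P")
    case True
    have "i \<in> J (e i)" using i by (simp add: J_def)
    then have "\<sigma> (e i) (src (e i) i) = tgt (e i) i" "c (e i) (src (e i) i) = k (e i) i"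
      using gd[OF True] unfolding good_def by auto
    then have "\<sigma> (e i) (b (nx i)) = bk i" "c (e i) (b (nx i)) = (if i = 0 then 1 else 0)"
      by (auto simp: src_def tgt_def k_def)
    then show ?thesis using True bS[OF nx] by (simp add: q_def q\<^sub>0_def)
  next
    case False
    let ?f = "einv \<Gamma> (e i)"
    have fP: "?f \<in> P" using False orient_cases eE i by blast
    have ne: "e i \<noteq> ?f" using einv_neq eE i by metis
    have "i \<in> J ?f" using i eE by (simp add: J_def einv_einv)
    then have "\<sigma> ?f (src ?f i) = tgt ?f i" "c ?f (src ?f i) = k ?f i"
      using gd[OF fP] unfolding good_def by auto
    then have "\<sigma> ?f (bk i) = b (nx i)" "c ?f (bk i) = (if i = 0 then - 1 else 0)"
      using ne by (cases "i = 0"; simp add: src_def tgt_def k_def)+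
    then have "q\<^sub>0 ?f (bk i, m + (if i = 0 then 1 else 0)) = (b (nx i), m)"
      using backS[OF i] by (simp add: q\<^sub>0_def)
    moreover have car: "q\<^sub>0 ?f \<in> carrier ?Q"
      unfolding q\<^sub>0_def using gd[OF fP] by (intro lift_shift_closed) (simp add: good_def)
    ultimately have "inv_into UNIV (q\<^sub>0 ?f) (b (nx i), m) = (bk i, m + (if i = 0 then 1 else 0))"
      by (intro inv_f_eq[OF bij_is_inj[OF shift_groupD(1)]])
    then show ?thesis
      using False inv_shift_group[OF car] by (simp only: q_def if_False)
  qed
  \<comment> \<open>Letters act from the right, so the point starts at \<open>b 0\<close>, which is
    chart \<open>n\<close> modulo \<open>n\<close>, and descends through the charts back to
    \<open>b 0\<close>, while the gauge factors of neighbouring letters cancel. The displacement 1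
    enters only at the final step \<open>i = 0\<close>.\<close>
  have suffix: "\<Phi> (gval (drop i w)) (p u (b 0, 0)) = p x (b (i mod n), if i = 0 then 1 else 0)"
    if "i \<le> n" "gpath x (drop i w) u" for i x
    using that
  proof (induction "n - i" arbitrary: i x)
    case 0
    then have "drop i w = []" "x = u" "i mod n = 0" "i \<noteq> 0" using n by (auto simp: n_def)
    then show ?case using hom_one[OF \<Phi> G.is_group Q.is_group] by simp
  next
    case (Suc d)
    then have i: "i < n" by simp
    have dw: "drop i w = (a i, e i) # drop (Suc i) w"
      using i by (simp add: n_def a_def e_def Cons_nth_drop_Suc)
    have x: "x = \<alpha>_of \<Gamma> (e i)" and path: "gpath (\<omega>_of \<Gamma> (e i)) (drop (Suc i) w) u"
      using Suc.prems(2) dw by auto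
    have IH: "\<Phi> (gval (drop (Suc i) w)) (p u (b 0, 0)) = p (\<omega>_of \<Gamma> (e i)) (b (nx i), 0)"
      using Suc.hyps(1)[of "Suc i", OF _ _ path] Suc.hyps(2) i by (simp add: nx_def)
    have cl: "\<iota> x (a i) \<in> carrier G" "stable (e i) \<in> carrier G" "gval (drop (Suc i) w) \<in> carrier G"
      using \<iota>_closed[OF V aV] stable_closed[OF eE] gval_closed[OF path] i x by auto
    have Vx: "x \<in> verts \<Gamma>" using V[OF i] x by simp
    have "\<Phi> (gval (drop i w)) (p u (b 0, 0)) = \<Phi> (\<iota> x (a i)) (\<Phi> (stable (e i)) (p (\<omega>_of \<Gamma> (e i)) (b (nx i), 0)))"
      using \<Phi> cl IH by (simp add: dw x hom_mult)
    also have "\<Phi> (stable (e i)) (p (\<omega>_of \<Gamma> (e i)) (b (nx i), 0)) = p x (bk i, if i = 0 then 1 else 0)"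
      using \<Phi>s[OF eE[OF i]] pinv[OF \<omega>_closed[OF eE[OF i]]] q_step[OF i, of 0] by (simp add: x)
    also have "\<Phi> (\<iota> x (a i)) \<dots> = p x (b i, if i = 0 then 1 else 0)"
      using \<Phi>\<iota>[OF Vx, of "a i"] aV[OF i] pinv[OF Vx] backS[OF i] move_back[OF i] by (simp add: x \<psi>_def)
    finally show ?case using i by simp
  qed
  have u: "u \<in> verts \<Gamma>" using gpath_verts[OF w(1)] by simp
  let ?x = "p u (b 0, 0)"
  have "\<Phi> (gval w) ?x = p u (b 0, 1)" using suffix[of 0 u] w(1) by simp
  also have "\<dots> = p u (shift 1 (b 0, 0))" by (simp add: shift_def)
  also have "\<dots> = shift 1 ?x" by (rule shift_groupD(2)[OF p[OF u]])
  finally have "\<Phi> (gval w) ?x = shift 1 ?x" .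
  moreover have "?x \<in> ?S \<times> UNIV"
    using bS[OF n] shift_groupD(3)[OF p[OF u]] by blast
  ultimately show ?thesis
    using \<Phi> finite_points[OF N] by (intro exI[of _ ?S] exI[of _ \<Phi>] exI[of _ ?x] conjI)
qed

end

section \<open>Extending homomorphisms to divisible groups\<close>

definition divisible_group :: "('d, 'm) monoid_scheme \<Rightarrow> bool" where
  "divisible_group D \<longleftrightarrow> comm_group D \<and>
     (\<forall>x\<in>carrier D. \<forall>n>0. \<exists>y\<in>carrier D. y [^]\<^bsub>D\<^esub> (n::nat) = x)"

text \<open>The graph of a homomorphism defined on a subgroup, single-valued by the last clause. As
  a relation it can be enlarged by inclusion and carried across edges without fixing values
  elsewhere.\<close>

definition partial_hom :: "('a, 'm) monoid_scheme \<Rightarrow> ('d, 'n) monoid_scheme \<Rightarrow> ('a \<times> 'd) set \<Rightarrow> bool" where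
  "partial_hom A D S \<longleftrightarrow> S \<subseteq> carrier A \<times> carrier D \<and> (\<one>\<^bsub>A\<^esub>, \<one>\<^bsub>D\<^esub>) \<in> S \<and>
     (\<forall>a x b y. (a, x) \<in> S \<longrightarrow> (b, y) \<in> S \<longrightarrow> (a \<otimes>\<^bsub>A\<^esub> b, x \<otimes>\<^bsub>D\<^esub> y) \<in> S) \<and>
     (\<forall>a x. (a, x) \<in> S \<longrightarrow> (inv\<^bsub>A\<^esub> a, inv\<^bsub>D\<^esub> x) \<in> S) \<and>
     (\<forall>x. (\<one>\<^bsub>A\<^esub>, x) \<in> S \<longrightarrow> x = \<one>\<^bsub>D\<^esub>)"

lemma partial_homI:
  assumes "S \<subseteq> carrier A \<times> carrier D" "(\<one>\<^bsub>A\<^esub>, \<one>\<^bsub>D\<^esub>) \<in> S"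
    and "\<And>a x b y. (a, x) \<in> S \<Longrightarrow> (b, y) \<in> S \<Longrightarrow> (a \<otimes>\<^bsub>A\<^esub> b, x \<otimes>\<^bsub>D\<^esub> y) \<in> S"
    and "\<And>a x. (a, x) \<in> S \<Longrightarrow> (inv\<^bsub>A\<^esub> a, inv\<^bsub>D\<^esub> x) \<in> S"
    and "\<And>x. (\<one>\<^bsub>A\<^esub>, x) \<in> S \<Longrightarrow> x = \<one>\<^bsub>D\<^esub>"
  shows "partial_hom A D S"
  unfolding partial_hom_def by (intro conjI allI impI) (fact assms(1,2) | erule (1) assms(3) | erule assms(4) | erule assms(5))+

lemma partial_homD:
  assumes "partial_hom A D S"
  shows "(a, x) \<in> S \<Longrightarrow> a \<in> carrier A" "(a, x) \<in> S \<Longrightarrow> x \<in> carrier D" "(\<one>\<^bsub>A\<^esub>, \<one>\<^bsub>D\<^esub>) \<in> S"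
    "(a, x) \<in> S \<Longrightarrow> (b, y) \<in> S \<Longrightarrow> (a \<otimes>\<^bsub>A\<^esub> b, x \<otimes>\<^bsub>D\<^esub> y) \<in> S"
    "(a, x) \<in> S \<Longrightarrow> (inv\<^bsub>A\<^esub> a, inv\<^bsub>D\<^esub> x) \<in> S"
    "(\<one>\<^bsub>A\<^esub>, x) \<in> S \<Longrightarrow> x = \<one>\<^bsub>D\<^esub>"
  using assms unfolding partial_hom_def by blast+

locale comm_group_pair = A: comm_group A + D: comm_group D for A (structure) and D (structure)
begin

lemma partial_hom_pow:
  assumes S: "partial_hom A D S" and ax: "(a, x) \<in> S"
  shows "(a [^]\<^bsub>A\<^esub> (i::int), x [^]\<^bsub>D\<^esub> i) \<in> S"
proof -
  note SD = partial_homD[OF S]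
  have nat: "(a [^]\<^bsub>A\<^esub> n, x [^]\<^bsub>D\<^esub> n) \<in> S" for n :: nat
  proof (induction n)
    case 0
    show ?case using SD(3) by simp
  next
    case (Suc n)
    show ?case using SD(4)[OF Suc ax] by simp
  qed
  show ?thesis
  proof (cases i)
    case (nonneg n)
    then show ?thesis using nat by (simp add: int_pow_int)
  next
    case (neg n)
    then show ?thesis
      using SD(5)[OF nat[of "Suc n"]] SD(1,2)[OF ax]
      by (simp only: A.int_pow_neg_int D.int_pow_neg_int)
  qed
qed

lemma partial_hom_functional:
  assumes S: "partial_hom A D S" and "(a, x) \<in> S" "(a, y) \<in> S"
  shows "x = y"
proof -
  note SD = partial_homD[OF S]
  have "(a \<otimes>\<^bsub>A\<^esub> inv\<^bsub>A\<^esub> a, x \<otimes>\<^bsub>D\<^esub> inv\<^bsub>D\<^esub> y) \<in> S" using SD assms by blast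
  then have "x \<otimes>\<^bsub>D\<^esub> inv\<^bsub>D\<^esub> y = \<one>\<^bsub>D\<^esub>" using SD assms by (simp add: A.r_inv)
  then show ?thesis using SD(2) assms by (metis D.inv_closed D.inv_equality D.inv_inv)
qed

text \<open>A product of an element of the domain and a power of \<open>a\<close> is trivial only if
  that power lies in the domain, so well-definedness comes down to agreement on such powers.\<close>

lemma partial_hom_adjoin:
  assumes S: "partial_hom A D S" and a: "a \<in> carrier A" and x: "x \<in> carrier D"
    and consistent: "\<And>i::int. \<And>y. (a [^]\<^bsub>A\<^esub> i, y) \<in> S \<Longrightarrow> x [^]\<^bsub>D\<^esub> i = y"
  shows "partial_hom A D {(b \<otimes>\<^bsub>A\<^esub> a [^]\<^bsub>A\<^esub> i, y \<otimes>\<^bsub>D\<^esub> x [^]\<^bsub>D\<^esub> i) |b y i::int. (b, y) \<in> S}"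
    (is "partial_hom A D ?S'")
    and "S \<subseteq> {(b \<otimes>\<^bsub>A\<^esub> a [^]\<^bsub>A\<^esub> i, y \<otimes>\<^bsub>D\<^esub> x [^]\<^bsub>D\<^esub> i) |b y i::int. (b, y) \<in> S}"
    and "(a, x) \<in> {(b \<otimes>\<^bsub>A\<^esub> a [^]\<^bsub>A\<^esub> i, y \<otimes>\<^bsub>D\<^esub> x [^]\<^bsub>D\<^esub> i) |b y i::int. (b, y) \<in> S}"
proof -
  note SD = partial_homD[OF S]
  have S'I: "(b \<otimes>\<^bsub>A\<^esub> a [^]\<^bsub>A\<^esub> i, y \<otimes>\<^bsub>D\<^esub> x [^]\<^bsub>D\<^esub> i) \<in> ?S'" if "(b, y) \<in> S" for b y and i :: int
    using that by blast
  show "S \<subseteq> ?S'"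
  proof
    fix p assume p: "p \<in> S"
    obtain b y where "p = (b, y)" by (cases p)
    then show "p \<in> ?S'" using S'I[of b y 0] p SD(1,2) by simp
  qed
  show "(a, x) \<in> ?S'" using S'I[OF SD(3), of 1] a x by simp
  show "partial_hom A D ?S'"
  proof (rule partial_homI)
    show "?S' \<subseteq> carrier A \<times> carrier D" using SD(1,2) a x by auto
    show "(\<one>\<^bsub>A\<^esub>, \<one>\<^bsub>D\<^esub>) \<in> ?S'" using S'I[OF SD(3), of 0] by simp
    fix b y assume "(b, y) \<in> ?S'"
    then obtain b' y' and i :: int where b: "b = b' \<otimes>\<^bsub>A\<^esub> a [^]\<^bsub>A\<^esub> i" "y = y' \<otimes>\<^bsub>D\<^esub> x [^]\<^bsub>D\<^esub> i" "(b', y') \<in> S" by blast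
    note bc = SD(1,2)[OF b(3)]
    have "(inv\<^bsub>A\<^esub> b' \<otimes>\<^bsub>A\<^esub> a [^]\<^bsub>A\<^esub> (- i), inv\<^bsub>D\<^esub> y' \<otimes>\<^bsub>D\<^esub> x [^]\<^bsub>D\<^esub> (- i)) \<in> ?S'"
      using S'I[OF SD(5)[OF b(3)]] .
    then show "(inv\<^bsub>A\<^esub> b, inv\<^bsub>D\<^esub> y) \<in> ?S'"
      using b bc a x by (simp add: A.inv_mult D.inv_mult A.int_pow_neg D.int_pow_neg)
    fix c z assume "(c, z) \<in> ?S'"
    then obtain c' z' and j :: int where c: "c = c' \<otimes>\<^bsub>A\<^esub> a [^]\<^bsub>A\<^esub> j" "z = z' \<otimes>\<^bsub>D\<^esub> x [^]\<^bsub>D\<^esub> j" "(c', z') \<in> S" by blast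
    note cc = SD(1,2)[OF c(3)]
    have "b \<otimes>\<^bsub>A\<^esub> c = (b' \<otimes>\<^bsub>A\<^esub> c') \<otimes>\<^bsub>A\<^esub> a [^]\<^bsub>A\<^esub> (i + j)"
      using b(1) c(1) bc cc a by (simp add: A.int_pow_mult A.m_ac)
    moreover have "y \<otimes>\<^bsub>D\<^esub> z = (y' \<otimes>\<^bsub>D\<^esub> z') \<otimes>\<^bsub>D\<^esub> x [^]\<^bsub>D\<^esub> (i + j)"
      using b(2) c(2) bc cc x by (simp add: D.int_pow_mult D.m_ac)
    ultimately show "(b \<otimes>\<^bsub>A\<^esub> c, y \<otimes>\<^bsub>D\<^esub> z) \<in> ?S'"
      using S'I[OF SD(4)[OF b(3) c(3)], of "i + j"] by simp
  next
    fix y assume "(\<one>\<^bsub>A\<^esub>, y) \<in> ?S'"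
    then obtain b y' and i :: int where b: "\<one>\<^bsub>A\<^esub> = b \<otimes>\<^bsub>A\<^esub> a [^]\<^bsub>A\<^esub> i" "y = y' \<otimes>\<^bsub>D\<^esub> x [^]\<^bsub>D\<^esub> i" "(b, y') \<in> S" by blast
    note bc = SD(1,2)[OF b(3)]
    have "a [^]\<^bsub>A\<^esub> i = inv\<^bsub>A\<^esub> b"
      using b(1) bc a by (metis A.inv_equality A.int_pow_closed A.m_comm A.inv_closed)
    then have "x [^]\<^bsub>D\<^esub> i = inv\<^bsub>D\<^esub> y'" using consistent SD(5)[OF b(3)] by metis
    then show "y = \<one>\<^bsub>D\<^esub>" using b(2) bc by simp
  qed
qed

text \<open>If some positive power of \<open>a\<close> lies in the domain, take the least exponent
  \<open>n\<close> and an \<open>n\<close>-th root of the value there; by division with remainder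
  every power of \<open>a\<close> in the domain is a power of this one. Otherwise every value is
  consistent, and the neutral element is taken.\<close>

lemma partial_hom_extend:
  assumes S: "partial_hom A D S" and D: "divisible_group D" and a: "a \<in> carrier A"
  shows "\<exists>S'. partial_hom A D S' \<and> S \<subseteq> S' \<and> a \<in> Domain S'"
proof -
  note SD = partial_homD[OF S]
  obtain x where x: "x \<in> carrier D" "\<And>i::int. \<And>y. (a [^]\<^bsub>A\<^esub> i, y) \<in> S \<Longrightarrow> x [^]\<^bsub>D\<^esub> i = y"
  proof (cases "\<exists>n>0. a [^]\<^bsub>A\<^esub> (n::nat) \<in> Domain S")
    case True
    define n where "n = (LEAST n::nat. n > 0 \<and> a [^]\<^bsub>A\<^esub> n \<in> Domain S)"
    have n: "n > 0" "a [^]\<^bsub>A\<^esub> n \<in> Domain S"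
      using LeastI_ex[OF True] by (auto simp: n_def)
    have least: "\<not> (m > 0 \<and> a [^]\<^bsub>A\<^esub> m \<in> Domain S)" if "m < n" for m :: nat
      using that unfolding n_def by (rule not_less_Least)
    obtain y\<^sub>0 where y0: "(a [^]\<^bsub>A\<^esub> n, y\<^sub>0) \<in> S" using n(2) by blast
    obtain x where x: "x \<in> carrier D" "x [^]\<^bsub>D\<^esub> n = y\<^sub>0"
      using D SD(2)[OF y0] n(1) unfolding divisible_group_def by blast
    have "x [^]\<^bsub>D\<^esub> i = y" if y: "(a [^]\<^bsub>A\<^esub> i, y) \<in> S" for i :: int and y
    proof -
      let ?q = "i div int n" and ?r = "nat (i mod int n)"
      have r: "int ?r = i mod int n" "?r < n" using n(1) by (auto simp: nat_less_iff)
      have pw: "((a [^]\<^bsub>A\<^esub> n) [^]\<^bsub>A\<^esub> k, y\<^sub>0 [^]\<^bsub>D\<^esub> k) \<in> S" for k :: int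
        by (rule partial_hom_pow[OF S y0])
      have an: "(a [^]\<^bsub>A\<^esub> n) [^]\<^bsub>A\<^esub> k = a [^]\<^bsub>A\<^esub> (int n * k)" for k :: int
        using a by (simp add: A.int_pow_pow flip: int_pow_int)
      have "a [^]\<^bsub>A\<^esub> ?r = a [^]\<^bsub>A\<^esub> i \<otimes>\<^bsub>A\<^esub> (a [^]\<^bsub>A\<^esub> n) [^]\<^bsub>A\<^esub> (- ?q)"
      proof -
        have "a [^]\<^bsub>A\<^esub> ?r = a [^]\<^bsub>A\<^esub> (i + int n * (- ?q))"
          using r(1) by (simp add: minus_mult_div_eq_mod flip: int_pow_int)
        then show ?thesis using a by (simp only: an A.int_pow_mult)
      qed
      then have "a [^]\<^bsub>A\<^esub> ?r \<in> Domain S"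
        using SD(4)[OF y pw[of "- ?q"]] by auto
      then have "?r = 0" using least[OF r(2)] by simp
      then have "int n dvd i" using r(1) by (simp add: mod_eq_0_iff_dvd)
      then obtain k where i: "i = int n * k" by blast
      have "(a [^]\<^bsub>A\<^esub> i, y\<^sub>0 [^]\<^bsub>D\<^esub> k) \<in> S" using pw[of k] unfolding an i .
      then have "y = y\<^sub>0 [^]\<^bsub>D\<^esub> k" by (rule partial_hom_functional[OF S y])
      also have "\<dots> = x [^]\<^bsub>D\<^esub> i"
        using x(1) by (simp add: i D.int_pow_pow flip: x(2) int_pow_int)
      finally show ?thesis ..
    qed
    then show ?thesis using x(1) that by blast
  next
    case False
    have "\<one>\<^bsub>D\<^esub> [^]\<^bsub>D\<^esub> i = y" if y: "(a [^]\<^bsub>A\<^esub> i, y) \<in> S" for i :: int and y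
    proof -
      have "i = 0"
      proof (rule ccontr)
        assume "i \<noteq> 0"
        have "(a [^]\<^bsub>A\<^esub> (- i), inv\<^bsub>D\<^esub> y) \<in> S" using SD(5)[OF y] a by (simp add: A.int_pow_neg)
        then have "a [^]\<^bsub>A\<^esub> \<bar>i\<bar> \<in> Domain S" using y by (cases "i < 0") auto
        then have "a [^]\<^bsub>A\<^esub> (nat \<bar>i\<bar>) \<in> Domain S" by (simp flip: int_pow_int)
        moreover have "nat \<bar>i\<bar> > 0" using \<open>i \<noteq> 0\<close> by simp
        ultimately show False using False by blast
      qed
      then show ?thesis using y SD(6) by simp
    qed
    then show ?thesis by (rule that[OF D.one_closed])
  qed
  from partial_hom_adjoin[OF S a x] show ?thesis by blast
qed

text \<open>Finite generation takes the place of Zorn's lemma: finitely many one-element extensions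
  put all generators into the domain, which is a subgroup.\<close>

theorem partial_hom_total:
  assumes S: "partial_hom A D S" and D: "divisible_group D" and fg: "finitely_generated_group A"
  shows "\<exists>F\<in>hom A D. \<forall>(a, x)\<in>S. F a = x"
proof -
 have ext: "\<exists>S'. partial_hom A D S' \<and> S \<subseteq> S' \<and> B \<subseteq> Domain S'" if "finite B" "B \<subseteq> carrier A" for B
    using that
  proof (induction rule: finite_induct)
    case empty
    then show ?case using S by blast
  next
    case (insert b B)
    then obtain S\<^sub>1 where S1: "partial_hom A D S\<^sub>1" "S \<subseteq> S\<^sub>1" "B \<subseteq> Domain S\<^sub>1" by auto
    from partial_hom_extend[OF S1(1) D, of b] obtain S\<^sub>2
      where "partial_hom A D S\<^sub>2" "S\<^sub>1 \<subseteq> S\<^sub>2" "b \<in> Domain S\<^sub>2" using insert.prems by auto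
    then show ?case using S1 by (intro exI[of _ S\<^sub>2]) blast
  qed
  obtain B where B: "finite B" "B \<subseteq> carrier A" "generate A B = carrier A"
    using fg by (auto simp: finitely_generated_group_def)
  obtain M where M: "partial_hom A D M" "S \<subseteq> M" "B \<subseteq> Domain M"
    using ext[OF B(1,2)] by blast
  note MD = partial_homD[OF M(1)]
  have "subgroup (Domain M) A"
    by (rule A.subgroupI) (use MD in blast)+
  then have full: "Domain M = carrier A"
    using B(3) M(3) A.generate_subgroup_incl MD(1) by blast
  define F where "F = (\<lambda>a. THE x. (a, x) \<in> M)"
  have F_eq: "F a = x" if "(a, x) \<in> M" for a x
    unfolding F_def using that partial_hom_functional[OF M(1)] by blast
  have F: "(a, F a) \<in> M" if "a \<in> carrier A" for a
    using that full F_eq by (metis DomainE)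
  have "F \<in> hom A D"
    by (rule homI) (simp_all add: MD(2)[OF F] F_eq[OF MD(4)[OF F F]])
  then show ?thesis using F_eq M(2) by blast
qed

end

section \<open>Two divisible targets: roots of unity and the rationals\<close>

definition root_of_unity_group :: "complex monoid" where
  "root_of_unity_group = \<lparr>carrier = {z. \<exists>n>0. z ^ n = 1}, monoid.mult = (*), monoid.one = 1\<rparr>"

definition rat_group :: "rat monoid" where
  "rat_group = \<lparr>carrier = UNIV, monoid.mult = (+), monoid.one = 0\<rparr>"

lemma root_of_unity_group_simps [simp]:
  "x \<otimes>\<^bsub>root_of_unity_group\<^esub> y = x * y" "\<one>\<^bsub>root_of_unity_group\<^esub> = 1"
  by (simp_all add: root_of_unity_group_def)

lemma rat_group_simps [simp]:
  "carrier rat_group = UNIV" "x \<otimes>\<^bsub>rat_group\<^esub> y = x + y" "\<one>\<^bsub>rat_group\<^esub> = 0"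
  by (simp_all add: rat_group_def)

lemma root_of_unityI: "n > 0 \<Longrightarrow> z ^ n = 1 \<Longrightarrow> z \<in> carrier root_of_unity_group"
  by (auto simp: root_of_unity_group_def)

lemma comm_group_roots: "comm_group root_of_unity_group"
proof (rule comm_groupI)
  fix x y assume "x \<in> carrier root_of_unity_group" "y \<in> carrier root_of_unity_group"
  then obtain m n :: nat where "m > 0" "x ^ m = 1" "n > 0" "y ^ n = 1"
    by (auto simp: root_of_unity_group_def)
  then have "m * n > 0" "(x * y) ^ (m * n) = 1"
    by (simp_all add: power_mult_distrib power_mult) (metis mult.commute power_mult power_one)
  then show "x \<otimes>\<^bsub>root_of_unity_group\<^esub> y \<in> carrier root_of_unity_group"
    unfolding root_of_unity_group_simps by (rule root_of_unityI)
next
  fix x assume "x \<in> carrier root_of_unity_group"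
  then obtain m :: nat where m: "m > 0" "x ^ m = 1" by (auto simp: root_of_unity_group_def)
  then have "inverse x ^ m = 1" "x \<noteq> 0" by (auto simp: power_inverse zero_power)
  then show "\<exists>y\<in>carrier root_of_unity_group. y \<otimes>\<^bsub>root_of_unity_group\<^esub> x = \<one>\<^bsub>root_of_unity_group\<^esub>"
    using m by (intro bexI[of _ "inverse x"] root_of_unityI[of m]) auto
qed (auto simp: root_of_unity_group_def)

lemma roots_nat_pow: "x [^]\<^bsub>root_of_unity_group\<^esub> (n::nat) = x ^ n"
  by (induction n) (simp_all add: mult.commute)

lemma divisible_roots: "divisible_group root_of_unity_group"
  unfolding divisible_group_def
proof (intro conjI ballI allI impI comm_group_roots)
  fix x and n :: nat assume x: "x \<in> carrier root_of_unity_group" and n: "n > 0"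
  obtain m :: nat where m: "m > 0" "x ^ m = 1" using x by (auto simp: root_of_unity_group_def)
  then have "x \<noteq> 0" by (auto simp: zero_power)
  then have "card {w. w ^ n = x} = n" using n by (rule card_nth_roots)
  then have "{w. w ^ n = x} \<noteq> {}" using n by (metis card.empty less_irrefl)
  then obtain w where w: "w ^ n = x" by blast
  then have "n * m > 0" "w ^ (n * m) = 1" using m n by (simp_all add: power_mult)
  then have "w \<in> carrier root_of_unity_group" by (rule root_of_unityI)
  then show "\<exists>y\<in>carrier root_of_unity_group. y [^]\<^bsub>root_of_unity_group\<^esub> n = x"
    using w roots_nat_pow by auto
qed

lemma comm_group_rat: "comm_group rat_group"
  by (rule comm_groupI) (auto intro: exI[of _ "- x" for x])

lemma rat_nat_pow: "x [^]\<^bsub>rat_group\<^esub> (n::nat) = of_nat n * x"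
  by (induction n) (simp_all add: algebra_simps)

lemma rat_inv: "inv\<^bsub>rat_group\<^esub> x = - x"
proof -
  interpret comm_group rat_group by (rule comm_group_rat)
  show ?thesis by (rule inv_equality) simp_all
qed

lemma rat_int_pow: "x [^]\<^bsub>rat_group\<^esub> (i::int) = of_int i * x"
proof -
  interpret comm_group rat_group by (rule comm_group_rat)
  show ?thesis
    by (cases i) (simp_all only: int_pow_int int_pow_neg_int rat_nat_pow rat_inv rat_group_simps UNIV_I of_int_of_nat_eq of_int_minus minus_mult_left)
qed

lemma divisible_rat: "divisible_group rat_group"
  unfolding divisible_group_def
proof (intro conjI ballI allI impI comm_group_rat)
  fix x :: rat and n :: nat assume "n > 0"
  then show "\<exists>y\<in>carrier rat_group. y [^]\<^bsub>rat_group\<^esub> n = x"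
    by (intro bexI[of _ "x / of_nat n"]) (simp_all add: rat_nat_pow)
qed

text \<open>Start on the trivial subgroup and adjoin \<open>a\<close> with value 1, which is
  consistent because no nonzero power of \<open>a\<close> is trivial.\<close>

lemma (in comm_group) hom_rat:
  assumes fg: "finitely_generated_group G" and a: "a \<in> carrier G" "\<And>i::int. a [^] i = \<one> \<Longrightarrow> i = 0"
  shows "\<exists>h\<in>hom G rat_group. h a = 1"
proof -
  interpret D: comm_group rat_group by (rule comm_group_rat)
  interpret comm_group_pair G rat_group ..
  have "partial_hom G rat_group {(\<one>, \<one>\<^bsub>rat_group\<^esub>)}"
    by (rule partial_homI) (auto simp: rat_inv)
  from partial_hom_adjoin[OF this a(1), of 1] partial_hom_total[OF _ divisible_rat fg]
  obtain S where S: "partial_hom G rat_group S" "(a, 1) \<in> S"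
    using a(2) by (fastforce simp: rat_int_pow)
  then show ?thesis using partial_hom_total[OF S(1) divisible_rat fg] by fastforce
qed

text \<open>Start with the value 1 on \<open>H\<close> and adjoin \<open>a\<close> with a root of
  unity \<open>\<zeta>\<close> other than 1 whose order suits the order of \<open>a\<close> modulo
  \<open>H\<close>.\<close>

lemma (in comm_group) hom_separating:
  assumes fg: "finitely_generated_group G" and H: "subgroup H G" and a: "a \<in> carrier G" "a \<notin> H"
  shows "\<exists>h\<in>hom G root_of_unity_group. (\<forall>b\<in>H. h b = 1) \<and> h a \<noteq> 1"
proof -
  let ?D = root_of_unity_group
  interpret D: comm_group ?D by (rule comm_group_roots)
  interpret comm_group_pair G ?D ..
  have inv1: "inv\<^bsub>?D\<^esub> 1 = 1" using D.inv_one by simp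
  have one: "1 \<in> carrier ?D" using D.one_closed by simp
  have H1: "partial_hom G ?D (H \<times> {1})"
    using H inv1 one subgroup.mem_carrier[OF H]
    by (intro partial_homI) (auto simp: subgroup.one_closed subgroup.m_closed subgroup.m_inv_closed)
  obtain \<zeta> where \<zeta>: "\<zeta> \<in> carrier ?D" "\<zeta> \<noteq> 1" "\<And>i::int. a [^] i \<in> H \<Longrightarrow> \<zeta> [^]\<^bsub>?D\<^esub> i = 1"
  proof (cases "\<exists>n>0. a [^] (n::nat) \<in> H")
    case True
    define n where "n = (LEAST n::nat. n > 0 \<and> a [^] n \<in> H)"
    have n: "n > 0" "a [^] n \<in> H"
      using LeastI_ex[OF True] by (auto simp: n_def)
    have least: "\<not> (m > 0 \<and> a [^] m \<in> H)" if "m < n" for m :: nat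
      using that unfolding n_def by (rule not_less_Least)
    \<comment> \<open>\<open>n\<close> is the order of \<open>a\<close> modulo \<open>H\<close>. It
      exceeds 1 because \<open>a\<close> is not in \<open>H\<close>, so there is an
      \<open>n\<close>-th root of unity other than 1.\<close>
    have "n \<noteq> 1" using n(2) a by (metis nat_pow_eone)
    then have "card {w::complex. w ^ n = 1} > 1" using n(1) card_nth_roots[of 1 n] by simp
    then have "\<not> {w::complex. w ^ n = 1} \<subseteq> {1}"
      by (metis card.empty card_mono finite.emptyI finite_insert is_singletonI is_singleton_altdef leD)
    then obtain \<zeta> :: complex where \<zeta>: "\<zeta> ^ n = 1" "\<zeta> \<noteq> 1" by blast
    have \<zeta>D: "\<zeta> \<in> carrier ?D" using n(1) \<zeta>(1) by (rule root_of_unityI)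
    have "\<zeta> [^]\<^bsub>?D\<^esub> i = 1" if i: "a [^] i \<in> H" for i :: int
    proof -
      let ?q = "i div int n" and ?r = "nat (i mod int n)"
      have r: "int ?r = i mod int n" "?r < n" using n(1) by (auto simp: nat_less_iff)
      have an: "(a [^] n) [^] k = a [^] (int n * k)" for k :: int
        using a by (simp add: int_pow_pow flip: int_pow_int)
      have "a [^] ?r = a [^] (i + int n * (- ?q))"
        using r(1) by (simp add: minus_mult_div_eq_mod flip: int_pow_int)
      also have "\<dots> = a [^] i \<otimes> (a [^] n) [^] (- ?q)" using a by (simp only: an int_pow_mult)
      finally have "a [^] ?r \<in> H"
        using i n(2) H subgroup_int_pow_closed[OF H] by (simp add: subgroup.m_closed)
      then have "?r = 0" using least[OF r(2)] by simp
      then have "int n dvd i" using r(1) by (simp add: mod_eq_0_iff_dvd)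
      then obtain k where i: "i = int n * k" by blast
      have "\<zeta> [^]\<^bsub>?D\<^esub> i = (\<zeta> [^]\<^bsub>?D\<^esub> n) [^]\<^bsub>?D\<^esub> k"
        using \<zeta>D by (simp add: i D.int_pow_pow flip: int_pow_int)
      also have "\<dots> = 1" using \<zeta>(1) D.int_pow_one by (simp add: roots_nat_pow)
      finally show ?thesis .
    qed
    then show ?thesis using that \<zeta>(2) \<zeta>D by blast
  next
    case False
    \<comment> \<open>If \<open>a\<close> has infinite order modulo \<open>H\<close>, any value is
      consistent, and -1 is a nontrivial one.\<close>
    have m1: "- 1 \<in> carrier ?D" by (rule root_of_unityI[of 2]) simp_all
    have "i = 0" if i: "a [^] i \<in> H" for i :: int
    proof (rule ccontr)
      assume "i \<noteq> 0"
      have "a [^] (- i) \<in> H" using i a H by (simp add: int_pow_neg subgroup.m_inv_closed)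
      then have "a [^] \<bar>i\<bar> \<in> H" using i by (cases "i < 0") auto
      then have "a [^] (nat \<bar>i\<bar>) \<in> H" by (simp flip: int_pow_int)
      moreover have "nat \<bar>i\<bar> > 0" using \<open>i \<noteq> 0\<close> by simp
      ultimately show False using False by blast
    qed
    then show ?thesis using that[of "- 1"] m1 by fastforce
  qed
  have "\<And>i::int. \<And>y. (a [^] i, y) \<in> H \<times> {1} \<Longrightarrow> \<zeta> [^]\<^bsub>?D\<^esub> i = y" using \<zeta>(3) by auto
  note adj = partial_hom_adjoin[OF H1 a(1) \<zeta>(1) this]
  obtain S where S: "partial_hom G ?D S" "H \<times> {1} \<subseteq> S" "(a, \<zeta>) \<in> S"
    by (rule that[OF adj])
  obtain h where h: "h \<in> hom G ?D" "\<forall>(b, y)\<in>S. h b = y"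
    using partial_hom_total[OF S(1) divisible_roots fg] by (rule bexE)
  have "h b = 1" if "b \<in> H" for b
    using bspec[OF h(2), of "(b, 1)"] that S(2) by auto
  moreover have "h a = \<zeta>" using bspec[OF h(2) S(3)] by simp
  ultimately show ?thesis using h(1) \<zeta>(2) by blast
qed

section \<open>Families of homomorphisms compatible along a tree\<close>

text \<open>The affine maps of the rational line: \<open>(a, b)\<close> stands for the map taking x
  to a x + b.\<close>

definition affine_group :: "(rat \<times> rat) monoid" where
  "affine_group = \<lparr>carrier = {p. fst p \<noteq> 0},
     monoid.mult = (\<lambda>p q. (fst p * fst q, fst p * snd q + snd p)), monoid.one = (1, 0)\<rparr>"

lemma affine_group_simps [simp]:
  "(a, b) \<otimes>\<^bsub>affine_group\<^esub> (a', b') = (a * a', a * b' + b)"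
  "\<one>\<^bsub>affine_group\<^esub> = (1, 0)" "(a, b) \<in> carrier affine_group \<longleftrightarrow> a \<noteq> 0"
  by (simp_all add: affine_group_def)

lemma group_affine: "group affine_group"
proof (rule groupI)
  fix p assume p: "p \<in> carrier affine_group"
  obtain a b where ab: "p = (a, b)" by (cases p)
  then have "(1 / a, - b / a) \<in> carrier affine_group" "(1 / a, - b / a) \<otimes>\<^bsub>affine_group\<^esub> p = \<one>\<^bsub>affine_group\<^esub>"
    using p by auto
  then show "\<exists>q\<in>carrier affine_group. q \<otimes>\<^bsub>affine_group\<^esub> p = \<one>\<^bsub>affine_group\<^esub>" by blast
qed (auto simp: affine_group_def algebra_simps)

context graph_of_groups_presentation
begin

text \<open>A homomorphism out of the tree product of the vertex groups along \<open>T\<close>,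
  given by its restrictions to them. The tree is a parameter because it will be the one missing the
  cyclic edge, which may differ from \<open>T\<^sub>0\<close>.\<close>

definition family :: "('v, 'e) pregraph \<Rightarrow> 'd monoid \<Rightarrow> ('v \<Rightarrow> 'a \<Rightarrow> 'd) \<Rightarrow> bool" where
  "family T D f \<longleftrightarrow> (\<forall>v\<in>verts \<Gamma>. f v \<in> hom (VG v) D) \<and>
     (\<forall>e\<in>edges T. \<forall>z\<in>carrier (EG e).
        f (\<alpha>_of \<Gamma> e) (\<phi> e z) = f (\<omega>_of \<Gamma> e) (\<phi> (einv \<Gamma> e) z))"

lemma maximal_tree_edges:
  assumes T: "maximal_tree T \<Gamma>" and e: "e \<in> edges T"
  shows "e \<in> edges \<Gamma>" "\<alpha>_of T e = \<alpha>_of \<Gamma> e" "\<omega>_of T e = \<omega>_of \<Gamma> e" "einv T e = einv \<Gamma> e"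
    "einv \<Gamma> e \<in> edges T"
proof -
  have sub: "subgraph_of T \<Gamma>" using T by (simp add: maximal_tree_def)
  show "e \<in> edges \<Gamma>" "\<alpha>_of T e = \<alpha>_of \<Gamma> e" "\<omega>_of T e = \<omega>_of \<Gamma> e" and inv: "einv T e = einv \<Gamma> e"
    using sub e by (auto simp: subgraph_of_def)
  have "serre_graph T" using sub by (simp add: subgraph_of_def)
  then show "einv \<Gamma> e \<in> edges T" using e inv serre_graph.einv_closed by metis
qed

lemma maximal_tree_choice:
  fixes A :: "'v \<Rightarrow> 'd set" and R :: "'e \<Rightarrow> 'd \<Rightarrow> 'd \<Rightarrow> bool"
  assumes T: "maximal_tree T \<Gamma>" and v: "v \<in> verts \<Gamma>" and start: "x \<in> A v"
    and step: "\<And>f x. f \<in> edges T \<Longrightarrow> x \<in> A (\<alpha>_of \<Gamma> f) \<Longrightarrow> \<exists>y\<in>A (\<omega>_of \<Gamma> f). R f x y"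
    and sym: "\<And>f x y. f \<in> edges T \<Longrightarrow> x \<in> A (\<alpha>_of \<Gamma> f) \<Longrightarrow> y \<in> A (\<omega>_of \<Gamma> f) \<Longrightarrow>
      R f x y \<Longrightarrow> R (einv \<Gamma> f) y x"
  shows "\<exists>F. (\<forall>u\<in>verts \<Gamma>. F u \<in> A u) \<and> F v = x \<and>
    (\<forall>f\<in>edges T. R f (F (\<alpha>_of \<Gamma> f)) (F (\<omega>_of \<Gamma> f)))"
proof -
  have VT: "verts T = verts \<Gamma>" by (rule maximal_tree_spanning[OF serre connected T])
  interpret T: rooted_tree T v
    using T v VT by unfold_locales (auto simp: maximal_tree_def)
  note TE = maximal_tree_edges[OF T]
  have "\<exists>F. (\<forall>u\<in>verts T. F u \<in> A u) \<and> F v = x \<and> (\<forall>f\<in>edges T. R f (F (\<alpha>_of T f)) (F (\<omega>_of T f)))"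
  proof (rule T.tree_choice[where A = A and R = R, OF start])
    fix f x assume "f \<in> edges T" "x \<in> A (\<alpha>_of T f)"
    then show "\<exists>y\<in>A (\<omega>_of T f). R f x y" using step TE by simp
  next
    fix f x y assume "f \<in> edges T" "x \<in> A (\<alpha>_of T f)" "y \<in> A (\<omega>_of T f)" "R f x y"
    then show "R (einv T f) y x" using sym TE by simp
  qed
  then obtain F where F: "\<forall>u\<in>verts T. F u \<in> A u" "F v = x"
    "\<forall>f\<in>edges T. R f (F (\<alpha>_of T f)) (F (\<omega>_of T f))" by (elim exE conjE)
  have "R f (F (\<alpha>_of \<Gamma> f)) (F (\<omega>_of \<Gamma> f))" if "f \<in> edges T" for f
    using bspec[OF F(3) that] TE[OF that] by simp
  then show ?thesis using F(1,2) VT by auto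
qed

lemma edge_hom_pair:
  assumes "e \<in> edges \<Gamma>"
  shows "\<phi> e \<in> hom (EG e) (VG (\<alpha>_of \<Gamma> e))" "\<phi> (einv \<Gamma> e) \<in> hom (EG e) (VG (\<omega>_of \<Gamma> e))"
    "inj_on (\<phi> e) (carrier (EG e))" "inj_on (\<phi> (einv \<Gamma> e)) (carrier (EG e))"
    "\<phi> e \<one>\<^bsub>EG e\<^esub> = \<one>\<^bsub>VG (\<alpha>_of \<Gamma> e)\<^esub>" "\<phi> (einv \<Gamma> e) \<one>\<^bsub>EG e\<^esub> = \<one>\<^bsub>VG (\<omega>_of \<Gamma> e)\<^esub>"
proof -
  show 1: "\<phi> e \<in> hom (EG e) (VG (\<alpha>_of \<Gamma> e))" "inj_on (\<phi> e) (carrier (EG e))"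
    using \<phi>_hom \<phi>_inj assms by auto
  show 2: "\<phi> (einv \<Gamma> e) \<in> hom (EG e) (VG (\<omega>_of \<Gamma> e))" "inj_on (\<phi> (einv \<Gamma> e)) (carrier (EG e))"
    using \<phi>_hom[OF einv_closed[OF assms]] \<phi>_inj[OF einv_closed[OF assms]] assms
    by (simp_all add: edge_group_einv \<alpha>_einv[OF serre])
  show "\<phi> e \<one>\<^bsub>EG e\<^esub> = \<one>\<^bsub>VG (\<alpha>_of \<Gamma> e)\<^esub>" "\<phi> (einv \<Gamma> e) \<one>\<^bsub>EG e\<^esub> = \<one>\<^bsub>VG (\<omega>_of \<Gamma> e)\<^esub>"
    using hom_one[OF 1(1)] hom_one[OF 2(1)] edge_group vertex_group \<alpha>_closed \<omega>_closed assms by auto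
qed

lemma edge_hom_inv:
  assumes "e \<in> edges \<Gamma>" "z \<in> carrier (EG e)"
  shows "\<phi> e (inv\<^bsub>EG e\<^esub> z) = inv\<^bsub>VG (\<alpha>_of \<Gamma> e)\<^esub> \<phi> e z"
    "\<phi> (einv \<Gamma> e) (inv\<^bsub>EG e\<^esub> z) = inv\<^bsub>VG (\<omega>_of \<Gamma> e)\<^esub> \<phi> (einv \<Gamma> e) z"
  using group_hom.hom_inv[of "EG e" "VG (\<alpha>_of \<Gamma> e)" "\<phi> e" z] group_hom.hom_inv[of "EG e" "VG (\<omega>_of \<Gamma> e)" "\<phi> (einv \<Gamma> e)" z]
    edge_hom_pair[OF assms(1)] edge_group vertex_group \<alpha>_closed \<omega>_closed assms
  by (simp_all add: group_hom_def group_hom_axioms_def)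

end

context abelian_graph_of_groups
begin

text \<open>Spread \<open>h\<close> along the tree. Crossing an edge forces the values at the far
  end on the image of the edge group and on \<open>C\<close>. By \<open>C_edge\<close> the two
  prescriptions agree where they overlap, so they form a partial homomorphism, which extends by
  divisibility of \<open>D\<close>.\<close>

lemma family_extension:
  fixes D :: "'d monoid"
  assumes T: "maximal_tree T \<Gamma>" and D: "divisible_group D"
    and C: "\<And>v. v \<in> verts \<Gamma> \<Longrightarrow> partial_hom (VG v) D (C v)"
    and C_edge: "\<And>e z y. e \<in> edges T \<Longrightarrow> z \<in> carrier (EG e) \<Longrightarrow>
      (\<phi> e z, y) \<in> C (\<alpha>_of \<Gamma> e) \<longleftrightarrow> (\<phi> (einv \<Gamma> e) z, y) \<in> C (\<omega>_of \<Gamma> e)"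
    and v: "v \<in> verts \<Gamma>" and h: "h \<in> hom (VG v) D" "\<And>b y. (b, y) \<in> C v \<Longrightarrow> h b = y"
  obtains f where "family T D f" "f v = h"
    "\<And>u b y. u \<in> verts \<Gamma> \<Longrightarrow> (b, y) \<in> C u \<Longrightarrow> f u b = y"
proof -
  interpret D: comm_group D using D by (simp add: divisible_group_def)
  note TE = maximal_tree_edges[OF T]
  define A where "A = (\<lambda>u. {F \<in> hom (VG u) D. \<forall>b y. (b, y) \<in> C u \<longrightarrow> F b = y})"
  define R :: "'e \<Rightarrow> ('a \<Rightarrow> 'd) \<Rightarrow> ('a \<Rightarrow> 'd) \<Rightarrow> bool" where "R = (\<lambda>e F F'. \<forall>z\<in>carrier (EG e). F (\<phi> e z) = F' (\<phi> (einv \<Gamma> e) z))"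
  have "h \<in> A v" using h by (simp add: A_def)
  have "\<exists>f. (\<forall>u\<in>verts \<Gamma>. f u \<in> A u) \<and> f v = h \<and>
    (\<forall>e\<in>edges T. R e (f (\<alpha>_of \<Gamma> e)) (f (\<omega>_of \<Gamma> e)))"
  proof (rule maximal_tree_choice[where A = A and R = R, OF T v \<open>h \<in> A v\<close>])
    fix e F assume 1: "e \<in> edges T" "F \<in> A (\<alpha>_of \<Gamma> e)"
    let ?a = "\<alpha>_of \<Gamma> e" and ?w = "\<omega>_of \<Gamma> e" and ?\<phi> = "\<phi> (einv \<Gamma> e)"
    have e: "e \<in> edges \<Gamma>" using TE 1 by blast
    have V: "?a \<in> verts \<Gamma>" "?w \<in> verts \<Gamma>" using e \<alpha>_closed \<omega>_closed by auto
    interpret H: group "EG e" using e by (rule edge_group)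
    interpret Ga: comm_group "VG ?a" using V(1) by (rule vertex_comm)
    interpret Gw: comm_group "VG ?w" using V(2) by (rule vertex_comm)
    interpret pair: comm_group_pair "VG ?w" D ..
    note CD = partial_homD[OF C[OF V(2)]] and eh = edge_hom_pair[OF e]
    have F: "F \<in> hom (VG ?a) D" "\<And>b y. (b, y) \<in> C ?a \<Longrightarrow> F b = y" using 1 by (auto simp: A_def)
    have cl: "\<phi> e z \<in> carrier (VG ?a)" "?\<phi> z \<in> carrier (VG ?w)" "F (\<phi> e z) \<in> carrier D" if "z \<in> carrier (EG e)" for z
      using that \<phi>_closed \<phi>_einv_closed e F(1) by (auto simp: hom_def)
    have Fone: "F \<one>\<^bsub>VG ?a\<^esub> = \<one>\<^bsub>D\<^esub>" using hom_one[OF F(1) Ga.is_group D.is_group] .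
    have Fmult: "F (\<phi> e (z \<otimes>\<^bsub>EG e\<^esub> z')) = F (\<phi> e z) \<otimes>\<^bsub>D\<^esub> F (\<phi> e z')"
      and \<phi>mult: "?\<phi> (z \<otimes>\<^bsub>EG e\<^esub> z') = ?\<phi> z \<otimes>\<^bsub>VG ?w\<^esub> ?\<phi> z'"
      if "z \<in> carrier (EG e)" "z' \<in> carrier (EG e)" for z z'
      using that eh(1,2) F(1) cl by (simp_all add: hom_mult)
    have Finv: "F (\<phi> e (inv\<^bsub>EG e\<^esub> z)) = inv\<^bsub>D\<^esub> F (\<phi> e z)" if "z \<in> carrier (EG e)" for z
      using Fmult[of "inv\<^bsub>EG e\<^esub> z" z] that cl eh(5) Fone by (intro D.inv_equality[symmetric]) simp_all
    define S where "S = {(?\<phi> z \<otimes>\<^bsub>VG ?w\<^esub> b, F (\<phi> e z) \<otimes>\<^bsub>D\<^esub> y) |z b y. z \<in> carrier (EG e) \<and> (b, y) \<in> C ?w}"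
    have SI: "(?\<phi> z \<otimes>\<^bsub>VG ?w\<^esub> b, F (\<phi> e z) \<otimes>\<^bsub>D\<^esub> y) \<in> S" if "z \<in> carrier (EG e)" "(b, y) \<in> C ?w" for z b y
      using that unfolding S_def by blast
    have SE: "\<exists>z b' y'. z \<in> carrier (EG e) \<and> (b', y') \<in> C ?w \<and> b = ?\<phi> z \<otimes>\<^bsub>VG ?w\<^esub> b' \<and> y = F (\<phi> e z) \<otimes>\<^bsub>D\<^esub> y'"
      if "(b, y) \<in> S" for b y using that unfolding S_def by blast
    have "partial_hom (VG ?w) D S"
    proof (rule partial_homI)
      show "S \<subseteq> carrier (VG ?w) \<times> carrier D" using cl CD(1,2) unfolding S_def by auto
      show "(\<one>\<^bsub>VG ?w\<^esub>, \<one>\<^bsub>D\<^esub>) \<in> S" using SI[OF H.one_closed CD(3)] eh(5,6) Fone by simp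
      fix b y assume "(b, y) \<in> S"
      then obtain z b1 y1 where b: "z \<in> carrier (EG e)" "(b1, y1) \<in> C ?w" "b = ?\<phi> z \<otimes>\<^bsub>VG ?w\<^esub> b1" "y = F (\<phi> e z) \<otimes>\<^bsub>D\<^esub> y1"
        using SE by blast
      note bc = CD(1,2)[OF b(2)] cl[OF b(1)]
      have "(?\<phi> (inv\<^bsub>EG e\<^esub> z) \<otimes>\<^bsub>VG ?w\<^esub> inv\<^bsub>VG ?w\<^esub> b1, F (\<phi> e (inv\<^bsub>EG e\<^esub> z)) \<otimes>\<^bsub>D\<^esub> inv\<^bsub>D\<^esub> y1) \<in> S"
        using b by (intro SI CD(5)) simp_all
      then show "(inv\<^bsub>VG ?w\<^esub> b, inv\<^bsub>D\<^esub> y) \<in> S"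
        using b bc by (simp add: edge_hom_inv(2)[OF e] Finv Gw.inv_mult D.inv_mult)
      fix b' y' assume "(b', y') \<in> S"
      then obtain z' b2 y2 where b': "z' \<in> carrier (EG e)" "(b2, y2) \<in> C ?w" "b' = ?\<phi> z' \<otimes>\<^bsub>VG ?w\<^esub> b2" "y' = F (\<phi> e z') \<otimes>\<^bsub>D\<^esub> y2"
        using SE by blast
      note bc' = CD(1,2)[OF b'(2)] cl[OF b'(1)]
      have "(?\<phi> (z \<otimes>\<^bsub>EG e\<^esub> z') \<otimes>\<^bsub>VG ?w\<^esub> (b1 \<otimes>\<^bsub>VG ?w\<^esub> b2), F (\<phi> e (z \<otimes>\<^bsub>EG e\<^esub> z')) \<otimes>\<^bsub>D\<^esub> (y1 \<otimes>\<^bsub>D\<^esub> y2)) \<in> S"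
        using b b' by (intro SI CD(4)) simp_all
      then show "(b \<otimes>\<^bsub>VG ?w\<^esub> b', y \<otimes>\<^bsub>D\<^esub> y') \<in> S"
        using b b' bc bc' by (simp add: Fmult \<phi>mult Gw.m_ac D.m_ac)
    next
      fix y assume "(\<one>\<^bsub>VG ?w\<^esub>, y) \<in> S"
      then obtain z b1 y1 where b: "z \<in> carrier (EG e)" "(b1, y1) \<in> C ?w" "\<one>\<^bsub>VG ?w\<^esub> = ?\<phi> z \<otimes>\<^bsub>VG ?w\<^esub> b1" "y = F (\<phi> e z) \<otimes>\<^bsub>D\<^esub> y1"
        using SE by blast
      note bc = CD(1,2)[OF b(2)] cl[OF b(1)]
      \<comment> \<open>An overlap of the two prescriptions is an edge group element whose far image
        lies in the domain of \<open>C\<close>. \<open>C_edge\<close> carries it back to the near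
        end, where \<open>F\<close> already agrees with \<open>C\<close>.\<close>
      have "b1 = ?\<phi> (inv\<^bsub>EG e\<^esub> z)"
        using b(3) bc b(1) by (metis Gw.inv_equality Gw.inv_inv Gw.m_comm edge_hom_inv(2)[OF e])
      then have "(\<phi> e (inv\<^bsub>EG e\<^esub> z), y1) \<in> C ?a" using C_edge[of e "inv\<^bsub>EG e\<^esub> z"] 1(1) b by simp
      then have "y1 = inv\<^bsub>D\<^esub> F (\<phi> e z)" using F(2) Finv[OF b(1)] by metis
      then show "y = \<one>\<^bsub>D\<^esub>" using b(4) bc by simp
    qed
    from pair.partial_hom_total[OF this D vertex_fg[OF V(2)]]
    obtain F' where F': "F' \<in> hom (VG ?w) D" "\<forall>(b, y)\<in>S. F' b = y" by (rule bexE)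
    have "F' b = y" if "(b, y) \<in> C ?w" for b y
      using bspec[OF F'(2) SI[OF H.one_closed that]] CD(1,2)[OF that] eh(5,6) Fone by simp
    moreover have "F (\<phi> e z) = F' (?\<phi> z)" if "z \<in> carrier (EG e)" for z
      using bspec[OF F'(2) SI[OF that CD(3)]] cl[OF that] by simp
    ultimately show "\<exists>F'\<in>A ?w. R e F F'" using F'(1) by (intro bexI[of _ F']) (auto simp: A_def R_def)
  next
    fix e F F' assume "e \<in> edges T" "R e F F'"
    then show "R (einv \<Gamma> e) F' F" using TE(1)[of e] by (auto simp: R_def edge_group_einv einv_einv)
  qed
  then obtain f where f0: "\<forall>u\<in>verts \<Gamma>. f u \<in> A u" "f v = h"
    "\<forall>e\<in>edges T. R e (f (\<alpha>_of \<Gamma> e)) (f (\<omega>_of \<Gamma> e))" by (elim exE conjE)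
  note f = bspec[OF f0(1)] f0(2) bspec[OF f0(3)]
  show ?thesis
  proof (rule that[of f])
    show "family T D f"
      unfolding family_def using f(1,3) by (auto simp: A_def R_def)
    show "f v = h" by (rule f(2))
    show "f u b = y" if "u \<in> verts \<Gamma>" "(b, y) \<in> C u" for u b y
      using f(1)[OF that(1)] that(2) by (auto simp: A_def)
  qed
qed

text \<open>\<open>C u\<close> records which elements of \<open>G\<^sub>u\<close> become powers of \<open>d\<close> along the tree, together with
  the value that \<open>d \<mapsto> x\<close> forces on them; \<open>\<psi>\<close> witnesses the identification in any target.\<close>

lemma transported_powers:
  fixes D :: "'d monoid"
  assumes T: "maximal_tree T \<Gamma>" and D: "divisible_group D"
    and w: "w \<in> verts \<Gamma>" "d \<in> carrier (VG w)" "\<And>i::int. d [^]\<^bsub>VG w\<^esub> i = \<one>\<^bsub>VG w\<^esub> \<Longrightarrow> i = 0"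
    and x: "x \<in> carrier D"
    and \<psi>: "\<And>e z. e \<in> edges T \<Longrightarrow> z \<in> carrier (EG e) \<Longrightarrow>
      \<psi> (\<alpha>_of \<Gamma> e) (\<phi> e z) = \<psi> (\<omega>_of \<Gamma> e) (\<phi> (einv \<Gamma> e) z)"
  obtains C where "\<And>v. v \<in> verts \<Gamma> \<Longrightarrow> partial_hom (VG v) D (C v)"
    "\<And>e z y. e \<in> edges T \<Longrightarrow> z \<in> carrier (EG e) \<Longrightarrow>
      (\<phi> e z, y) \<in> C (\<alpha>_of \<Gamma> e) \<longleftrightarrow> (\<phi> (einv \<Gamma> e) z, y) \<in> C (\<omega>_of \<Gamma> e)"
    "(d, x) \<in> C w"
    "\<And>v b y. v \<in> verts \<Gamma> \<Longrightarrow> (b, y) \<in> C v \<Longrightarrow> \<exists>j::int. y = x [^]\<^bsub>D\<^esub> j \<and> \<psi> v b = \<psi> w (d [^]\<^bsub>VG w\<^esub> j)"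
proof -
  interpret D: comm_group D using D by (simp add: divisible_group_def)
  note TE = maximal_tree_edges[OF T]
  define A where "A = (\<lambda>u. {C. partial_hom (VG u) D C \<and>
    (\<forall>b y. (b, y) \<in> C \<longrightarrow> (\<exists>j::int. y = x [^]\<^bsub>D\<^esub> j \<and> \<psi> u b = \<psi> w (d [^]\<^bsub>VG w\<^esub> j)))})"
  define R :: "'e \<Rightarrow> ('a \<times> 'd) set \<Rightarrow> ('a \<times> 'd) set \<Rightarrow> bool" where "R = (\<lambda>e C C'. \<forall>z\<in>carrier (EG e). \<forall>y. (\<phi> e z, y) \<in> C \<longleftrightarrow> (\<phi> (einv \<Gamma> e) z, y) \<in> C')"
  \<comment> \<open>Single-valued because \<open>d\<close> has infinite order.\<close>
  define C\<^sub>0 where "C\<^sub>0 = range (\<lambda>i::int. (d [^]\<^bsub>VG w\<^esub> i, x [^]\<^bsub>D\<^esub> i))"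
  interpret Gw: comm_group "VG w" using w(1) by (rule vertex_comm)
  have C0: "partial_hom (VG w) D C\<^sub>0"
  proof (rule partial_homI)
    show "C\<^sub>0 \<subseteq> carrier (VG w) \<times> carrier D" using w x by (auto simp: C\<^sub>0_def)
    show "(\<one>\<^bsub>VG w\<^esub>, \<one>\<^bsub>D\<^esub>) \<in> C\<^sub>0" unfolding C\<^sub>0_def by (rule range_eqI[of _ _ 0]) simp
    fix b y assume "(b, y) \<in> C\<^sub>0"
    then obtain i :: int where i: "b = d [^]\<^bsub>VG w\<^esub> i" "y = x [^]\<^bsub>D\<^esub> i" by (auto simp: C\<^sub>0_def)
    show "(inv\<^bsub>VG w\<^esub> b, inv\<^bsub>D\<^esub> y) \<in> C\<^sub>0"
      unfolding C\<^sub>0_def using w(2) x i by (intro range_eqI[of _ _ "- i"]) (simp add: Gw.int_pow_neg D.int_pow_neg)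
    fix b' y' assume "(b', y') \<in> C\<^sub>0"
    then obtain j :: int where j: "b' = d [^]\<^bsub>VG w\<^esub> j" "y' = x [^]\<^bsub>D\<^esub> j" by (auto simp: C\<^sub>0_def)
    show "(b \<otimes>\<^bsub>VG w\<^esub> b', y \<otimes>\<^bsub>D\<^esub> y') \<in> C\<^sub>0"
      unfolding C\<^sub>0_def using w(2) x i j by (intro range_eqI[of _ _ "i + j"]) (simp add: Gw.int_pow_mult D.int_pow_mult)
  next
    fix y assume "(\<one>\<^bsub>VG w\<^esub>, y) \<in> C\<^sub>0"
    then obtain i :: int where i: "\<one>\<^bsub>VG w\<^esub> = d [^]\<^bsub>VG w\<^esub> i" "y = x [^]\<^bsub>D\<^esub> i" by (auto simp: C\<^sub>0_def)
    then have "i = 0" using w(3) by metis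
    then show "y = \<one>\<^bsub>D\<^esub>" using i by simp
  qed
  then have "C\<^sub>0 \<in> A w" unfolding A_def C\<^sub>0_def by blast
  have "\<exists>C. (\<forall>u\<in>verts \<Gamma>. C u \<in> A u) \<and> C w = C\<^sub>0 \<and>
    (\<forall>e\<in>edges T. R e (C (\<alpha>_of \<Gamma> e)) (C (\<omega>_of \<Gamma> e)))"
  proof (rule maximal_tree_choice[where A = A and R = R, OF T w(1) \<open>C\<^sub>0 \<in> A w\<close>])
    fix e B assume 1: "e \<in> edges T" "B \<in> A (\<alpha>_of \<Gamma> e)"
    let ?a = "\<alpha>_of \<Gamma> e" and ?w = "\<omega>_of \<Gamma> e" and ?\<phi> = "\<phi> (einv \<Gamma> e)"
    have e: "e \<in> edges \<Gamma>" using TE 1 by blast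
    interpret H: group "EG e" using e by (rule edge_group)
    note eh = edge_hom_pair[OF e]
    have B: "partial_hom (VG ?a) D B"
      "\<And>b y. (b, y) \<in> B \<Longrightarrow> \<exists>j::int. y = x [^]\<^bsub>D\<^esub> j \<and> \<psi> ?a b = \<psi> w (d [^]\<^bsub>VG w\<^esub> j)"
      using 1(2) by (auto simp: A_def)
    note BD = partial_homD[OF B(1)]
    \<comment> \<open>Exactly what passes through the edge group is kept, so that membership
      corresponds in both directions; the backward direction uses injectivity of the far edge
      map.\<close>
    define B' where "B' = {(?\<phi> z, y) |z y. z \<in> carrier (EG e) \<and> (\<phi> e z, y) \<in> B}"
    have B'I: "(?\<phi> z, y) \<in> B'" if "z \<in> carrier (EG e)" "(\<phi> e z, y) \<in> B" for z y
      using that unfolding B'_def by blast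
    have B'E: "\<exists>z. z \<in> carrier (EG e) \<and> b = ?\<phi> z \<and> (\<phi> e z, y) \<in> B" if "(b, y) \<in> B'" for b y
      using that unfolding B'_def by blast
    have "partial_hom (VG ?w) D B'"
    proof (rule partial_homI)
      show "B' \<subseteq> carrier (VG ?w) \<times> carrier D"
        unfolding B'_def using \<phi>_einv_closed[OF e] BD(2) by auto
      show "(\<one>\<^bsub>VG ?w\<^esub>, \<one>\<^bsub>D\<^esub>) \<in> B'" using B'I[OF H.one_closed] BD(3) eh(5,6) by simp
      fix b y assume "(b, y) \<in> B'"
      then obtain z where b: "z \<in> carrier (EG e)" "b = ?\<phi> z" "(\<phi> e z, y) \<in> B" using B'E by blast
      show "(inv\<^bsub>VG ?w\<^esub> b, inv\<^bsub>D\<^esub> y) \<in> B'"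
        using B'I[of "inv\<^bsub>EG e\<^esub> z"] BD(5)[OF b(3)] b(1,2) by (simp add: edge_hom_inv[OF e])
      fix b' y' assume "(b', y') \<in> B'"
      then obtain z' where b': "z' \<in> carrier (EG e)" "b' = ?\<phi> z'" "(\<phi> e z', y') \<in> B" using B'E by blast
      show "(b \<otimes>\<^bsub>VG ?w\<^esub> b', y \<otimes>\<^bsub>D\<^esub> y') \<in> B'"
        using B'I[of "z \<otimes>\<^bsub>EG e\<^esub> z'"] BD(4)[OF b(3) b'(3)] b(1,2) b'(1,2) eh(1,2) by (simp add: hom_mult)
    next
      fix y assume "(\<one>\<^bsub>VG ?w\<^esub>, y) \<in> B'"
      then obtain z where b: "z \<in> carrier (EG e)" "\<one>\<^bsub>VG ?w\<^esub> = ?\<phi> z" "(\<phi> e z, y) \<in> B" using B'E by blast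
      then have "z = \<one>\<^bsub>EG e\<^esub>" using eh(4,6) by (metis H.one_closed inj_onD)
      then show "y = \<one>\<^bsub>D\<^esub>" using b(3) eh(5) BD(6) by simp
    qed
    moreover have "\<exists>j::int. y = x [^]\<^bsub>D\<^esub> j \<and> \<psi> ?w b = \<psi> w (d [^]\<^bsub>VG w\<^esub> j)" if bB: "(b, y) \<in> B'" for b y
    proof -
      obtain z where b: "z \<in> carrier (EG e)" "b = ?\<phi> z" "(\<phi> e z, y) \<in> B" using B'E[OF bB] by blast
      then show ?thesis using B(2)[OF b(3)] \<psi>[OF 1(1) b(1)] by simp
    qed
    moreover have "R e B B'"
      unfolding R_def
    proof (intro ballI allI iffI)
      fix z y assume "z \<in> carrier (EG e)" "(?\<phi> z, y) \<in> B'"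
      then show "(\<phi> e z, y) \<in> B" using B'E eh(4) by (metis inj_onD)
    qed (rule B'I)
    ultimately show "\<exists>B'\<in>A ?w. R e B B'" by (intro bexI[of _ B']) (simp_all add: A_def)
  next
    fix e B B' assume "e \<in> edges T" "R e B B'"
    then show "R (einv \<Gamma> e) B' B" using TE(1)[of e] by (auto simp: R_def edge_group_einv einv_einv)
  qed
  then obtain C where c0: "\<forall>u\<in>verts \<Gamma>. C u \<in> A u" "C w = C\<^sub>0"
    "\<forall>e\<in>edges T. R e (C (\<alpha>_of \<Gamma> e)) (C (\<omega>_of \<Gamma> e))" by (elim exE conjE)
  note C = bspec[OF c0(1)] c0(2) bspec[OF c0(3)]
  show ?thesis
  proof (rule that[of C])
    show "partial_hom (VG v) D (C v)" if "v \<in> verts \<Gamma>" for v using C(1)[OF that] by (simp add: A_def)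
    show "(\<phi> e z, y) \<in> C (\<alpha>_of \<Gamma> e) \<longleftrightarrow> (\<phi> (einv \<Gamma> e) z, y) \<in> C (\<omega>_of \<Gamma> e)"
      if "e \<in> edges T" "z \<in> carrier (EG e)" for e z y
      using C(3)[OF that(1)] that(2) by (simp add: R_def)
    show "(d, x) \<in> C w" unfolding C(2) C\<^sub>0_def using w(2) x by (intro range_eqI[of _ _ 1]) simp
    show "\<exists>j::int. y = x [^]\<^bsub>D\<^esub> j \<and> \<psi> v b = \<psi> w (d [^]\<^bsub>VG w\<^esub> j)"
      if "v \<in> verts \<Gamma>" "(b, y) \<in> C v" for v b y
      using C(1)[OF that(1)] that(2) by (simp add: A_def)
  qed
qed

text \<open>The value \<open>x\<close> at \<open>d\<close> is first transported along the tree to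
  \<open>v\<close>. There \<open>c\<close> is adjoined with value \<open>y\<close>; this is
  consistent, since a power of \<open>c\<close> with a transported value is identified by
  \<open>\<psi>\<close> with a power of \<open>d\<close>. The resulting homomorphism at
  \<open>v\<close> is then spread along the tree in accordance with the transported values, hence
  takes \<open>d\<close> to \<open>x\<close>.\<close>

lemma two_point_extension:
  fixes D :: "'d monoid"
  assumes T: "maximal_tree T \<Gamma>" and D: "divisible_group D"
    and v: "v \<in> verts \<Gamma>" "c \<in> carrier (VG v)"
    and w: "w \<in> verts \<Gamma>" "d \<in> carrier (VG w)" "\<And>i::int. d [^]\<^bsub>VG w\<^esub> i = \<one>\<^bsub>VG w\<^esub> \<Longrightarrow> i = 0"
    and y: "y \<in> carrier D" and x: "x \<in> carrier D"
    and \<psi>: "\<And>e z. e \<in> edges T \<Longrightarrow> z \<in> carrier (EG e) \<Longrightarrow>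
      \<psi> (\<alpha>_of \<Gamma> e) (\<phi> e z) = \<psi> (\<omega>_of \<Gamma> e) (\<phi> (einv \<Gamma> e) z)"
    and consistent: "\<And>(i::int) (j::int). i \<noteq> 0 \<Longrightarrow> \<psi> v (c [^]\<^bsub>VG v\<^esub> i) = \<psi> w (d [^]\<^bsub>VG w\<^esub> j) \<Longrightarrow>
      y [^]\<^bsub>D\<^esub> i = x [^]\<^bsub>D\<^esub> j"
  obtains f where "family T D f" "f v c = y" "f w d = x"
proof -
  interpret D: comm_group D using D by (simp add: divisible_group_def)
  interpret Gv: comm_group "VG v" using v(1) by (rule vertex_comm)
  interpret pair: comm_group_pair "VG v" D ..
  from transported_powers[OF T D w x \<psi>]
  obtain C where C: "\<And>v. v \<in> verts \<Gamma> \<Longrightarrow> partial_hom (VG v) D (C v)"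
    "\<And>e z y. e \<in> edges T \<Longrightarrow> z \<in> carrier (EG e) \<Longrightarrow>
      (\<phi> e z, y) \<in> C (\<alpha>_of \<Gamma> e) \<longleftrightarrow> (\<phi> (einv \<Gamma> e) z, y) \<in> C (\<omega>_of \<Gamma> e)"
    "(d, x) \<in> C w"
    "\<And>v b y. v \<in> verts \<Gamma> \<Longrightarrow> (b, y) \<in> C v \<Longrightarrow> \<exists>j::int. y = x [^]\<^bsub>D\<^esub> j \<and> \<psi> v b = \<psi> w (d [^]\<^bsub>VG w\<^esub> j)"
    by metis
  have "y [^]\<^bsub>D\<^esub> i = y'" if iy: "(c [^]\<^bsub>VG v\<^esub> i, y') \<in> C v" for i :: int and y'
  proof (cases "i = 0")
    case True
    then show ?thesis using iy partial_homD(6)[OF C(1)[OF v(1)]] by simp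
  next
    case False
    obtain j :: int where "y' = x [^]\<^bsub>D\<^esub> j" "\<psi> v (c [^]\<^bsub>VG v\<^esub> i) = \<psi> w (d [^]\<^bsub>VG w\<^esub> j)"
      using C(4)[OF v(1) iy] by blast
    then show ?thesis using consistent[OF False] by simp
  qed
  note adj = pair.partial_hom_adjoin[OF C(1)[OF v(1)] v(2) y this]
  obtain S where S: "partial_hom (VG v) D S" "C v \<subseteq> S" "(c, y) \<in> S" by (rule that[OF adj])
  obtain h where h: "h \<in> hom (VG v) D" "\<forall>(b, z)\<in>S. h b = z"
    using pair.partial_hom_total[OF S(1) D vertex_fg[OF v(1)]] by (rule bexE)
  have hC: "h b = z" if "(b, z) \<in> C v" for b z using bspec[OF h(2) subsetD[OF S(2) that]] by simp
  from family_extension[OF T D C(1,2) v(1) h(1) hC]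
  obtain f where f: "family T D f" "f v = h" "\<And>u b y. u \<in> verts \<Gamma> \<Longrightarrow> (b, y) \<in> C u \<Longrightarrow> f u b = y"
    by metis
  show ?thesis
    using that[OF f(1)] f(2) f(3)[OF w(1) C(3)] bspec[OF h(2) S(3)] by simp
qed

text \<open>This is \<open>family_extension\<close> with nothing prescribed beyond the neutral
  elements.\<close>

lemma family_of_hom:
  fixes D :: "'d monoid"
  assumes T: "maximal_tree T \<Gamma>" and D: "divisible_group D" and v: "v \<in> verts \<Gamma>" and h: "h \<in> hom (VG v) D"
  obtains f where "family T D f" "f v = h"
proof -
  interpret D: comm_group D using D by (simp add: divisible_group_def)
  define C where "C = (\<lambda>u. {(\<one>\<^bsub>VG u\<^esub>, \<one>\<^bsub>D\<^esub>)})"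
  have C1: "partial_hom (VG u) D (C u)" if "u \<in> verts \<Gamma>" for u
  proof -
    interpret Gu: comm_group "VG u" using that by (rule vertex_comm)
    show ?thesis unfolding C_def by (rule partial_homI) auto
  qed
  have C2: "(\<phi> e z, y) \<in> C (\<alpha>_of \<Gamma> e) \<longleftrightarrow> (\<phi> (einv \<Gamma> e) z, y) \<in> C (\<omega>_of \<Gamma> e)"
    if "e \<in> edges T" "z \<in> carrier (EG e)" for e z y
  proof -
    have e: "e \<in> edges \<Gamma>" using maximal_tree_edges(1)[OF T that(1)] .
    interpret H: group "EG e" using e by (rule edge_group)
    note eh = edge_hom_pair[OF e]
    have "\<phi> e z = \<one>\<^bsub>VG (\<alpha>_of \<Gamma> e)\<^esub> \<longleftrightarrow> z = \<one>\<^bsub>EG e\<^esub>"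
      using inj_onD[OF eh(3) _ that(2) H.one_closed] eh(5) by auto
    moreover have "\<phi> (einv \<Gamma> e) z = \<one>\<^bsub>VG (\<omega>_of \<Gamma> e)\<^esub> \<longleftrightarrow> z = \<one>\<^bsub>EG e\<^esub>"
      using inj_onD[OF eh(4) _ that(2) H.one_closed] eh(6) by auto
    ultimately show ?thesis by (simp add: C_def)
  qed
  have C3: "h b = y" if "(b, y) \<in> C v" for b y
    using that hom_one[OF h vertex_group[OF v] D.is_group] by (simp add: C_def)
  obtain f where "family T D f" "f v = h"
    by (rule family_extension[OF T D C1 C2 v h C3])
  then show ?thesis by (rule that)
qed

end

section \<open>The edge outside the tree\<close>

lemma (in group) intertwine_pow:
  assumes "t \<in> carrier G" "x \<in> carrier G" "y \<in> carrier G" "t \<otimes> x = y \<otimes> t"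
  shows "t \<otimes> x [^] (i::int) = y [^] i \<otimes> t"
proof -
  have "t \<otimes> x \<otimes> inv t = y"
    unfolding assms(4) using assms(1,3) by (simp add: m_assoc)
  then have "t \<otimes> x [^] i \<otimes> inv t = y [^] i"
    using conjugate_pow[OF assms(2,1), of i] by simp
  then have "y [^] i \<otimes> t = t \<otimes> x [^] i \<otimes> inv t \<otimes> t" by simp
  then show ?thesis using assms(1,2) by (simp add: m_assoc)
qed

text \<open>\<open>T\<close> is the tree that misses \<open>e\<close>, while
  \<open>T\<^sub>0\<close> belongs to the presentation. The assumption \<open>edges_eq\<close> is
  what the Euler characteristic contributes.\<close>

locale marked_graph_of_groups = abelian_graph_of_groups \<Gamma> VG EG \<phi> T\<^sub>0 P
  for \<Gamma> :: "('v, 'e) pregraph" and VG :: "'v \<Rightarrow> 'a monoid" and EG :: "'e \<Rightarrow> 'b monoid"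
    and \<phi> :: "'e \<Rightarrow> 'b \<Rightarrow> 'a" and T\<^sub>0 :: "('v, 'e) pregraph" and P :: "'e set" +
  fixes T :: "('v, 'e) pregraph" and e :: 'e and z\<^sub>0 :: 'b
  assumes T: "maximal_tree T \<Gamma>" and e: "e \<in> edges \<Gamma>" "e \<notin> edges T"
    and edges_eq: "edges \<Gamma> = edges T \<union> {e, einv \<Gamma> e}"
    and z0: "z\<^sub>0 \<in> carrier (EG e)" and generator: "carrier (EG e) = range (\<lambda>i::int. z\<^sub>0 [^]\<^bsub>EG e\<^esub> i)"
begin

abbreviation v :: 'v where "v \<equiv> \<alpha>_of \<Gamma> e"
abbreviation w :: 'v where "w \<equiv> \<omega>_of \<Gamma> e"
definition c :: 'a where "c = \<phi> e z\<^sub>0"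
definition d :: 'a where "d = \<phi> (einv \<Gamma> e) z\<^sub>0"

lemma vw: "v \<in> verts \<Gamma>" "w \<in> verts \<Gamma>"
  using e \<alpha>_closed \<omega>_closed by auto

lemma cd: "c \<in> carrier (VG v)" "d \<in> carrier (VG w)"
  using \<phi>_closed[OF e(1) z0] \<phi>_einv_closed[OF e(1) z0] by (auto simp: c_def d_def)

lemma \<phi>_pow: "\<phi> e (z\<^sub>0 [^]\<^bsub>EG e\<^esub> i) = c [^]\<^bsub>VG v\<^esub> (i::int)"
  "\<phi> (einv \<Gamma> e) (z\<^sub>0 [^]\<^bsub>EG e\<^esub> i) = d [^]\<^bsub>VG w\<^esub> i"
  using hom_int_pow[OF edge_hom_pair(1)[OF e(1)] z0 edge_group[OF e(1)] vertex_group[OF vw(1)]]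
    hom_int_pow[OF edge_hom_pair(2)[OF e(1)] z0 edge_group[OF e(1)] vertex_group[OF vw(2)]]
  by (auto simp: c_def d_def)

lemma generatorE:
  assumes "z \<in> carrier (EG e)"
  obtains i :: int where "z = z\<^sub>0 [^]\<^bsub>EG e\<^esub> i"
  using assms generator by auto

lemma einv_e: "einv \<Gamma> e \<notin> edges T"
  using maximal_tree_edges(5)[OF T, of "einv \<Gamma> e"] e einv_einv by auto

text \<open>The edges of \<open>T\<close> are given the neutral element, which leaves
  \<open>t\<close> as the only letter to choose. As \<open>z\<^sub>0\<close> generates the edge
  group of \<open>e\<close>, the relation there follows from its instance at \<open>c\<close> and
  \<open>d\<close>.\<close>

lemma tree_gauged_hom:
  assumes Q: "group (Q :: 'q monoid)" and \<psi>: "family T Q \<psi>"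
    and t: "t \<in> carrier Q" "t \<otimes>\<^bsub>Q\<^esub> \<psi> w d = \<psi> v c \<otimes>\<^bsub>Q\<^esub> t"
  obtains \<Phi> p where "\<Phi> \<in> hom G Q" "\<And>u. u \<in> verts \<Gamma> \<Longrightarrow> p u \<in> carrier Q"
    "\<And>u a. u \<in> verts \<Gamma> \<Longrightarrow> a \<in> carrier (VG u) \<Longrightarrow> \<Phi> (\<iota> u a) = p u \<otimes>\<^bsub>Q\<^esub> \<psi> u a \<otimes>\<^bsub>Q\<^esub> inv\<^bsub>Q\<^esub> p u"
proof -
  interpret Q: group Q by fact
  have \<psi>_hom: "\<psi> u \<in> hom (VG u) Q" if "u \<in> verts \<Gamma>" for u
    using \<psi> that by (simp add: family_def)
  have \<psi>_cl: "\<psi> u a \<in> carrier Q" if "u \<in> verts \<Gamma>" "a \<in> carrier (VG u)" for u a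
    using \<psi>_hom[OF that(1)] that(2) by (auto simp: hom_def)
  have \<psi>_T: "\<psi> (\<alpha>_of \<Gamma> f) (\<phi> f z) = \<psi> (\<omega>_of \<Gamma> f) (\<phi> (einv \<Gamma> f) z)"
    if "f \<in> edges T" "z \<in> carrier (EG f)" for f z
    using \<psi> that by (simp add: family_def)
  define q where "q = (\<lambda>f. if f \<in> edges T then \<one>\<^bsub>Q\<^esub> else if f = e then t else inv\<^bsub>Q\<^esub> t)"
  have rel_e: "t \<otimes>\<^bsub>Q\<^esub> \<psi> w (\<phi> (einv \<Gamma> e) z) = \<psi> v (\<phi> e z) \<otimes>\<^bsub>Q\<^esub> t" if z: "z \<in> carrier (EG e)" for z
  proof -
    obtain i :: int where i: "z = z\<^sub>0 [^]\<^bsub>EG e\<^esub> i" by (rule generatorE[OF z])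
    have "\<psi> w (d [^]\<^bsub>VG w\<^esub> i) = \<psi> w d [^]\<^bsub>Q\<^esub> i" "\<psi> v (c [^]\<^bsub>VG v\<^esub> i) = \<psi> v c [^]\<^bsub>Q\<^esub> i"
      using hom_int_pow[OF \<psi>_hom[OF vw(2)] cd(2) vertex_group[OF vw(2)] Q]
        hom_int_pow[OF \<psi>_hom[OF vw(1)] cd(1) vertex_group[OF vw(1)] Q] by auto
    then show ?thesis
      using Q.intertwine_pow[OF t(1) \<psi>_cl[OF vw(2) cd(2)] \<psi>_cl[OF vw(1) cd(1)] t(2)] by (simp add: i \<phi>_pow)
  qed
  have "\<exists>\<Phi> p. \<Phi> \<in> hom G Q \<and> (\<forall>v\<in>verts \<Gamma>. p v \<in> carrier Q) \<and>
    (\<forall>v\<in>verts \<Gamma>. \<forall>a\<in>carrier (VG v). \<Phi> (\<iota> v a) = p v \<otimes>\<^bsub>Q\<^esub> \<psi> v a \<otimes>\<^bsub>Q\<^esub> inv\<^bsub>Q\<^esub> p v) \<and>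
    (\<forall>e\<in>edges \<Gamma>. \<Phi> (stable e) = p (\<alpha>_of \<Gamma> e) \<otimes>\<^bsub>Q\<^esub> q e \<otimes>\<^bsub>Q\<^esub> inv\<^bsub>Q\<^esub> p (\<omega>_of \<Gamma> e))"
  proof (rule gauged_hom[OF Q \<psi>_hom])
    fix f assume f: "f \<in> edges \<Gamma>"
    show "q f \<in> carrier Q" using t by (simp add: q_def)
    consider "f \<in> edges T" | "f = e" | "f = einv \<Gamma> e" using f edges_eq by blast
    then show "q (einv \<Gamma> f) = inv\<^bsub>Q\<^esub> q f"
    proof cases
      case 1
      then show ?thesis using maximal_tree_edges(5)[OF T] by (simp add: q_def)
    next
      case 2
      then show ?thesis using einv_e einv_neq[OF e(1)] e(2) by (simp add: q_def)
    next
      case 3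
      then show ?thesis using einv_e einv_neq[OF e(1)] e t by (simp add: q_def einv_einv)
    qed
    fix z assume z: "z \<in> carrier (EG f)"
    consider "f \<in> edges T" | "f = e" | "f = einv \<Gamma> e" using f edges_eq by blast
    then show "q f \<otimes>\<^bsub>Q\<^esub> \<psi> (\<omega>_of \<Gamma> f) (\<phi> (einv \<Gamma> f) z) = \<psi> (\<alpha>_of \<Gamma> f) (\<phi> f z) \<otimes>\<^bsub>Q\<^esub> q f"
    proof cases
      case 1
      then show ?thesis
        using \<psi>_T[OF 1 z] \<psi>_cl[OF \<omega>_closed[OF f] \<phi>_einv_closed[OF f z]] by (simp add: q_def)
    next
      case 2
      then show ?thesis using rel_e z e by (simp add: q_def)
    next
      case 3
      then have z': "z \<in> carrier (EG e)" using z by (simp add: edge_group_einv e(1))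
      have "\<psi> w (\<phi> (einv \<Gamma> e) z) \<in> carrier Q" "\<psi> v (\<phi> e z) \<in> carrier Q"
        using \<psi>_cl vw \<phi>_closed[OF e(1) z'] \<phi>_einv_closed[OF e(1) z'] by auto
      then have "inv\<^bsub>Q\<^esub> t \<otimes>\<^bsub>Q\<^esub> \<psi> v (\<phi> e z) = \<psi> w (\<phi> (einv \<Gamma> e) z) \<otimes>\<^bsub>Q\<^esub> inv\<^bsub>Q\<^esub> t"
        using rel_e[OF z'] t(1) by (metis Q.inv_closed Q.inv_solve_left Q.inv_solve_right Q.m_assoc Q.m_closed)
      then show ?thesis
        using 3 einv_e einv_neq[OF e(1)] e(1) by (simp add: q_def einv_einv \<omega>_einv \<alpha>_einv[OF serre])
    qed
  qed
  then show ?thesis using that by (elim exE conjE) blast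
qed

text \<open>Here \<open>p u\<close> is the product of the stable letters along the
  \<open>T\<close>-path to \<open>u\<close>. Conjugated by it, the images of the vertex groups in
  \<open>G\<close> agree along \<open>T\<close>, although the presentation trivialises the letters
  of \<open>T\<^sub>0\<close>.\<close>

lemma regauge:
  obtains p where "\<And>u. u \<in> verts \<Gamma> \<Longrightarrow> p u \<in> carrier G"
    "\<And>f. f \<in> edges T \<Longrightarrow> p (\<alpha>_of \<Gamma> f) \<otimes>\<^bsub>G\<^esub> stable f = p (\<omega>_of \<Gamma> f)"
proof -
  note TE = maximal_tree_edges[OF T]
  have "\<exists>p. (\<forall>u\<in>verts \<Gamma>. p u \<in> carrier G) \<and> p v = \<one>\<^bsub>G\<^esub> \<and>
    (\<forall>f\<in>edges T. p (\<alpha>_of \<Gamma> f) \<otimes>\<^bsub>G\<^esub> stable f = p (\<omega>_of \<Gamma> f))"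
  proof (rule maximal_tree_choice[where A = "\<lambda>_. carrier G" and R = "\<lambda>f x y. x \<otimes>\<^bsub>G\<^esub> stable f = y", OF T vw(1)])
    fix f x assume "f \<in> edges T" "x \<in> carrier G"
    then show "\<exists>y\<in>carrier G. x \<otimes>\<^bsub>G\<^esub> stable f = y" using stable_closed TE(1) by auto
  next
    fix f x y assume "f \<in> edges T" "x \<in> carrier G" "y \<in> carrier G" "x \<otimes>\<^bsub>G\<^esub> stable f = y"
    then show "y \<otimes>\<^bsub>G\<^esub> stable (einv \<Gamma> f) = x"
      using stable_closed stable_einv TE(1) by (metis G.inv_solve_right)
  qed simp
  then show ?thesis using that by (elim exE conjE) blast
qed

text \<open>Vertex elements become translations by their values under \<open>f\<close>, and the
  stable letter of \<open>e\<close> becomes the dilation by \<open>f v c / f w d\<close>. So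
  \<open>d\<close> goes to a conjugate of a nontrivial translation.\<close>

lemma affine_infinite_order:
  assumes f: "family T rat_group f" and nz: "f v c \<noteq> 0" "f w d \<noteq> 0" and n: "(\<iota> w d) [^]\<^bsub>G\<^esub> (n::nat) = \<one>\<^bsub>G\<^esub>"
  shows "n = 0"
proof -
  interpret Q: group affine_group by (rule group_affine)
  define \<psi> where "\<psi> = (\<lambda>u a. (1 :: rat, f u a))"
  have f_hom: "f u \<in> hom (VG u) rat_group" if "u \<in> verts \<Gamma>" for u using f that by (simp add: family_def)
  have "\<psi> u \<in> hom (VG u) affine_group" if "u \<in> verts \<Gamma>" for u
    using f_hom[OF that] by (auto simp: hom_def \<psi>_def)
  then have "family T affine_group \<psi>"
    using f by (simp add: family_def \<psi>_def)
  moreover have "(f v c / f w d, 0) \<otimes>\<^bsub>affine_group\<^esub> \<psi> w d = \<psi> v c \<otimes>\<^bsub>affine_group\<^esub> (f v c / f w d, 0)"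
    using nz by (simp add: \<psi>_def)
  ultimately obtain \<Phi> p where \<Phi>: "\<Phi> \<in> hom G affine_group" and p: "\<And>u. u \<in> verts \<Gamma> \<Longrightarrow> p u \<in> carrier affine_group"
    and \<Phi>\<iota>: "\<And>u a. u \<in> verts \<Gamma> \<Longrightarrow> a \<in> carrier (VG u) \<Longrightarrow>
      \<Phi> (\<iota> u a) = p u \<otimes>\<^bsub>affine_group\<^esub> \<psi> u a \<otimes>\<^bsub>affine_group\<^esub> inv\<^bsub>affine_group\<^esub> p u"
    using tree_gauged_hom[OF group_affine, of \<psi> "(f v c / f w d, 0)"] nz by auto
  interpret Gw: group "VG w" using vw(2) by (rule vertex_group)
  have pow: "\<psi> w (d [^]\<^bsub>VG w\<^esub> n) = (1, of_nat n * f w d)"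
    using hom_int_pow[OF f_hom[OF vw(2)] cd(2) Gw.is_group, of "int n"] comm_group_rat
    by (simp add: \<psi>_def int_pow_int rat_nat_pow comm_group_def)
  have "\<iota> w (d [^]\<^bsub>VG w\<^esub> n) = \<one>\<^bsub>G\<^esub>"
    using hom_int_pow[OF \<iota>_hom[OF vw(2)] cd(2) Gw.is_group G.is_group, of "int n"] n by (simp add: int_pow_int)
  then have "p w \<otimes>\<^bsub>affine_group\<^esub> \<psi> w (d [^]\<^bsub>VG w\<^esub> n) \<otimes>\<^bsub>affine_group\<^esub> inv\<^bsub>affine_group\<^esub> p w = \<one>\<^bsub>affine_group\<^esub>"
    using \<Phi>\<iota>[OF vw(2), of "d [^]\<^bsub>VG w\<^esub> n"] cd(2) hom_one[OF \<Phi> G.is_group Q.is_group] by simp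
  moreover have "\<psi> w (d [^]\<^bsub>VG w\<^esub> n) \<in> carrier affine_group" by (simp add: pow)
  ultimately have "\<psi> w (d [^]\<^bsub>VG w\<^esub> n) = \<one>\<^bsub>affine_group\<^esub>"
    using p[OF vw(2)] by (metis Q.inv_closed Q.inv_equality Q.inv_inv Q.l_cancel_one' Q.m_closed)
  then show ?thesis using pow nz by simp
qed

text \<open>The stable letter of \<open>e\<close> conjugates the \<open>i\<close>-th power of
  \<open>d\<close> to that of \<open>c\<close>, and \<open>eq\<close> conjugates the latter to the
  \<open>j\<close>-th power of \<open>d\<close>. The family \<open>f\<close> ensures that
  \<open>j\<close> is nonzero and that \<open>d\<close> has infinite order in \<open>G\<close>, so
  balancedness applies.\<close>

lemma balanced_exponents:
  assumes bal: "balanced G" and f: "family T rat_group f" "f v c = 1"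
    and p: "\<And>u. u \<in> verts \<Gamma> \<Longrightarrow> p u \<in> carrier G"
    and ij: "i \<noteq> 0" "of_int i * f v c = of_int j * f w d"
    and eq: "p v \<otimes>\<^bsub>G\<^esub> \<iota> v (c [^]\<^bsub>VG v\<^esub> i) \<otimes>\<^bsub>G\<^esub> inv\<^bsub>G\<^esub> p v = p w \<otimes>\<^bsub>G\<^esub> \<iota> w (d [^]\<^bsub>VG w\<^esub> j) \<otimes>\<^bsub>G\<^esub> inv\<^bsub>G\<^esub> p w"
  shows "j = i \<or> j = - i"
proof -
  have "of_int j * f w d \<noteq> 0" using ij(1) unfolding ij(2)[symmetric] f(2) by simp
  then have nz: "j \<noteq> 0" "f w d \<noteq> 0" by auto
  let ?g = "\<iota> w d"
  have cl: "\<iota> v c \<in> carrier G" "?g \<in> carrier G" "stable e \<in> carrier G" "p v \<in> carrier G" "p w \<in> carrier G"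
    using \<iota>_closed vw cd stable_closed e(1) p by auto
  have pow: "\<iota> v (c [^]\<^bsub>VG v\<^esub> k) = \<iota> v c [^]\<^bsub>G\<^esub> k" "\<iota> w (d [^]\<^bsub>VG w\<^esub> k) = ?g [^]\<^bsub>G\<^esub> k" for k :: int
    using hom_int_pow[OF \<iota>_hom[OF vw(1)] cd(1) vertex_group[OF vw(1)] G.is_group]
      hom_int_pow[OF \<iota>_hom[OF vw(2)] cd(2) vertex_group[OF vw(2)] G.is_group] by auto
  have "stable e \<otimes>\<^bsub>G\<^esub> ?g = \<iota> v c \<otimes>\<^bsub>G\<^esub> stable e"
    using stable_rel[OF e(1) z0] by (simp add: c_def d_def)
  then have "stable e \<otimes>\<^bsub>G\<^esub> ?g [^]\<^bsub>G\<^esub> i = \<iota> v c [^]\<^bsub>G\<^esub> i \<otimes>\<^bsub>G\<^esub> stable e"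
    by (rule G.intertwine_pow[OF cl(3,2,1)])
  then have 1: "\<iota> v c [^]\<^bsub>G\<^esub> i = stable e \<otimes>\<^bsub>G\<^esub> ?g [^]\<^bsub>G\<^esub> i \<otimes>\<^bsub>G\<^esub> inv\<^bsub>G\<^esub> stable e"
    using cl by (simp add: G.m_assoc)
  let ?h = "inv\<^bsub>G\<^esub> p w \<otimes>\<^bsub>G\<^esub> p v \<otimes>\<^bsub>G\<^esub> stable e"
  have inv_cancel: "inv\<^bsub>G\<^esub> p w \<otimes>\<^bsub>G\<^esub> (p w \<otimes>\<^bsub>G\<^esub> x) = x" if "x \<in> carrier G" for x
    using cl that by (simp add: G.m_assoc[symmetric])
  have "?h \<otimes>\<^bsub>G\<^esub> ?g [^]\<^bsub>G\<^esub> i \<otimes>\<^bsub>G\<^esub> inv\<^bsub>G\<^esub> ?h = inv\<^bsub>G\<^esub> p w \<otimes>\<^bsub>G\<^esub> (p v \<otimes>\<^bsub>G\<^esub> \<iota> v c [^]\<^bsub>G\<^esub> i \<otimes>\<^bsub>G\<^esub> inv\<^bsub>G\<^esub> p v) \<otimes>\<^bsub>G\<^esub> p w"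
    unfolding 1 using cl by (simp add: G.m_assoc G.inv_mult_group)
  also have "\<dots> = ?g [^]\<^bsub>G\<^esub> j"
    using eq cl by (simp add: pow G.m_assoc inv_cancel)
  finally have "conjugate_in G (?g [^]\<^bsub>G\<^esub> i) (?g [^]\<^bsub>G\<^esub> j)"
    unfolding conjugate_in_def using cl by (intro bexI[of _ ?h]) auto
  moreover have "G.ord ?g = 0"
    unfolding G.ord_eq_0[OF cl(2)] using affine_infinite_order[OF f(1)] f(2) nz(2) by (metis zero_neq_one)
  ultimately show ?thesis using bal ij(1) nz(1) cl(2) unfolding balanced_def by blast
qed

text \<open>Whenever the tree identifies powers of \<open>c\<close> and \<open>d\<close> with
  exponents \<open>i\<close> and \<open>j\<close>, the relation between \<open>g v c\<close> and
  \<open>g w d\<close> must survive the exchange of the two values. For \<open>j = i\<close> and for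
  \<open>j = - i\<close> it does.\<close>

lemma swapped_family:
  fixes D :: "'d monoid"
  assumes bal: "balanced G" and inf: "\<And>i::int. z\<^sub>0 [^]\<^bsub>EG e\<^esub> i = \<one>\<^bsub>EG e\<^esub> \<Longrightarrow> i = 0"
    and D: "divisible_group D" and g: "family T D g"
  obtains g' where "family T D g'" "g' v c = g w d" "g' w d = g v c"
proof -
  interpret D: comm_group D using D by (simp add: divisible_group_def)
  interpret Gv: comm_group "VG v" using vw(1) by (rule vertex_comm)
  interpret H: group "EG e" using e(1) by (rule edge_group)
  have g_hom: "g u \<in> hom (VG u) D" if "u \<in> verts \<Gamma>" for u using g that by (simp add: family_def)
  have inf_c: "i = 0" if "c [^]\<^bsub>VG v\<^esub> i = \<one>\<^bsub>VG v\<^esub>" for i :: int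
  proof -
    have "\<phi> e (z\<^sub>0 [^]\<^bsub>EG e\<^esub> i) = \<phi> e \<one>\<^bsub>EG e\<^esub>" using that edge_hom_pair(5)[OF e(1)] \<phi>_pow by simp
    then show ?thesis using inf inj_onD[OF edge_hom_pair(3)[OF e(1)]] z0 by blast
  qed
  have inf_d: "i = 0" if "d [^]\<^bsub>VG w\<^esub> i = \<one>\<^bsub>VG w\<^esub>" for i :: int
  proof -
    have "\<phi> (einv \<Gamma> e) (z\<^sub>0 [^]\<^bsub>EG e\<^esub> i) = \<phi> (einv \<Gamma> e) \<one>\<^bsub>EG e\<^esub>" using that edge_hom_pair(6)[OF e(1)] \<phi>_pow by simp
    then show ?thesis using inf inj_onD[OF edge_hom_pair(4)[OF e(1)]] z0 by blast
  qed
  obtain h where h: "h \<in> hom (VG v) rat_group" "h c = 1"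
    using Gv.hom_rat[OF vertex_fg[OF vw(1)] cd(1) inf_c] by blast
  obtain f where f: "family T rat_group f" "f v = h"
    by (rule family_of_hom[OF T divisible_rat vw(1) h(1)])
  have f_hom: "f u \<in> hom (VG u) rat_group" if "u \<in> verts \<Gamma>" for u using f(1) that by (simp add: family_def)
  obtain p where p: "\<And>u. u \<in> verts \<Gamma> \<Longrightarrow> p u \<in> carrier G"
    "\<And>f. f \<in> edges T \<Longrightarrow> p (\<alpha>_of \<Gamma> f) \<otimes>\<^bsub>G\<^esub> stable f = p (\<omega>_of \<Gamma> f)"
    using regauge by blast
  \<comment> \<open>One identification, three consequences: the first component gives conjugacy in
    \<open>G\<close>, the second the relation between the values of \<open>g\<close>, the third a
    nonzero \<open>j\<close> and infinite order of \<open>d\<close>.\<close>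
  define \<psi> where "\<psi> = (\<lambda>u a. (p u \<otimes>\<^bsub>G\<^esub> \<iota> u a \<otimes>\<^bsub>G\<^esub> inv\<^bsub>G\<^esub> p u, g u a, f u a))"
  have \<psi>: "\<psi> (\<alpha>_of \<Gamma> k) (\<phi> k z) = \<psi> (\<omega>_of \<Gamma> k) (\<phi> (einv \<Gamma> k) z)"
    if k: "k \<in> edges T" "z \<in> carrier (EG k)" for k z
  proof -
    have kE: "k \<in> edges \<Gamma>" using maximal_tree_edges(1)[OF T k(1)] .
    let ?x = "\<iota> (\<alpha>_of \<Gamma> k) (\<phi> k z)" and ?y = "\<iota> (\<omega>_of \<Gamma> k) (\<phi> (einv \<Gamma> k) z)"
    have cl: "?x \<in> carrier G" "?y \<in> carrier G" "stable k \<in> carrier G" "p (\<alpha>_of \<Gamma> k) \<in> carrier G" "p (\<omega>_of \<Gamma> k) \<in> carrier G"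
      using \<iota>_closed \<alpha>_closed \<omega>_closed \<phi>_closed \<phi>_einv_closed stable_closed p(1) kE k(2) by auto
    have "p (\<omega>_of \<Gamma> k) \<otimes>\<^bsub>G\<^esub> ?y \<otimes>\<^bsub>G\<^esub> inv\<^bsub>G\<^esub> p (\<omega>_of \<Gamma> k)
      = p (\<alpha>_of \<Gamma> k) \<otimes>\<^bsub>G\<^esub> (stable k \<otimes>\<^bsub>G\<^esub> ?y) \<otimes>\<^bsub>G\<^esub> (inv\<^bsub>G\<^esub> stable k \<otimes>\<^bsub>G\<^esub> inv\<^bsub>G\<^esub> p (\<alpha>_of \<Gamma> k))"
      using cl by (simp add: p(2)[OF k(1), symmetric] G.m_assoc G.inv_mult_group)
    also have "\<dots> = p (\<alpha>_of \<Gamma> k) \<otimes>\<^bsub>G\<^esub> ?x \<otimes>\<^bsub>G\<^esub> inv\<^bsub>G\<^esub> p (\<alpha>_of \<Gamma> k)"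
      unfolding stable_rel[OF kE k(2)] using cl
      by (simp add: G.m_assoc) (simp add: G.m_assoc[symmetric])
    finally show ?thesis
      using g f(1) k by (simp add: \<psi>_def family_def)
  qed
  have gpow: "g v (c [^]\<^bsub>VG v\<^esub> i) = g v c [^]\<^bsub>D\<^esub> i" "g w (d [^]\<^bsub>VG w\<^esub> i) = g w d [^]\<^bsub>D\<^esub> i"
    "f v (c [^]\<^bsub>VG v\<^esub> i) = of_int i * f v c" "f w (d [^]\<^bsub>VG w\<^esub> i) = of_int i * f w d" for i :: int
    using hom_int_pow[OF g_hom[OF vw(1)] cd(1) vertex_group[OF vw(1)] D.is_group]
      hom_int_pow[OF g_hom[OF vw(2)] cd(2) vertex_group[OF vw(2)] D.is_group]
      hom_int_pow[OF f_hom[OF vw(1)] cd(1) vertex_group[OF vw(1)]]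
      hom_int_pow[OF f_hom[OF vw(2)] cd(2) vertex_group[OF vw(2)]] comm_group_rat
    by (auto simp: rat_int_pow comm_group_def)
  have gcl: "g v c \<in> carrier D" "g w d \<in> carrier D"
    using g_hom vw cd by (auto simp: hom_def)
  have consistent: "g w d [^]\<^bsub>D\<^esub> i = g v c [^]\<^bsub>D\<^esub> j"
    if ij: "i \<noteq> 0" "\<psi> v (c [^]\<^bsub>VG v\<^esub> i) = \<psi> w (d [^]\<^bsub>VG w\<^esub> j)" for i j :: int
  proof -
    have eq: "p v \<otimes>\<^bsub>G\<^esub> \<iota> v (c [^]\<^bsub>VG v\<^esub> i) \<otimes>\<^bsub>G\<^esub> inv\<^bsub>G\<^esub> p v = p w \<otimes>\<^bsub>G\<^esub> \<iota> w (d [^]\<^bsub>VG w\<^esub> j) \<otimes>\<^bsub>G\<^esub> inv\<^bsub>G\<^esub> p w"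
      "g v c [^]\<^bsub>D\<^esub> i = g w d [^]\<^bsub>D\<^esub> j" "of_int i * f v c = of_int j * f w d"
      using ij(2) by (simp_all add: \<psi>_def gpow)
    have "j = i \<or> j = - i"
      using balanced_exponents[OF bal f(1) _ p(1) ij(1) eq(3,1)] f(2) h(2) by simp
    then show ?thesis
    proof
      assume "j = - i"
      then show ?thesis using eq(2) gcl by (simp add: D.int_pow_neg)
    qed (use eq(2) in simp)
  qed
  from two_point_extension[OF T D vw(1) cd(1) vw(2) cd(2) inf_d gcl(2,1) \<psi> consistent]
  show ?thesis using that by metis
qed

end

section \<open>Separating vertex group elements by finite quotients\<close>

lemma (in group) detect_infinite_conjugate:
  assumes \<Phi>: "\<Phi> \<in> hom G (shift_group S)" and S: "finite S" and g: "g \<in> carrier G"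
    and conj: "conjugate_in G g g'" and p: "p \<in> S \<times> UNIV" and s: "\<Phi> g' p = shift s p" "s \<noteq> 0"
  shows "virtual_retract (range (\<lambda>i::int. g [^] i)) G"
proof -
  interpret Q: group "shift_group S" by (rule group_shift_group)
  obtain h where h: "h \<in> carrier G" "h \<otimes> g \<otimes> inv h = g'" using conj by (auto simp: conjugate_in_def)
  have car: "\<Phi> x \<in> carrier (shift_group S)" if "x \<in> carrier G" for x
    using \<Phi> that by (auto simp: hom_def)
  have comp: "\<Phi> (x \<otimes> y) q = \<Phi> x (\<Phi> y q)" if "x \<in> carrier G" "y \<in> carrier G" for x y q
    using \<Phi> that by (simp add: hom_mult)
  let ?p = "\<Phi> (inv h) p"
  have "g \<otimes> inv h = inv h \<otimes> g'"
    using h(1) g by (simp add: h(2)[symmetric] m_assoc) (simp add: m_assoc[symmetric])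
  then have "\<Phi> g ?p = \<Phi> (inv h) (\<Phi> g' p)"
    using comp[of g "inv h" p] comp[of "inv h" g' p] h g by auto
  also have "\<dots> = shift s ?p"
    unfolding s(1) using shift_groupD(2)[OF car[of "inv h"]] h(1) by simp
  finally have eq: "\<Phi> g ?p = shift s ?p" .
  have "?p \<in> \<Phi> (inv h) ` (S \<times> UNIV)" using p by (rule imageI)
  then have "?p \<in> S \<times> UNIV" using shift_groupD(3)[OF car[of "inv h"]] h(1) by simp
  from detect_infinite[OF \<Phi> S g this eq s(2)] show ?thesis .
qed

lemma (in group) trivial_action_conjugate:
  assumes \<Phi>: "\<Phi> \<in> hom G (shift_group S)" and g: "g \<in> carrier G" and h: "h \<in> carrier G"
    and triv: "\<And>y. y \<in> S \<Longrightarrow> fst (\<Phi> g (y, 0)) = y" and y: "y \<in> S"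
  shows "fst (\<Phi> (h \<otimes> g \<otimes> inv h) (y, 0)) = y"
proof -
  interpret Q: group "shift_group S" by (rule group_shift_group)
  have car: "\<Phi> x \<in> carrier (shift_group S)" if "x \<in> carrier G" for x
    using \<Phi> that by (auto simp: hom_def)
  have comp: "\<Phi> (x \<otimes> y) q = \<Phi> x (\<Phi> y q)" if "x \<in> carrier G" "y \<in> carrier G" for x y q
    using \<Phi> that by (simp add: hom_mult)
  obtain y' k where y': "\<Phi> (inv h) (y, 0) = (y', k)" by (cases "\<Phi> (inv h) (y, 0)")
  have "(y', k) \<in> \<Phi> (inv h) ` (S \<times> UNIV)" using y y' by (metis SigmaI UNIV_I imageI)
  then have y'S: "y' \<in> S" using shift_groupD(3)[OF car[of "inv h"]] h by auto
  obtain m where m: "\<Phi> g (y', 0) = (y', m)" using triv[OF y'S] by (metis prod.collapse)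
  have "\<Phi> g (y', k) = \<Phi> g (shift k (y', 0))" by (simp add: shift_def)
  also have "\<dots> = shift m (y', k)"
    unfolding shift_groupD(2)[OF car[OF g]] m by (simp add: shift_def)
  finally have "\<Phi> (h \<otimes> g \<otimes> inv h) (y, 0) = \<Phi> h (shift m (\<Phi> (inv h) (y, 0)))"
    using g h by (simp add: comp y')
  also have "\<dots> = shift m (\<Phi> (h \<otimes> inv h) (y, 0))"
    by (simp only: shift_groupD(2)[OF car[OF h]] comp[OF h inv_closed[OF h]])
  also have "\<Phi> (h \<otimes> inv h) (y, 0) = (y, 0)"
    using h hom_one[OF \<Phi> is_group Q.is_group] by simp
  finally show ?thesis by (simp add: shift_def)
qed

text \<open>Applied to exponents of roots of unity and to denominators, both of which may be
  replaced by multiples.\<close>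

lemma common_multiple:
  assumes "finite B" and "\<And>b. b \<in> B \<Longrightarrow> \<exists>m::nat>0. R b m"
    and "\<And>b m k. b \<in> B \<Longrightarrow> R b m \<Longrightarrow> R b (k * m)"
  shows "\<exists>m::nat>0. \<forall>b\<in>B. R b m"
  using assms
proof (induction rule: finite_induct)
  case (insert b B)
  obtain m where m: "m > 0" "\<forall>b\<in>B. R b m" using insert.IH insert.prems by blast
  obtain k where k: "k > 0" "R b k" using insert.prems(1) by blast
  have "R b (m * k)" using insert.prems(2) k by blast
  moreover have "R x (m * k)" if "x \<in> B" for x
    using insert.prems(2)[of x m k] m(2) that by (simp add: mult.commute)
  ultimately show ?case using m(1) k(1) by (intro exI[of _ "m * k"]) simp
qed auto

lemma (in group) finite_generating_set:
  assumes "finitely_generated_group G"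
  shows "\<exists>B. finite B \<and> B \<subseteq> carrier G \<and> (\<forall>H. subgroup H G \<longrightarrow> B \<subseteq> H \<longrightarrow> carrier G \<subseteq> H)"
proof -
  obtain B where "finite B" "B \<subseteq> carrier G" "generate G B = carrier G"
    using assms by (auto simp: finitely_generated_group_def)
  then show ?thesis using generate_subgroup_incl by metis
qed

text \<open>A common exponent for the values at finitely many generators works everywhere, since the
  elements whose values it kills form a subgroup.\<close>

lemma (in group) hom_roots_bounded:
  assumes fg: "finitely_generated_group G" and h: "h \<in> hom G root_of_unity_group"
  shows "\<exists>m>0. \<forall>a\<in>carrier G. h a ^ m = 1"
proof -
  interpret D: comm_group root_of_unity_group by (rule comm_group_roots)
  obtain B where B: "finite B" "B \<subseteq> carrier G"
    and gen: "\<forall>H. subgroup H G \<longrightarrow> B \<subseteq> H \<longrightarrow> carrier G \<subseteq> H"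
    using finite_generating_set[OF fg] by (elim exE conjE)
  have "\<exists>m::nat>0. \<forall>b\<in>B. h b ^ m = 1"
  proof (rule common_multiple[OF B(1)])
    fix b assume "b \<in> B"
    then have "h b \<in> carrier root_of_unity_group" using h B(2) by (auto simp: hom_def)
    then show "\<exists>m::nat>0. h b ^ m = 1" by (auto simp: root_of_unity_group_def)
  next
    fix b and m k :: nat assume "h b ^ m = 1"
    then show "h b ^ (k * m) = 1" by (simp add: mult.commute[of k] power_mult)
  qed
  then obtain m :: nat where m: "m > 0" "\<forall>b\<in>B. h b ^ m = 1" by blast
  have inv: "h (inv a) * h a = 1" if "a \<in> carrier G" for a
  proof -
    have "h (inv a \<otimes> a) = h (inv a) * h a" using hom_mult[OF h inv_closed[OF that] that] by simp
    then show ?thesis using that hom_one[OF h is_group D.is_group] by simp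
  qed
  have "subgroup {a \<in> carrier G. h a ^ m = 1} G"
  proof (rule subgroupI)
    have "\<one> \<in> {a \<in> carrier G. h a ^ m = 1}" using hom_one[OF h is_group D.is_group] by simp
    then show "{a \<in> carrier G. h a ^ m = 1} \<noteq> {}" by blast
    fix a assume a: "a \<in> {a \<in> carrier G. h a ^ m = 1}"
    then have "(h (inv a) * h a) ^ m = 1" using inv by simp
    then show "inv a \<in> {a \<in> carrier G. h a ^ m = 1}" using a by (simp add: power_mult_distrib)
    fix b assume "b \<in> {a \<in> carrier G. h a ^ m = 1}"
    then show "a \<otimes> b \<in> {a \<in> carrier G. h a ^ m = 1}"
      using a hom_mult[OF h, of a b] by (simp add: power_mult_distrib)
  qed auto
  then have "carrier G \<subseteq> {a \<in> carrier G. h a ^ m = 1}" using B(2) m(2) by (intro gen[rule_format]) auto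
  then show ?thesis using m(1) by blast
qed

lemma (in group) hom_rat_denominator:
  assumes fg: "finitely_generated_group G" and h: "h \<in> hom G rat_group"
  shows "\<exists>m::nat>0. \<forall>a\<in>carrier G. of_nat m * h a \<in> \<int>"
proof -
  interpret D: comm_group rat_group by (rule comm_group_rat)
  obtain B where B: "finite B" "B \<subseteq> carrier G"
    and gen: "\<forall>H. subgroup H G \<longrightarrow> B \<subseteq> H \<longrightarrow> carrier G \<subseteq> H"
    using finite_generating_set[OF fg] by (elim exE conjE)
  have "\<exists>m::nat>0. \<forall>b\<in>B. of_nat m * h b \<in> \<int>"
  proof (rule common_multiple[OF B(1)])
    fix b
    obtain p q :: int where pq: "h b = of_int p / of_int q" "q > 0"
      by (metis quotient_of_denom_pos quotient_of_div surj_pair)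
    then have "of_nat (nat q) * h b = of_int p" by simp
    then show "\<exists>m::nat>0. of_nat m * h b \<in> \<int>"
      using pq(2) by (intro exI[of _ "nat q"]) auto
  next
    fix b and m k :: nat assume "of_nat m * h b \<in> \<int>"
    from Ints_mult[OF Ints_of_nat[of k] this] show "of_nat (k * m) * h b \<in> \<int>" by (simp add: mult.assoc)
  qed
  then obtain m :: nat where m: "m > 0" "\<forall>b\<in>B. of_nat m * h b \<in> \<int>" by blast
  have inv: "h (inv a) = - h a" if "a \<in> carrier G" for a
  proof -
    have "h (inv a \<otimes> a) = h (inv a) + h a" using hom_mult[OF h inv_closed[OF that] that] by simp
    then show ?thesis using that hom_one[OF h is_group D.is_group] by simp
  qed
  have "subgroup {a \<in> carrier G. of_nat m * h a \<in> \<int>} G"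
  proof (rule subgroupI)
    have "\<one> \<in> {a \<in> carrier G. of_nat m * h a \<in> \<int>}" using hom_one[OF h is_group D.is_group] by simp
    then show "{a \<in> carrier G. of_nat m * h a \<in> \<int>} \<noteq> {}" by blast
    fix a assume a: "a \<in> {a \<in> carrier G. of_nat m * h a \<in> \<int>}"
    then show "inv a \<in> {a \<in> carrier G. of_nat m * h a \<in> \<int>}" using inv by simp
    fix b assume "b \<in> {a \<in> carrier G. of_nat m * h a \<in> \<int>}"
    then show "a \<otimes> b \<in> {a \<in> carrier G. of_nat m * h a \<in> \<int>}"
      using a hom_mult[OF h, of a b] by (simp add: distrib_left)
  qed auto
  then have "carrier G \<subseteq> {a \<in> carrier G. of_nat m * h a \<in> \<int>}" using B(2) m(2) by (intro gen[rule_format]) auto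
  then show ?thesis using m(1) by blast
qed

text \<open>This shows that an intersection of two systems still has finitely many cosets at each
  vertex.\<close>

lemma (in group) lcos_Int:
  assumes "subgroup N G" "subgroup M G" "x \<in> carrier G"
  shows "x <# (N \<inter> M) = (x <# N) \<inter> (x <# M)"
proof
  show "x <# (N \<inter> M) \<subseteq> (x <# N) \<inter> (x <# M)" by (auto simp: l_coset_def)
  show "(x <# N) \<inter> (x <# M) \<subseteq> x <# (N \<inter> M)"
  proof
    fix y assume "y \<in> (x <# N) \<inter> (x <# M)"
    then obtain a b where ab: "a \<in> N" "b \<in> M" "y = x \<otimes> a" "y = x \<otimes> b" by (auto simp: l_coset_def)
    then have "a = b" using assms by (metis l_cancel subgroup.mem_carrier)
    then show "y \<in> x <# (N \<inter> M)" using ab by (auto simp: l_coset_def)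
  qed
qed

lemma (in comm_group) hom_kernel:
  assumes fg: "finitely_generated_group G" and h: "h \<in> hom G root_of_unity_group"
  defines "K \<equiv> {a \<in> carrier G. h a = 1}"
  shows "subgroup K G" "finite ((\<lambda>x. x <# K) ` carrier G)"
proof -
  interpret D: comm_group root_of_unity_group by (rule comm_group_roots)
  have one: "h \<one> = 1" using hom_one[OF h is_group D.is_group] by simp
  have mult: "h (a \<otimes> b) = h a * h b" if "a \<in> carrier G" "b \<in> carrier G" for a b
    using hom_mult[OF h that] by simp
  have inv: "h (inv a) * h a = 1" if "a \<in> carrier G" for a
    using mult[OF inv_closed[OF that] that] that one by simp
  show "subgroup K G"
  proof (rule subgroupI)
    show "K \<noteq> {}" using one one_closed unfolding K_def by blast
    fix a assume a: "a \<in> K"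
    show "inv a \<in> K" using inv[of a] a by (simp add: K_def)
    fix b assume "b \<in> K"
    then show "a \<otimes> b \<in> K" using a by (simp add: K_def mult)
  qed (auto simp: K_def)
  obtain m where m: "m > 0" "\<forall>a\<in>carrier G. h a ^ m = 1"
    using hom_roots_bounded[OF fg h] by blast
  have "x <# K = {a \<in> carrier G. h a = h x}" if x: "x \<in> carrier G" for x
  proof
    show "x <# K \<subseteq> {a \<in> carrier G. h a = h x}"
      using x by (auto simp: l_coset_def K_def mult)
    show "{a \<in> carrier G. h a = h x} \<subseteq> x <# K"
    proof
      fix a assume a: "a \<in> {a \<in> carrier G. h a = h x}"
      then have "inv x \<otimes> a \<in> K" using x inv[OF x] by (simp add: K_def mult)
      moreover have "a = x \<otimes> (inv x \<otimes> a)" using a x by (simp add: m_assoc[symmetric])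
      ultimately show "a \<in> x <# K" unfolding l_coset_def by blast
    qed
  qed
  \<comment> \<open>Cosets of the kernel are fibres of \<open>h\<close>, and all values are
    \<open>m\<close>-th roots of unity.\<close>
  then have "(\<lambda>x. x <# K) ` carrier G \<subseteq> (\<lambda>t. {a \<in> carrier G. h a = t}) ` {z. z ^ m = 1}"
    using m(2) by auto
  then show "finite ((\<lambda>x. x <# K) ` carrier G)"
    using finite_nth_roots[OF m(1), of 1] by (rule finite_subset[OF _ finite_imageI])
qed

context marked_graph_of_groups
begin

text \<open>Compatibility along \<open>T\<close> only: the condition at \<open>e\<close> is the one
  that has to be earned.\<close>

definition tree_system :: "('v \<Rightarrow> 'a set) \<Rightarrow> bool" where
  "tree_system N \<longleftrightarrow> (\<forall>u\<in>verts \<Gamma>. subgroup (N u) (VG u) \<and> finite (cosets N u)) \<and>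
     (\<forall>f\<in>edges T. \<forall>z\<in>carrier (EG f).
        \<phi> f z \<in> N (\<alpha>_of \<Gamma> f) \<longleftrightarrow> \<phi> (einv \<Gamma> f) z \<in> N (\<omega>_of \<Gamma> f))"

lemma tree_system_kernel:
  assumes f: "family T root_of_unity_group f"
  shows "tree_system (\<lambda>u. {a \<in> carrier (VG u). f u a = 1})"
  unfolding tree_system_def
proof (intro conjI ballI)
  fix u assume u: "u \<in> verts \<Gamma>"
  interpret Gu: comm_group "VG u" using u by (rule vertex_comm)
  have "f u \<in> hom (VG u) root_of_unity_group" using f u by (simp add: family_def)
  from Gu.hom_kernel[OF vertex_fg[OF u] this]
  show "subgroup {a \<in> carrier (VG u). f u a = 1} (VG u)"
    "finite (cosets (\<lambda>u. {a \<in> carrier (VG u). f u a = 1}) u)" by (auto simp: cosets_def)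
next
  fix k z assume k: "k \<in> edges T" "z \<in> carrier (EG k)"
  have "k \<in> edges \<Gamma>" using maximal_tree_edges(1)[OF T k(1)] .
  then show "\<phi> k z \<in> {a \<in> carrier (VG (\<alpha>_of \<Gamma> k)). f (\<alpha>_of \<Gamma> k) a = 1} \<longleftrightarrow>
      \<phi> (einv \<Gamma> k) z \<in> {a \<in> carrier (VG (\<omega>_of \<Gamma> k)). f (\<omega>_of \<Gamma> k) a = 1}"
    using f k \<phi>_closed[OF _ k(2)] \<phi>_einv_closed[OF _ k(2)] by (simp add: family_def)
qed

lemma cosets_Int:
  assumes "u \<in> verts \<Gamma>" "subgroup (N u) (VG u)" "subgroup (M u) (VG u)"
    and "finite (cosets N u)" "finite (cosets M u)"
  shows "finite (cosets (\<lambda>u. N u \<inter> M u) u)"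
proof (rule finite_subset)
  interpret Gu: comm_group "VG u" using assms(1) by (rule vertex_comm)
  show "cosets (\<lambda>u. N u \<inter> M u) u \<subseteq> (\<lambda>(C, C'). C \<inter> C') ` (cosets N u \<times> cosets M u)"
    using Gu.lcos_Int[OF assms(2,3)] by (auto simp: cosets_def)
  show "finite ((\<lambda>(C, C'). C \<inter> C') ` (cosets N u \<times> cosets M u))" using assms(4,5) by simp
qed

lemma tree_system_Int:
  assumes "tree_system N" "tree_system M"
  shows "tree_system (\<lambda>u. N u \<inter> M u)"
  using assms cosets_Int vertex_group unfolding tree_system_def
  by (auto intro: group.subgroups_Inter_pair)

lemma compatible_system_iff:
  "compatible_system N \<longleftrightarrow> tree_system N \<and>
     (\<forall>z\<in>carrier (EG e). \<phi> e z \<in> N v \<longleftrightarrow> \<phi> (einv \<Gamma> e) z \<in> N w)"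
proof
  show "compatible_system N \<Longrightarrow> tree_system N \<and> (\<forall>z\<in>carrier (EG e). \<phi> e z \<in> N v \<longleftrightarrow> \<phi> (einv \<Gamma> e) z \<in> N w)"
    using edges_eq e(1) by (auto simp: compatible_system_def tree_system_def)
next
  assume N: "tree_system N \<and> (\<forall>z\<in>carrier (EG e). \<phi> e z \<in> N v \<longleftrightarrow> \<phi> (einv \<Gamma> e) z \<in> N w)"
  have "\<phi> f z \<in> N (\<alpha>_of \<Gamma> f) \<longleftrightarrow> \<phi> (einv \<Gamma> f) z \<in> N (\<omega>_of \<Gamma> f)"
    if f: "f \<in> edges \<Gamma>" "z \<in> carrier (EG f)" for f z
  proof -
    consider "f \<in> edges T" | "f = e" | "f = einv \<Gamma> e" using f(1) edges_eq by blast
    then show ?thesis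
    proof cases
      case 3
      then have "z \<in> carrier (EG e)" using f(2) by (simp add: edge_group_einv e(1))
      then show ?thesis using 3 N e(1) by (simp add: einv_einv \<omega>_einv \<alpha>_einv[OF serre])
    qed (use N f in \<open>auto simp: tree_system_def\<close>)
  qed
  then show "compatible_system N" using N by (simp add: compatible_system_def tree_system_def)
qed

lemma compatible_system_Int:
  "compatible_system N \<Longrightarrow> compatible_system M \<Longrightarrow> compatible_system (\<lambda>u. N u \<inter> M u)"
  unfolding compatible_system_iff using tree_system_Int by auto

lemma tree_system_separating:
  assumes u: "u \<in> verts \<Gamma>" and h: "h \<in> hom (VG u) root_of_unity_group"
  shows "\<exists>N. tree_system N \<and> (\<forall>a\<in>N u. h a = 1)"
proof -
  obtain f where f: "family T root_of_unity_group f" "f u = h"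
    by (rule family_of_hom[OF T divisible_roots u h])
  show ?thesis using tree_system_kernel[OF f(1)] f(2) by (intro exI conjI) auto
qed

lemma tree_system_avoiding:
  assumes u: "u \<in> verts \<Gamma>" and a: "a \<in> carrier (VG u)" "a \<noteq> \<one>\<^bsub>VG u\<^esub>"
  shows "\<exists>N. tree_system N \<and> a \<notin> N u"
proof -
  interpret Gu: comm_group "VG u" using u by (rule vertex_comm)
  obtain h where "h \<in> hom (VG u) root_of_unity_group" "h a \<noteq> 1"
    using Gu.hom_separating[OF vertex_fg[OF u] Gu.triv_subgroup a(1)] a(2) by auto
  then show ?thesis using tree_system_separating[OF u] by blast
qed

text \<open>Shrink the system until it contains no nontrivial element of either image of the finite
  edge group; both sides of the condition at \<open>e\<close> then hold for the neutral element
  only.\<close>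

lemma finite_edge_group_system:
  assumes fin: "finite (carrier (EG e))" and N: "tree_system N"
  shows "\<exists>M. compatible_system M \<and> (\<forall>u\<in>verts \<Gamma>. M u \<subseteq> N u)"
proof -
  interpret H: group "EG e" using e(1) by (rule edge_group)
  note eh = edge_hom_pair[OF e(1)]
  have "\<exists>M. tree_system M \<and> (\<forall>u\<in>verts \<Gamma>. M u \<subseteq> N u) \<and> (\<forall>z\<in>F. \<phi> e z \<notin> M v \<and> \<phi> (einv \<Gamma> e) z \<notin> M w)"
    if "finite F" "F \<subseteq> carrier (EG e) - {\<one>\<^bsub>EG e\<^esub>}" for F
    using that
  proof (induction rule: finite_induct)
    case empty
    then show ?case using N by blast
  next
    case (insert z F)
    then obtain M where M: "tree_system M" "\<forall>u\<in>verts \<Gamma>. M u \<subseteq> N u" "\<forall>z\<in>F. \<phi> e z \<notin> M v \<and> \<phi> (einv \<Gamma> e) z \<notin> M w"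
      by auto
    have z: "z \<in> carrier (EG e)" "z \<noteq> \<one>\<^bsub>EG e\<^esub>" using insert.prems by auto
    have "\<phi> e z \<noteq> \<one>\<^bsub>VG v\<^esub>" "\<phi> (einv \<Gamma> e) z \<noteq> \<one>\<^bsub>VG w\<^esub>"
      using inj_onD[OF eh(3) _ z(1) H.one_closed] inj_onD[OF eh(4) _ z(1) H.one_closed] eh(5,6) z(2) by auto
    then obtain N1 N2 where N12: "tree_system N1" "\<phi> e z \<notin> N1 v" "tree_system N2" "\<phi> (einv \<Gamma> e) z \<notin> N2 w"
      using tree_system_avoiding[OF vw(1) \<phi>_closed[OF e(1) z(1)]]
        tree_system_avoiding[OF vw(2) \<phi>_einv_closed[OF e(1) z(1)]] by blast
    have "tree_system (\<lambda>u. M u \<inter> (N1 u \<inter> N2 u))"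
      using M(1) N12 by (intro tree_system_Int)
    then show ?case using M N12 by (intro exI[of _ "\<lambda>u. M u \<inter> (N1 u \<inter> N2 u)"]) auto
  qed
  from this[of "carrier (EG e) - {\<one>\<^bsub>EG e\<^esub>}"] fin
  obtain M where M: "tree_system M" "\<forall>u\<in>verts \<Gamma>. M u \<subseteq> N u"
    "\<forall>z\<in>carrier (EG e) - {\<one>\<^bsub>EG e\<^esub>}. \<phi> e z \<notin> M v \<and> \<phi> (einv \<Gamma> e) z \<notin> M w" by auto
  have "\<one>\<^bsub>VG v\<^esub> \<in> M v" "\<one>\<^bsub>VG w\<^esub> \<in> M w"
    using M(1) vw by (auto simp: tree_system_def subgroup.one_closed)
  then have "compatible_system M"
    unfolding compatible_system_iff using M(1,3) eh(5,6) by auto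
  then show ?thesis using M(2) by blast
qed

lemma finite_edge_group:
  assumes "z\<^sub>0 [^]\<^bsub>EG e\<^esub> i = \<one>\<^bsub>EG e\<^esub>" "(i::int) \<noteq> 0"
  shows "finite (carrier (EG e))"
proof -
  interpret H: group "EG e" using e(1) by (rule edge_group)
  have "z\<^sub>0 [^]\<^bsub>EG e\<^esub> k = z\<^sub>0 [^]\<^bsub>EG e\<^esub> (k mod int (H.ord z\<^sub>0))" for k :: int
    unfolding H.int_pow_eq[OF z0] by (simp add: mod_eq_dvd_iff[symmetric])
  moreover have "H.ord z\<^sub>0 > 0" using assms H.int_pow_eq_id[OF z0, of i] by (cases "H.ord z\<^sub>0 = 0") auto
  ultimately have "z\<^sub>0 [^]\<^bsub>EG e\<^esub> k \<in> (\<lambda>k. z\<^sub>0 [^]\<^bsub>EG e\<^esub> k) ` {0..<int (H.ord z\<^sub>0)}" for k :: int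
    by (intro image_eqI[of _ _ "k mod int (H.ord z\<^sub>0)"]) auto
  then have "carrier (EG e) \<subseteq> (\<lambda>k. z\<^sub>0 [^]\<^bsub>EG e\<^esub> k) ` {0..<int (H.ord z\<^sub>0)}"
    unfolding generator by blast
  then show ?thesis by (rule finite_subset) simp
qed

theorem system_separating:
  assumes bal: "balanced G" and u: "u \<in> verts \<Gamma>" and h: "h \<in> hom (VG u) root_of_unity_group"
  shows "\<exists>N. compatible_system N \<and> (\<forall>a\<in>N u. h a = 1)"
proof (cases "\<forall>i::int. z\<^sub>0 [^]\<^bsub>EG e\<^esub> i = \<one>\<^bsub>EG e\<^esub> \<longrightarrow> i = 0")
  case False
  then have "finite (carrier (EG e))" using finite_edge_group by blast
  then show ?thesis using tree_system_separating[OF u h] finite_edge_group_system u by (meson subsetD)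
next
  case True
  interpret D: comm_group root_of_unity_group by (rule comm_group_roots)
  obtain f where f: "family T root_of_unity_group f" "f u = h"
    by (rule family_of_hom[OF T divisible_roots u h])
  obtain f' where f': "family T root_of_unity_group f'" "f' v c = f w d" "f' w d = f v c"
    by (rule swapped_family[OF bal _ divisible_roots f(1)]) (use True in auto)
  \<comment> \<open>Intersecting the two kernels makes the condition at \<open>e\<close> symmetric:
    at either end it says that the \<open>i\<close>-th powers of \<open>f v c\<close> and of
    \<open>f w d\<close> are both 1.\<close>
  define N where "N = (\<lambda>u. {a \<in> carrier (VG u). f u a = 1} \<inter> {a \<in> carrier (VG u). f' u a = 1})"
  have "tree_system N"
    unfolding N_def by (intro tree_system_Int tree_system_kernel f f')
  moreover have "\<phi> e z \<in> N v \<longleftrightarrow> \<phi> (einv \<Gamma> e) z \<in> N w" if z: "z \<in> carrier (EG e)" for z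
  proof -
    obtain i :: int where i: "z = z\<^sub>0 [^]\<^bsub>EG e\<^esub> i" by (rule generatorE[OF z])
    have pow: "k v (c [^]\<^bsub>VG v\<^esub> i) = k v c [^]\<^bsub>root_of_unity_group\<^esub> i"
      "k w (d [^]\<^bsub>VG w\<^esub> i) = k w d [^]\<^bsub>root_of_unity_group\<^esub> i"
      if "family T root_of_unity_group k" for k
      using that hom_int_pow[OF _ cd(1) vertex_group[OF vw(1)] D.is_group, of "k v"]
        hom_int_pow[OF _ cd(2) vertex_group[OF vw(2)] D.is_group, of "k w"] vw by (auto simp: family_def)
    show ?thesis
      using \<phi>_closed[OF e(1) z] \<phi>_einv_closed[OF e(1) z]
      by (auto simp: N_def i \<phi>_pow pow[OF f(1)] pow[OF f'(1)] f'(2,3))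
  qed
  ultimately have "compatible_system N" by (simp add: compatible_system_iff)
  moreover have "\<forall>a\<in>N u. h a = 1" by (simp add: N_def f(2))
  ultimately show ?thesis by blast
qed

lemma finitely_many_systems:
  fixes n :: nat
  assumes bal: "balanced G"
    and ex: "\<And>i. i < n \<Longrightarrow> \<exists>N. compatible_system N \<and> N (r i) \<inter> A i = {}"
  shows "\<exists>N. compatible_system N \<and> (\<forall>i<n. N (r i) \<inter> A i = {})"
  using ex
proof (induction n)
  case 0
  obtain u where u: "u \<in> verts \<Gamma>" using nonempty by blast
  interpret D: comm_group root_of_unity_group by (rule comm_group_roots)
  \<comment> \<open>With nothing to avoid, a compatible system must still exist; the trivial
    homomorphism provides one.\<close>
  have "(\<lambda>_. 1) \<in> hom (VG u) root_of_unity_group"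
    using D.one_closed by (intro homI) simp_all
  then show ?case using system_separating[OF bal u] by blast
next
  case (Suc n)
  then obtain N where N: "compatible_system N" "\<forall>i<n. N (r i) \<inter> A i = {}" by auto
  obtain M where M: "compatible_system M" "M (r n) \<inter> A n = {}" using Suc.prems by blast
  have "(N (r i) \<inter> M (r i)) \<inter> A i = {}" if "i < Suc n" for i
    using that N(2) M(2) by (auto simp: less_Suc_eq)
  then show ?case using compatible_system_Int[OF N(1) M(1)]
    by (intro exI[of _ "\<lambda>u. N u \<inter> M u"]) auto
qed

end

section \<open>Balanced groups have (VRC)\<close>

context marked_graph_of_groups
begin

lemma hyperbolic_retract:
  assumes bal: "balanced G" and g: "g \<in> carrier G" and hyp: "hyperbolic g"
  shows "virtual_retract (range (\<lambda>i::int. g [^]\<^bsub>G\<^esub> i)) G"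
proof -
  obtain u w where path: "w \<noteq> []" "gpath u w u" "cyc_reduced w" "conjugate_in G g (gval w)"
    using hyp by (auto simp: hyperbolic_def)
  let ?n = "length w"
  let ?e = "\<lambda>i. snd (w ! i)" and ?a = "\<lambda>i. fst (w ! (Suc i mod ?n))"
  let ?w = "\<lambda>i. \<omega>_of \<Gamma> (?e i)"
  \<comment> \<open>What the system has to avoid at position \<open>i\<close> for \<open>w\<close>
    to stay cyclically reduced modulo \<open>N\<close>; empty where \<open>w\<close> does not
    backtrack.\<close>
  define A where "A = (\<lambda>i. if snd (w ! (Suc i mod ?n)) = einv \<Gamma> (?e i)
    then {\<phi> (einv \<Gamma> (?e i)) z \<otimes>\<^bsub>VG (?w i)\<^esub> inv\<^bsub>VG (?w i)\<^esub> ?a i |z. z \<in> carrier (EG (?e i))} else {})"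
  have "\<exists>N. compatible_system N \<and> N (?w i) \<inter> A i = {}" if i: "i < ?n" for i
  proof (cases "snd (w ! (Suc i mod ?n)) = einv \<Gamma> (?e i)")
    case False
    interpret D: comm_group root_of_unity_group by (rule comm_group_roots)
    have "(\<lambda>_. 1) \<in> hom (VG v) root_of_unity_group"
      using D.one_closed by (intro homI) simp_all
    then show ?thesis using system_separating[OF bal vw(1)] False by (auto simp: A_def)
  next
    case True
    have eE: "?e i \<in> edges \<Gamma>" using gpath_nth(1)[OF path(2) i] .
    have V: "?w i \<in> verts \<Gamma>" using eE by (rule \<omega>_closed)
    interpret Gw: comm_group "VG (?w i)" using V by (rule vertex_comm)
    interpret H: group "EG (?e i)" using eE by (rule edge_group)
    interpret D: comm_group root_of_unity_group by (rule comm_group_roots)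
    let ?H = "\<phi> (einv \<Gamma> (?e i)) ` carrier (EG (?e i))"
    have "subgroup ?H (VG (?w i))"
      using group_hom.img_is_subgroup[of "EG (?e i)" "VG (?w i)" "\<phi> (einv \<Gamma> (?e i))"] edge_hom_pair(2)[OF eE]
      by (simp add: group_hom_def group_hom_axioms_def H.is_group Gw.is_group)
    moreover have "?a i \<notin> ?H" using path(3) i True by (auto simp: cyc_reduced_def)
    moreover have aV: "?a i \<in> carrier (VG (?w i))"
      using gpath_nth(2)[OF path(2), of "Suc i mod ?n"] path(1) True \<alpha>_einv[OF serre eE] by simp
    \<comment> \<open>Being trivial on the edge group but not at the vertex element of the turn,
      \<open>h\<close> has one and the same value, different from 1, on all of \<open>A i\<close>.
      So a single system avoids this possibly infinite set.\<close>
    ultimately obtain h where h: "h \<in> hom (VG (?w i)) root_of_unity_group" "\<forall>b\<in>?H. h b = 1" "h (?a i) \<noteq> 1"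
      using Gw.hom_separating[OF vertex_fg[OF V]] by blast
    obtain N where N: "compatible_system N" "\<forall>b\<in>N (?w i). h b = 1"
      using system_separating[OF bal V h(1)] by blast
    have "\<phi> (einv \<Gamma> (?e i)) z \<otimes>\<^bsub>VG (?w i)\<^esub> inv\<^bsub>VG (?w i)\<^esub> ?a i \<notin> N (?w i)" if z: "z \<in> carrier (EG (?e i))" for z
    proof
      let ?b = "\<phi> (einv \<Gamma> (?e i)) z"
      assume "?b \<otimes>\<^bsub>VG (?w i)\<^esub> inv\<^bsub>VG (?w i)\<^esub> ?a i \<in> N (?w i)"
      then have 1: "h (?b \<otimes>\<^bsub>VG (?w i)\<^esub> inv\<^bsub>VG (?w i)\<^esub> ?a i) = 1" using N(2) by blast
      have b: "?b \<in> carrier (VG (?w i))" "h ?b = 1" using \<phi>_einv_closed[OF eE z] h(2) z by auto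
      have "?b = (?b \<otimes>\<^bsub>VG (?w i)\<^esub> inv\<^bsub>VG (?w i)\<^esub> ?a i) \<otimes>\<^bsub>VG (?w i)\<^esub> ?a i"
        using b(1) aV by (simp add: Gw.m_assoc)
      then have "h ?b = h (?b \<otimes>\<^bsub>VG (?w i)\<^esub> inv\<^bsub>VG (?w i)\<^esub> ?a i) * h (?a i)"
        using hom_mult[OF h(1), of "?b \<otimes>\<^bsub>VG (?w i)\<^esub> inv\<^bsub>VG (?w i)\<^esub> ?a i" "?a i"] b(1) aV by simp
      then show False using 1 b(2) h(3) by simp
    qed
    then show ?thesis using N(1) True by (intro exI[of _ N]) (auto simp: A_def)
  qed
  from finitely_many_systems[OF bal, of ?n ?w A, OF this]
  obtain N where N: "compatible_system N" "\<forall>i<?n. N (?w i) \<inter> A i = {}" by blast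
  have sep: "\<phi> (einv \<Gamma> (?e i)) z \<otimes>\<^bsub>VG (?w i)\<^esub> inv\<^bsub>VG (?w i)\<^esub> ?a i \<notin> N (?w i)"
    if "i < ?n" "snd (w ! (Suc i mod ?n)) = einv \<Gamma> (?e i)" "z \<in> carrier (EG (?e i))" for i z
  proof -
    have "\<phi> (einv \<Gamma> (?e i)) z \<otimes>\<^bsub>VG (?w i)\<^esub> inv\<^bsub>VG (?w i)\<^esub> ?a i \<in> A i" using that by (auto simp: A_def)
    then show ?thesis using N(2) that(1) by blast
  qed
  have "\<exists>(S :: (('v \<Rightarrow> 'a set) \<times> nat) set) \<Phi> x. finite S \<and> \<Phi> \<in> hom G (shift_group S) \<and>
    x \<in> S \<times> UNIV \<and> \<Phi> (gval w) x = shift 1 x"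
    by (rule hyperbolic_action[OF N(1) path(2,1)]) (rule sep)
  then obtain S :: "(('v \<Rightarrow> 'a set) \<times> nat) set" and \<Phi> x where S: "finite S" "\<Phi> \<in> hom G (shift_group S)"
    "x \<in> S \<times> UNIV" "\<Phi> (gval w) x = shift 1 x" by (elim exE conjE)
  from G.detect_infinite_conjugate[OF S(2,1) g path(4) S(3,4)] show ?thesis by simp
qed

lemma finite_elliptic_retract:
  assumes bal: "balanced G" and g: "g \<in> carrier G" and u: "u \<in> verts \<Gamma>" and a: "a \<in> carrier (VG u)"
    and conj: "conjugate_in G g (\<iota> u a)" and fin: "group.ord (VG u) a \<noteq> 0"
  shows "virtual_retract (range (\<lambda>i::int. g [^]\<^bsub>G\<^esub> i)) G"
proof -
  interpret Gu: comm_group "VG u" using u by (rule vertex_comm)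
  let ?n = "Gu.ord a"
  \<comment> \<open>The nontrivial powers of \<open>a\<close>, finitely many since \<open>a\<close>
    has finite order. Avoiding them makes \<open>N u\<close> meet the powers of \<open>a\<close>
    trivially.\<close>
  define A where "A = (\<lambda>i::nat. {a [^]\<^bsub>VG u\<^esub> i} - {\<one>\<^bsub>VG u\<^esub>})"
  have "\<exists>N. compatible_system N \<and> N u \<inter> A i = {}" if "i < ?n" for i
  proof (cases "a [^]\<^bsub>VG u\<^esub> i = \<one>\<^bsub>VG u\<^esub>")
    case True
    interpret D: comm_group root_of_unity_group by (rule comm_group_roots)
    have "(\<lambda>_. 1) \<in> hom (VG v) root_of_unity_group"
      using D.one_closed by (intro homI) simp_all
    then show ?thesis using system_separating[OF bal vw(1)] True by (auto simp: A_def)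
  next
    case False
    have ai: "a [^]\<^bsub>VG u\<^esub> i \<in> carrier (VG u)" using a by simp
    obtain h where h: "h \<in> hom (VG u) root_of_unity_group" "h (a [^]\<^bsub>VG u\<^esub> i) \<noteq> 1"
      using Gu.hom_separating[OF vertex_fg[OF u] Gu.triv_subgroup ai] False by auto
    then show ?thesis using system_separating[OF bal u h(1)] by (auto simp: A_def)
  qed
  from finitely_many_systems[OF bal, of ?n "\<lambda>_. u" A, OF this]
  obtain N where N: "compatible_system N" "\<forall>i<?n. N u \<inter> A i = {}" by blast
  have a_pow: "a [^]\<^bsub>VG u\<^esub> i = \<one>\<^bsub>VG u\<^esub>" if i: "a [^]\<^bsub>VG u\<^esub> i \<in> N u" for i :: int
  proof -
    let ?k = "nat (i mod int ?n)"
    have k: "int ?k = i mod int ?n" "?k < ?n" using fin by (auto simp: nat_less_iff)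
    have "a [^]\<^bsub>VG u\<^esub> i = a [^]\<^bsub>VG u\<^esub> (int ?k)"
      unfolding Gu.int_pow_eq[OF a] k(1) by (simp add: mod_eq_dvd_iff[symmetric])
    then have eq: "a [^]\<^bsub>VG u\<^esub> i = a [^]\<^bsub>VG u\<^esub> ?k" by (simp only: int_pow_int)
    have "N u \<inter> A ?k = {}" using N(2) k(2) by blast
    then show ?thesis using i unfolding eq A_def by blast
  qed
  obtain S :: "(('v \<Rightarrow> 'a set) \<times> nat) set" and \<Phi> where S: "finite S" "\<Phi> \<in> hom G (shift_group S)"
    "\<forall>v\<in>verts \<Gamma>. \<forall>a\<in>carrier (VG v). (\<forall>x\<in>S. fst (\<Phi> (\<iota> v a) (x, 0)) = x) \<longrightarrow> a \<in> N v"
    using torsion_action[OF N(1)] by (elim exE conjE)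
  obtain h where h: "h \<in> carrier G" "h \<otimes>\<^bsub>G\<^esub> g \<otimes>\<^bsub>G\<^esub> inv\<^bsub>G\<^esub> h = \<iota> u a"
    using conj by (auto simp: conjugate_in_def)
  have pow: "h \<otimes>\<^bsub>G\<^esub> g [^]\<^bsub>G\<^esub> i \<otimes>\<^bsub>G\<^esub> inv\<^bsub>G\<^esub> h = \<iota> u (a [^]\<^bsub>VG u\<^esub> i)" for i :: int
    using G.conjugate_pow[OF g h(1), of i] h(2) hom_int_pow[OF \<iota>_hom[OF u] a Gu.is_group G.is_group, of i] by simp
  show ?thesis
  proof (rule G.detect_finite[OF S(2,1) g])
    \<comment> \<open>If a power of \<open>g\<close> acts trivially, so does its conjugate, the same
      power of \<open>a\<close>. That power then lies in \<open>N u\<close>, so it is trivial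
      already in the vertex group, and the power of \<open>g\<close> is trivial in
      \<open>G\<close>.\<close>
    fix i :: int assume triv: "\<And>y. y \<in> S \<Longrightarrow> fst (\<Phi> (g [^]\<^bsub>G\<^esub> i) (y, 0)) = y"
    have "fst (\<Phi> (\<iota> u (a [^]\<^bsub>VG u\<^esub> i)) (y, 0)) = y" if "y \<in> S" for y
      using G.trivial_action_conjugate[OF S(2) _ h(1) triv that] g pow by simp
    then have "a [^]\<^bsub>VG u\<^esub> i \<in> N u" using S(3) u a by blast
    then have "a [^]\<^bsub>VG u\<^esub> i = \<one>\<^bsub>VG u\<^esub>" by (rule a_pow)
    then have "h \<otimes>\<^bsub>G\<^esub> g [^]\<^bsub>G\<^esub> i \<otimes>\<^bsub>G\<^esub> inv\<^bsub>G\<^esub> h = \<one>\<^bsub>G\<^esub>"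
      using pow hom_one[OF \<iota>_hom[OF u] Gu.is_group G.is_group] by simp
    then have "h \<otimes>\<^bsub>G\<^esub> g [^]\<^bsub>G\<^esub> i = \<one>\<^bsub>G\<^esub> \<otimes>\<^bsub>G\<^esub> h"
      using h(1) g by (metis G.inv_solve_right G.int_pow_closed G.m_closed G.one_closed)
    then show "g [^]\<^bsub>G\<^esub> i = \<one>\<^bsub>G\<^esub>"
      using h(1) g by (metis G.int_pow_closed G.l_cancel G.l_one G.one_closed G.r_one)
  qed
qed

text \<open>The two families are the coordinates of a homomorphism to an extension of \<open>\<int>/2\<close> by \<open>\<int>\<^sup>2\<close>
  in which the stable letter of \<open>e\<close> swaps the coordinates.\<close>

lemma infinite_elliptic_retract:
  assumes bal: "balanced G" and g: "g \<in> carrier G" and u: "u \<in> verts \<Gamma>" and a: "a \<in> carrier (VG u)"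
    and conj: "conjugate_in G g (\<iota> u a)" and inf: "group.ord (VG u) a = 0"
  shows "virtual_retract (range (\<lambda>i::int. g [^]\<^bsub>G\<^esub> i)) G"
proof -
  interpret Gu: comm_group "VG u" using u by (rule vertex_comm)
  interpret D: comm_group rat_group by (rule comm_group_rat)
  have "i = 0" if "a [^]\<^bsub>VG u\<^esub> i = \<one>\<^bsub>VG u\<^esub>" for i :: int
    using that inf by (simp add: Gu.int_pow_eq_id[OF a])
  then obtain h where h: "h \<in> hom (VG u) rat_group" "h a = 1"
    using Gu.hom_rat[OF vertex_fg[OF u] a] by blast
  obtain f where f: "family T rat_group f" "f u = h"
    by (rule family_of_hom[OF T divisible_rat u h(1)])
  have f_pow: "f v (c [^]\<^bsub>VG v\<^esub> i) = of_int i * f v c" "f w (d [^]\<^bsub>VG w\<^esub> i) = of_int i * f w d" for i :: int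
    using f(1) hom_int_pow[OF _ cd(1) vertex_group[OF vw(1)] D.is_group, of "f v"]
      hom_int_pow[OF _ cd(2) vertex_group[OF vw(2)] D.is_group, of "f w"] vw by (auto simp: family_def rat_int_pow)
  obtain f' where f': "family T rat_group f'" "f' v c = f w d" "f' w d = f v c"
  proof (cases "\<forall>i::int. z\<^sub>0 [^]\<^bsub>EG e\<^esub> i = \<one>\<^bsub>EG e\<^esub> \<longrightarrow> i = 0")
    case True
    show ?thesis by (rule swapped_family[OF bal _ divisible_rat f(1)]) (use True that in auto)
  next
    \<comment> \<open>Here \<open>c\<close> and \<open>d\<close> are torsion, so rational values on
      them vanish and \<open>f\<close> is its own swap.\<close>
    case False
    then obtain i :: int where i: "z\<^sub>0 [^]\<^bsub>EG e\<^esub> i = \<one>\<^bsub>EG e\<^esub>" "i \<noteq> 0" by blast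
    have "c [^]\<^bsub>VG v\<^esub> i = \<one>\<^bsub>VG v\<^esub>" "d [^]\<^bsub>VG w\<^esub> i = \<one>\<^bsub>VG w\<^esub>"
      using \<phi>_pow[of i] edge_hom_pair(5,6)[OF e(1)] unfolding i(1) by auto
    then have "of_int i * f v c = 0" "of_int i * f w d = 0"
      using f_pow[of i] f_pow[of 0] by simp_all
    then have "f v c = 0" "f w d = 0" using i(2) by auto
    then show ?thesis using that[OF f(1)] by simp
  qed
  have hom: "k x \<in> hom (VG x) rat_group" if "family T rat_group k" "x \<in> verts \<Gamma>" for k x
    using that by (simp add: family_def)
  have "\<exists>m::nat>0. \<forall>x\<in>verts \<Gamma>. (\<forall>b\<in>carrier (VG x). of_nat m * k x b \<in> \<int>)"
    if k: "family T rat_group k" for k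
  proof (rule common_multiple[OF finite_verts])
    fix x assume "x \<in> verts \<Gamma>"
    then show "\<exists>m::nat>0. \<forall>b\<in>carrier (VG x). of_nat m * k x b \<in> \<int>"
      using group.hom_rat_denominator[OF vertex_group vertex_fg hom[OF k]] by blast
  next
    fix x and m l :: nat assume m: "\<forall>b\<in>carrier (VG x). of_nat m * k x b \<in> \<int>"
    show "\<forall>b\<in>carrier (VG x). of_nat (l * m) * k x b \<in> \<int>"
    proof
      fix b assume "b \<in> carrier (VG x)"
      from Ints_mult[OF Ints_of_nat[of l] bspec[OF m this]] show "of_nat (l * m) * k x b \<in> \<int>" by (simp add: mult.assoc)
    qed
  qed
  from this[OF f(1)] this[OF f'(1)] obtain m m' :: nat where m: "m > 0" "m' > 0"
    "\<forall>x\<in>verts \<Gamma>. \<forall>b\<in>carrier (VG x). of_nat m * f x b \<in> \<int>"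
    "\<forall>x\<in>verts \<Gamma>. \<forall>b\<in>carrier (VG x). of_nat m' * f' x b \<in> \<int>" by blast
  \<comment> \<open>A common denominator: \<open>M\<close> times either family is integral on all
    vertex groups, so the floor in \<open>F\<close> is exact.\<close>
  define M where "M = m * m'"
  define F where "F = (\<lambda>i x b. \<lfloor>of_nat M * (if i then f x b else f' x b)\<rfloor>)"
  have F: "rat_of_int (F i x b) = of_nat M * (if i then f x b else f' x b)"
    if "x \<in> verts \<Gamma>" "b \<in> carrier (VG x)" for i x b
  proof -
    have "of_nat m' * (of_nat m * f x b) \<in> \<int>" "of_nat m * (of_nat m' * f' x b) \<in> \<int>"
      using m(3,4) that by (auto intro!: Ints_mult[OF Ints_of_nat])
    then have "of_nat M * (if i then f x b else f' x b) \<in> \<int>"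
      by (simp add: M_def mult.assoc mult.left_commute)
    then show ?thesis unfolding F_def by (rule of_int_floor)
  qed
  \<comment> \<open>Two copies of the integers: \<open>True\<close> carries \<open>f\<close> and
    \<open>False\<close> carries \<open>f'\<close>. Vertex elements translate each copy, and
    \<open>t\<close> exchanges the copies.\<close>
  let ?S = "UNIV :: bool set"
  let ?Q = "shift_group ?S"
  interpret Q: group ?Q by (rule group_shift_group)
  define \<psi> where "\<psi> = (\<lambda>x b. lift_shift ?S id (\<lambda>i. F i x b))"
  define t where "t = lift_shift ?S Not (\<lambda>_. 0)"
  have F_mult: "F i x (b \<otimes>\<^bsub>VG x\<^esub> b') = F i x b + F i x b'"
    if x: "x \<in> verts \<Gamma>" "b \<in> carrier (VG x)" "b' \<in> carrier (VG x)" for i x b b'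
  proof -
    interpret Gx: comm_group "VG x" using x(1) by (rule vertex_comm)
    have "rat_of_int (F i x (b \<otimes>\<^bsub>VG x\<^esub> b')) = rat_of_int (F i x b + F i x b')"
      using F[OF x(1)] x hom_mult[OF hom[OF f(1) x(1)] x(2,3)] hom_mult[OF hom[OF f'(1) x(1)] x(2,3)]
      by (simp add: distrib_left)
    then show ?thesis by (simp only: of_int_eq_iff)
  qed
  have "family T ?Q \<psi>"
    unfolding family_def
  proof (intro conjI ballI)
    fix x assume x: "x \<in> verts \<Gamma>"
    show "\<psi> x \<in> hom (VG x) ?Q"
    proof (rule homI)
      fix b b' assume b: "b \<in> carrier (VG x)" "b' \<in> carrier (VG x)"
      show "\<psi> x b \<in> carrier ?Q" unfolding \<psi>_def by (rule lift_shift_closed) simp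
      show "\<psi> x (b \<otimes>\<^bsub>VG x\<^esub> b') = \<psi> x b \<otimes>\<^bsub>?Q\<^esub> \<psi> x b'"
        using F_mult[OF x b] by (simp add: \<psi>_def lift_shift_comp add.commute id_def)
    qed
  next
    fix k z assume k: "k \<in> edges T" "z \<in> carrier (EG k)"
    then have "F i (\<alpha>_of \<Gamma> k) (\<phi> k z) = F i (\<omega>_of \<Gamma> k) (\<phi> (einv \<Gamma> k) z)" for i
      using f(1) f'(1) by (simp add: F_def family_def)
    then show "\<psi> (\<alpha>_of \<Gamma> k) (\<phi> k z) = \<psi> (\<omega>_of \<Gamma> k) (\<phi> (einv \<Gamma> k) z)"
      by (simp add: \<psi>_def)
  qed
  moreover have "t \<in> carrier ?Q"
    unfolding t_def by (rule lift_shift_closed) (rule bij_betw_byWitness[of _ Not], auto)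
  \<comment> \<open>Moving the exchange of copies past \<open>\<psi> w d\<close> turns it into
    \<open>\<psi> v c\<close> precisely because \<open>f'\<close> swaps the values of
    \<open>f\<close> at \<open>c\<close> and \<open>d\<close>.\<close>
  moreover have "t \<otimes>\<^bsub>?Q\<^esub> \<psi> w d = \<psi> v c \<otimes>\<^bsub>?Q\<^esub> t"
    using f'(2,3) by (simp add: t_def \<psi>_def lift_shift_comp F_def) (rule lift_shift_cong, auto)
  ultimately obtain \<Phi> p where \<Phi>: "\<Phi> \<in> hom G ?Q" "\<And>x. x \<in> verts \<Gamma> \<Longrightarrow> p x \<in> carrier ?Q"
    "\<And>x b. x \<in> verts \<Gamma> \<Longrightarrow> b \<in> carrier (VG x) \<Longrightarrow> \<Phi> (\<iota> x b) = p x \<otimes>\<^bsub>?Q\<^esub> \<psi> x b \<otimes>\<^bsub>?Q\<^esub> inv\<^bsub>?Q\<^esub> p x"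
    using tree_gauged_hom[OF Q.is_group] by blast
  note pu = \<Phi>(2)[OF u]
  let ?x = "p u (True, 0)"
  have "\<Phi> (\<iota> u a) ?x = p u (shift (F True u a) (True, 0))"
    using \<Phi>(3)[OF u a] inv_shift_group[OF pu] bij_is_inj[OF shift_groupD(1)[OF pu]]
    by (simp add: \<psi>_def shift_def)
  also have "\<dots> = shift (F True u a) ?x" by (rule shift_groupD(2)[OF pu])
  finally have "\<Phi> (\<iota> u a) ?x = shift (F True u a) ?x" .
  moreover have "F True u a \<noteq> 0"
    using F[OF u a, of True] h(2) f(2) m(1,2) by (auto simp: M_def)
  ultimately show ?thesis
    using G.detect_infinite_conjugate[OF \<Phi>(1) _ g conj, of ?x] by (simp add: mem_Times_iff)
qed

theorem balanced_imp_VRC: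
  assumes "balanced G"
  shows "property_VRC G"
proof (rule G.VRC_by_elements)
  fix g assume g: "g \<in> carrier G"
  from elliptic_or_hyperbolic[OF g] show "virtual_retract (range (\<lambda>i::int. g [^]\<^bsub>G\<^esub> i)) G"
    using hyperbolic_retract[OF assms g] finite_elliptic_retract[OF assms g]
      infinite_elliptic_retract[OF assms g] unfolding elliptic_def by blast
qed

end

theorem corollary10p3:
  fixes \<Gamma> :: "('v, 'e) pregraph"
    and VG :: "'v \<Rightarrow> 'a monoid"
    and EG :: "'e \<Rightarrow> 'b monoid"
    and \<phi> :: "'e \<Rightarrow> 'b \<Rightarrow> 'a"
    and T\<^sub>0 :: "('v, 'e) pregraph"
    and P :: "'e set"
    and G :: "('v, 'e, 'a) gog_gen word set monoid"
  assumes "finite_graph_of_groups \<Gamma> VG EG \<phi>"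
    and "maximal_tree T\<^sub>0 \<Gamma>"
    and "orientation \<Gamma> P"
    and "G = fundamental_group \<Gamma> VG EG \<phi> T\<^sub>0 P"
    and "euler_char \<Gamma> = 0"
    and "\<forall>v\<in>verts \<Gamma>. comm_group (VG v) \<and> finitely_generated_group (VG v)"
    and "\<exists>e\<in>edges \<Gamma>. (\<exists>T. maximal_tree T \<Gamma> \<and> e \<notin> edges T) \<and> cyclic_group (EG e)"
  shows "property_VRC G \<longleftrightarrow> balanced G"
proof -
  interpret finite_graph_of_groups \<Gamma> VG EG \<phi> by fact
  obtain e T where e: "e \<in> edges \<Gamma>" "e \<notin> edges T" "maximal_tree T \<Gamma>" "cyclic_group (EG e)"
    using assms(7) by blast
  interpret H: group "EG e" using e(1) by (rule edge_group)
  obtain z where z: "z \<in> carrier (EG e)" "carrier (EG e) = range (\<lambda>i::int. z [^]\<^bsub>EG e\<^esub> i)"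
    using e(4) unfolding H.cyclic_group by blast
  have "serre_graph \<Gamma>" by unfold_locales
  then have "edges \<Gamma> = edges T \<union> {e, einv \<Gamma> e}"
    using unicyclic_edges(1)[OF _ connected finite_verts finite_edges assms(5) e(3,1,2)] by blast
  then interpret M: marked_graph_of_groups \<Gamma> VG EG \<phi> T\<^sub>0 P T e z
    using assms(1-3,6) e z
    by (intro marked_graph_of_groups.intro abelian_graph_of_groups.intro graph_of_groups_presentation.intro
        graph_of_groups_presentation_axioms.intro abelian_graph_of_groups_axioms.intro
        marked_graph_of_groups_axioms.intro) simp_all
  show ?thesis
    unfolding assms(4) using M.balanced_imp_VRC M.G.VRC_imp_balanced by blast
qed

end
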